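(* Let $(\alpha_1,\alpha_2)\in(0,1)\times(0,1)$, $\lambda>0$, and let $N_{\alpha_1,\alpha_2}(t_1,t_2)$, $(t_1,t_2)\in\mathbb{R}_+^2$, be the fractional Poisson random field with parameter $\lambda$. Let $p_k^{\alpha_1,\alpha_2}(t_1,t_2)=\mathrm{P}(N_{\alpha_1,\alpha_2}(t_1,t_2)=k)$, $k=0,1,2,\ldots$ 1) The marginal distributions satisfy the following fractional differential-integral recurrent equations: $$\mathrm{D}^{\alpha_1,\alpha_2}_{t_1,t_2}p_0^{\alpha_1,\alpha_2}(t_1,t_2)=\int_0^\infty\!\!\int_0^\infty(-\lambda+\lambda^2x_1x_2)\,p_0^{\alpha_1,\alpha_2}(x_1,x_2)\,f_{\alpha_1}(t_1,x_1)f_{\alpha_2}(t_2,x_2)\,dx_1dx_2,$$ $$\mathrm{D}^{\alpha_1,\alpha_2}_{t_1,t_2}p_1^{\alpha_1,\alpha_2}(t_1,t_2)=\int_0^\infty\!\!\int_0^\infty\big[(-3\lambda+\lambda^2x_1x_2)\,p_1^{\alpha_1,\alpha_2}(x_1,x_2)+\lambda p_0^{\alpha_1,\alpha_2}(x_1,x_2)\big]f_{\alpha_1}(t_1,x_1)f_{\alpha_2}(t_2,x_2)\,dx_1dx_2,$$ and, for $k\ge 2$, $$\mathrm{D}^{\alpha_1,\alpha_2}_{t_1,t_2}p_k^{\alpha_1,\alpha_2}(t_1,t_2)=\int_0^\infty\!\!\int_0^\infty\big[(-\lambda+\lambda^2x_1x_2)\,p_k^{\alpha_1,\alpha_2}(x_1,x_2)+(\lambda-2\lambda^2x_1x_2)\,p_{k-1}^{\alpha_1,\alpha_2}(x_1,x_2)+\lambda^2x_1x_2\,p_{k-2}^{\alpha_1,\alpha_2}(x_1,x_2)\big]f_{\alpha_1}(t_1,x_1)f_{\alpha_2}(t_2,x_2)\,dx_1dx_2,$$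 with the initial conditions $$p_0^{\alpha_1,\alpha_2}(0,0)=1,\qquad p_k^{\alpha_1,\alpha_2}(0,0)=p_k^{\alpha_1,\alpha_2}(t_1,0)=p_k^{\alpha_1,\alpha_2}(0,t_2)=0,\quad k\ge 1.$$ 2) For $\alpha_1\to1$, $\alpha_2\to1$, one has $f_{\alpha_1}(t_1,x_1)\to\delta(t_1-x_1)$ and $f_{\alpha_2}(t_2,x_2)\to\delta(t_2-x_2)$ (weak convergence to the delta distribution), and hence the three equations in 1) become, respectively, the equations satisfied by the marginal distributions $p_k^c(t_1,t_2)=e^{-\lambda t_1t_2}(\lambda t_1t_2)^k/k!$, $k=0,1,2,\ldots$, of the classical Poisson random field: $$\frac{\partial^2p_0^c(t_1,t_2)}{\partial t_1\partial t_2}=(-\lambda+\lambda^2t_1t_2)p_0^c(t_1,t_2),$$ $$\frac{\partial^2p_1^c(t_1,t_2)}{\partial t_1\partial t_2}=(-3\lambda+\lambda^2t_1t_2)p_1^c(t_1,t_2)+\lambda p_0^c(t_1,t_2),$$ $$\frac{\partial^2p_k^c(t_1,t_2)}{\partial t_1\partial t_2}=(-\lambda+\lambda^2t_1t_2)p_k^c(t_1,t_2)+(\lambda-2\lambda^2t_1t_2)p_{k-1}^c(t_1,t_2)+\lambda^2t_1t_2\,p_{k-2}^c(t_1,t_2),\quad k\ge2.$$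
   Context: An inverse $\alpha$-stable subordinator, $\alpha\in(0,1)$, is $Y_\alpha(t)=\inf\{u\ge 0:L_\alpha(u)>t\}$ with $L_\alpha$ a Lévy subordinator with $\mathrm{E}e^{-sL_\alpha(t)}=e^{-ts^\alpha}$. For $t>0$, $f_\alpha(t,x)=\frac{d}{dx}\mathrm{P}\{Y_\alpha(t)\le x\}$, $x>0$, is its density; its Laplace transform is $\int_0^\infty e^{-st}f_\alpha(t,x)\,dt=s^{\alpha-1}e^{-xs^\alpha}$. A Poisson random field (PRF) with intensity $\lambda>0$ is a field $N(t_1,t_2)$ on $\mathbb{R}_+^2$ given by a homogeneous Poisson point process of intensity $\lambda$ with respect to Lebesgue measure ($N(t_1,t_2)$ counts points in $[0,t_1]\times[0,t_2]$). The fractional Poisson random field (FPRF) with parameter $\lambda$ is $N_{\alpha_1,\alpha_2}(t_1,t_2)=N(Y^{(1)}_{\alpha_1}(t_1),Y^{(2)}_{\alpha_2}(t_2))$, where $Y^{(1)}_{\alpha_1},Y^{(2)}_{\alpha_2}$ are independent inverse stable subordinators with indices $\alpha_1,\alpha_2$, independent of the PRF $N$ with intensity $\lambda$. The Caputo–Djrbashian mixed fractional derivative of order $(\alpha_1,\alpha_2)\in(0,1)\times(0,1)$ is $$\mathrm{D}^{\alpha_1,\alpha_2}_{t_1,t_2}u(t_1,t_2)=\frac{1}{\Gamma(1-\alpha_1)\Gamma(1-\alpha_2)}\int_0^{t_1}\!\!\int_0^{t_2}\frac{\partial^2u(\tau_1,\tau_2)}{\partial\tau_1\partial\tau_2}\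,\frac{d\tau_1\,d\tau_2}{(t_1-\tau_1)^{\alpha_1}(t_2-\tau_2)^{\alpha_2}}.$$
   Formalization: Under the integrals in part 1, the fractional probabilities p_k^{α1,α2}(x1,x2) are replaced by the classical p_k^c(x1,x2); as printed the system is false for all (α1,α2) in (0,1)², already at k=0 (Laplace injectivity would force p_0^{α1,α2}=p_0^c). *)

theory Defs
  imports "HOL-Probability.Probability"
begin

text \<open>A process is a function of time and outcome, \<open>X t \<omega>\<close>; times range over \<open>t \<ge> 0\<close>.\<close>

definition process_events :: "'a measure \<Rightarrow> 'i set \<Rightarrow> ('i \<Rightarrow> 'a \<Rightarrow> real) \<Rightarrow> 'a set set" where
  "process_events M T X =
     sigma_sets (space M) {X t -` A \<inter> space M | t A. t \<in> T \<and> A \<in> sets borel}"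

definition levy_process :: "'a measure \<Rightarrow> (real \<Rightarrow> 'a \<Rightarrow> real) \<Rightarrow> bool" where
  "levy_process M L \<longleftrightarrow>
     prob_space M
   \<and> (\<forall>t\<ge>0. L t \<in> borel_measurable M)
   \<and> (AE \<omega> in M. L 0 \<omega> = 0)
   \<and> (\<forall>(s :: nat \<Rightarrow> real) n. 0 \<le> s 0 \<and> incseq s \<longrightarrow>
        prob_space.indep_vars M (\<lambda>_. borel) (\<lambda>i \<omega>. L (s (Suc i)) \<omega> - L (s i) \<omega>) {..<n})
   \<and> (\<forall>s\<ge>0. \<forall>t\<ge>0. distr M borel (\<lambda>\<omega>. L (s + t) \<omega> - L s \<omega>) = distr M borel (L t))
   \<and> (AE \<omega> in M. (\<forall>t\<ge>0. ((\<lambda>u. L u \<omega>) \<longlongrightarrow> L t \<omega>) (at_right t))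
                \<and> (\<forall>t>0. \<exists>l. ((\<lambda>u. L u \<omega>) \<longlongrightarrow> l) (at_left t)))"

definition levy_subordinator :: "'a measure \<Rightarrow> (real \<Rightarrow> 'a \<Rightarrow> real) \<Rightarrow> bool" where
  "levy_subordinator M L \<longleftrightarrow>
     levy_process M L \<and> (AE \<omega> in M. mono_on {0..} (\<lambda>t. L t \<omega>))"

definition stable_subordinator :: "'a measure \<Rightarrow> real \<Rightarrow> (real \<Rightarrow> 'a \<Rightarrow> real) \<Rightarrow> bool" where
  "stable_subordinator M \<alpha> L \<longleftrightarrow>
     levy_subordinator M L
   \<and> (\<forall>t\<ge>0. \<forall>s\<ge>0. (\<integral>\<omega>. exp (- (s * L t \<omega>)) \<partial>M) = exp (- (t * s powr \<alpha>)))"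

text \<open>The infimum is taken of a nonempty set only almost surely, so the pathwise formula is
  required almost surely and measurability of \<open>Y t\<close> is required separately.\<close>

definition inverse_stable_subordinator :: "'a measure \<Rightarrow> real \<Rightarrow> (real \<Rightarrow> 'a \<Rightarrow> real) \<Rightarrow> bool" where
  "inverse_stable_subordinator M \<alpha> Y \<longleftrightarrow>
     (\<forall>t\<ge>0. Y t \<in> borel_measurable M)
   \<and> (\<exists>L. stable_subordinator M \<alpha> L
        \<and> (AE \<omega> in M. \<forall>t\<ge>0. Y t \<omega> = Inf {u. 0 \<le> u \<and> L u \<omega> > t}))"

definition process_density :: "'a measure \<Rightarrow> (real \<Rightarrow> 'a \<Rightarrow> real) \<Rightarrow> real \<Rightarrow> real \<Rightarrow> real" where
  "process_density M Y t x = deriv (\<lambda>y. measure M {\<omega> \<in> space M. Y t \<omega> \<le> y}) x"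

text \<open>A point process on the quadrant is a random locally finite set of points; no
  multiplicities are needed because the intensity measure has no atoms.  For \<open>measure lborel B = 0\<close>
  the formula below uses \<open>0 ^ 0 = 1\<close>.\<close>

definition poisson_point_process :: "'a measure \<Rightarrow> real \<Rightarrow> ('a \<Rightarrow> (real \<times> real) set) \<Rightarrow> bool" where
  "poisson_point_process M lam P \<longleftrightarrow>
     (let \<B> = {B \<in> sets borel. bounded B \<and> B \<subseteq> {0..} \<times> {0..}} in
       prob_space M
     \<and> (\<forall>\<omega>\<in>space M. P \<omega> \<subseteq> {0..} \<times> {0..} \<and> (\<forall>B. bounded B \<longrightarrow> finite (P \<omega> \<inter> B)))
     \<and> (\<forall>B\<in>\<B>. (\<lambda>\<omega>. card (P \<omega> \<inter> B)) \<in> measurable M (count_space UNIV))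
     \<and> (\<forall>B\<in>\<B>. \<forall>k. measure M {\<omega> \<in> space M. card (P \<omega> \<inter> B) = k} =
          exp (- (lam * measure lborel B)) * (lam * measure lborel B) ^ k / fact k)
     \<and> (\<forall>(B :: nat \<Rightarrow> _) n. (\<forall>i<n. B i \<in> \<B>) \<and> disjoint_family_on B {..<n} \<longrightarrow>
          prob_space.indep_vars M (\<lambda>_. count_space UNIV) (\<lambda>i \<omega>. card (P \<omega> \<inter> B i)) {..<n}))"

definition count_field :: "('a \<Rightarrow> (real \<times> real) set) \<Rightarrow> real \<Rightarrow> real \<Rightarrow> 'a \<Rightarrow> nat" where
  "count_field P t1 t2 \<omega> = card (P \<omega> \<inter> ({0..t1} \<times> {0..t2}))"

text \<open>The data of a fractional Poisson random field; the field itself is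
  \<open>fractional_count_field P Y1 Y2\<close>.\<close>

definition fractional_poisson_field ::
  "'a measure \<Rightarrow> real \<Rightarrow> real \<Rightarrow> real \<Rightarrow> ('a \<Rightarrow> (real \<times> real) set) \<Rightarrow>
   (real \<Rightarrow> 'a \<Rightarrow> real) \<Rightarrow> (real \<Rightarrow> 'a \<Rightarrow> real) \<Rightarrow> bool" where
  "fractional_poisson_field M lam \<alpha>1 \<alpha>2 P Y1 Y2 \<longleftrightarrow>
     poisson_point_process M lam P
   \<and> inverse_stable_subordinator M \<alpha>1 Y1
   \<and> inverse_stable_subordinator M \<alpha>2 Y2
   \<and> prob_space.indep_sets M
       (\<lambda>i. [process_events M {0..} Y1,
             process_events M {0..} Y2,
             process_events M ({0..} \<times> {0..}) (\<lambda>(t1, t2) \<omega>. real (count_field P t1 t2 \<omega>))] ! i)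
       {..<3}"

definition fractional_count_field ::
  "('a \<Rightarrow> (real \<times> real) set) \<Rightarrow> (real \<Rightarrow> 'a \<Rightarrow> real) \<Rightarrow> (real \<Rightarrow> 'a \<Rightarrow> real) \<Rightarrow>
   real \<Rightarrow> real \<Rightarrow> 'a \<Rightarrow> nat" where
  "fractional_count_field P Y1 Y2 t1 t2 \<omega> = count_field P (Y1 t1 \<omega>) (Y2 t2 \<omega>) \<omega>"

definition fpf_prob ::
  "'a measure \<Rightarrow> ('a \<Rightarrow> (real \<times> real) set) \<Rightarrow> (real \<Rightarrow> 'a \<Rightarrow> real) \<Rightarrow> (real \<Rightarrow> 'a \<Rightarrow> real) \<Rightarrow>
   nat \<Rightarrow> real \<Rightarrow> real \<Rightarrow> real" where
  "fpf_prob M P Y1 Y2 k t1 t2 =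
     measure M {\<omega> \<in> space M. fractional_count_field P Y1 Y2 t1 t2 \<omega> = k}"

definition classical_prob :: "real \<Rightarrow> nat \<Rightarrow> real \<Rightarrow> real \<Rightarrow> real" where
  "classical_prob lam k t1 t2 = exp (- (lam * t1 * t2)) * (lam * t1 * t2) ^ k / fact k"

definition mixed_deriv :: "(real \<Rightarrow> real \<Rightarrow> real) \<Rightarrow> real \<Rightarrow> real \<Rightarrow> real" where
  "mixed_deriv u t1 t2 = deriv (\<lambda>r1. deriv (\<lambda>r2. u r1 r2) t2) t1"

text \<open>As \<open>deriv\<close> is a total function, existence of the derivatives is stated separately.  The
  inner derivative has to exist for all first arguments close to \<open>t1\<close>.\<close>

definition mixed_differentiable :: "(real \<Rightarrow> real \<Rightarrow> real) \<Rightarrow> real \<Rightarrow> real \<Rightarrow> bool" where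
  "mixed_differentiable u t1 t2 \<longleftrightarrow>
     (\<forall>\<^sub>F r1 in nhds t1. (\<lambda>r2. u r1 r2) differentiable (at t2))
   \<and> (\<lambda>r1. deriv (\<lambda>r2. u r1 r2) t2) differentiable (at t1)"

definition caputo_integrand ::
  "real \<Rightarrow> real \<Rightarrow> (real \<Rightarrow> real \<Rightarrow> real) \<Rightarrow> real \<Rightarrow> real \<Rightarrow> real \<times> real \<Rightarrow> real" where
  "caputo_integrand \<alpha>1 \<alpha>2 u t1 t2 =
     (\<lambda>(r1, r2). mixed_deriv u r1 r2 / ((t1 - r1) powr \<alpha>1 * (t2 - r2) powr \<alpha>2))"

definition caputo_mixed ::
  "real \<Rightarrow> real \<Rightarrow> (real \<Rightarrow> real \<Rightarrow> real) \<Rightarrow> real \<Rightarrow> real \<Rightarrow> real" where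
  "caputo_mixed \<alpha>1 \<alpha>2 u t1 t2 =
     1 / (Gamma (1 - \<alpha>1) * Gamma (1 - \<alpha>2)) *
     (LINT r : {0<..<t1} \<times> {0<..<t2} | lborel. caputo_integrand \<alpha>1 \<alpha>2 u t1 t2 r)"

definition caputo_mixed_exists ::
  "real \<Rightarrow> real \<Rightarrow> (real \<Rightarrow> real \<Rightarrow> real) \<Rightarrow> real \<Rightarrow> real \<Rightarrow> bool" where
  "caputo_mixed_exists \<alpha>1 \<alpha>2 u t1 t2 \<longleftrightarrow>
     (\<forall>r1 \<in> {0<..<t1}. \<forall>r2 \<in> {0<..<t2}. mixed_differentiable u r1 r2)
   \<and> set_integrable lborel ({0<..<t1} \<times> {0<..<t2}) (caputo_integrand \<alpha>1 \<alpha>2 u t1 t2)"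

text \<open>The right-hand side of the recurrent equations, for a sequence of functions \<open>p\<close>.  It is used
  with \<open>p = classical_prob lam\<close> in the fractional equations as well: there \<open>(x1, x2)\<close> runs over the
  values of the two inverse subordinators, and given these values the probabilities of the
  subordinated field are \<open>classical_prob lam k x1 x2\<close>.  (With the fractional probabilities in their
  place the equations fail.)\<close>

definition recurrence_rhs ::
  "real \<Rightarrow> (nat \<Rightarrow> real \<Rightarrow> real \<Rightarrow> real) \<Rightarrow> nat \<Rightarrow> real \<Rightarrow> real \<Rightarrow> real" where
  "recurrence_rhs lam p k x1 x2 =
     (if k = 0 then (- lam + lam\<^sup>2 * x1 * x2) * p 0 x1 x2
      else if k = 1 then (- 3 * lam + lam\<^sup>2 * x1 * x2) * p 1 x1 x2 + lam * p 0 x1 x2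
      else (- lam + lam\<^sup>2 * x1 * x2) * p k x1 x2
           + (lam - 2 * lam\<^sup>2 * x1 * x2) * p (k - 1) x1 x2
           + lam\<^sup>2 * x1 * x2 * p (k - 2) x1 x2)"

definition averaged_integrand ::
  "(real \<Rightarrow> real \<Rightarrow> real) \<Rightarrow> (real \<Rightarrow> real \<Rightarrow> real) \<Rightarrow> (real \<Rightarrow> real \<Rightarrow> real) \<Rightarrow>
   real \<Rightarrow> real \<Rightarrow> real \<times> real \<Rightarrow> real" where
  "averaged_integrand g f1 f2 t1 t2 = (\<lambda>(x1, x2). g x1 x2 * f1 t1 x1 * f2 t2 x2)"

definition averaged ::
  "(real \<Rightarrow> real \<Rightarrow> real) \<Rightarrow> (real \<Rightarrow> real \<Rightarrow> real) \<Rightarrow> (real \<Rightarrow> real \<Rightarrow> real) \<Rightarrow>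
   real \<Rightarrow> real \<Rightarrow> real" where
  "averaged g f1 f2 t1 t2 =
     (LINT x : {0<..} \<times> {0<..} | lborel. averaged_integrand g f1 f2 t1 t2 x)"

end

theory Submission
  imports Defs
begin

text \<open>
  Let \<open>S\<close> be the subordinator at time one. Its Laplace transform gives
  \<open>E V(S) = c * (\<integral>r>0. r powr - \<alpha> * E (V(S + r) / (S + r)))\<close> with \<open>c = \<alpha> / Gamma (1 - \<alpha>)\<close> for all \<open>V \<ge> 0\<close>.
  Iterated, this identity yields a continuous density of \<open>S\<close> on the positive half-line; by self-similarity the
  inverse subordinator at time \<open>t\<close> is distributed like \<open>(t / S) powr \<alpha>\<close>, so its distribution function is
  continuously differentiable. After the substitution \<open>S + r = S * t / \<tau>\<close> the same identity says that the Caputo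
  derivative in \<open>t\<close> of \<open>E g(Y t)\<close> is \<open>E g'(Y t)\<close>. By independence the probabilities of the fractional field are the
  expectations of the classical ones at \<open>(Y1 t1, Y2 t2)\<close>, so the fractional equations follow from the classical
  mixed derivative by applying the identity in each variable. As the indices tend to one, \<open>exp (- S)\<close> has constant
  mean and vanishing variance, hence the inverse subordinators converge in probability to the deterministic times.
\<close>

text \<open>The identity is the size-biasing formula of an infinitely divisible law:
  \<open>stable_const * r powr - \<alpha>\<close> is \<open>r\<close> times the Levy density of the
  subordinator, and \<open>E (S * V S)\<close> is the integral of \<open>E (V (S + r))\<close>
  against it. Moving the factor \<open>S\<close> to the other side leaves a statement whose
  transform at zero is the total mass, so uniqueness of transforms applies to a probability measure.
  The obstacle is that the stable density has no elementary closed form while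
  \<open>process_density\<close> is a pointwise \<open>deriv\<close> of a distribution function: a
  density that exists almost everywhere would not do, hence the iteration up to a continuous kernel.
  Differentiability in time is cheaper. By self-similarity the times enter the probabilities only
  through \<open>t1 powr \<alpha>1 * t2 powr \<alpha>2\<close>, so one function of one variable is
  differentiated under the expectation, and the moments \<open>E (S powr - \<alpha>)\<close> suffice
  because \<open>z\<close> times the second derivative of a Poisson weight is bounded. These moments
  are finite since the Caputo identity for a constant function would otherwise fail.\<close>

section \<open>The one-sided stable law\<close>

text \<open>The map \<open>exp (- x)\<close> carries the half-line into \<open>{0..1}\<close> and
  turns the transforms at natural numbers into moments. Polynomials are dense there by
  Stone-Weierstrass, so the moments fix the expectations of all continuous functions of
  \<open>exp (- x)\<close>, and these fix the distribution function.\<close>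

lemma laplace_transform_unique:
  assumes "real_distribution M" "real_distribution N"
    and M0: "AE x in M. 0 \<le> x" and N0: "AE x in N. 0 \<le> x"
    and eq: "\<And>n::nat. (\<integral>x. exp (- (real n * x)) \<partial>M) = (\<integral>x. exp (- (real n * x)) \<partial>N)"
  shows "M = N"
proof -
  interpret M: real_distribution M by fact
  interpret N: real_distribution N by fact
  have bnd: "integrable K (\<lambda>x. f (exp (- x)))"
    if "real_distribution K" "AE x in K. 0 \<le> x" "continuous_on UNIV f" for K and f :: "real \<Rightarrow> real"
  proof -
    interpret K: real_distribution K by fact
    have "compact (f ` {0..1})"
      using that(3) by (intro compact_continuous_image) (auto intro: continuous_on_subset)
    then obtain B where "\<forall>y\<in>f ` {0..1}. norm y \<le> B"
      using compact_imp_bounded bounded_iff by metis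
    then have B: "\<And>y. 0 \<le> y \<Longrightarrow> y \<le> 1 \<Longrightarrow> \<bar>f y\<bar> \<le> B" by auto
    have [measurable]: "f \<in> borel_measurable borel"
      using that(3) by (rule borel_measurable_continuous_onI)
    show ?thesis
    proof (rule K.integrable_const_bound[where B=B])
      show "AE x in K. norm (f (exp (- x))) \<le> B"
        using that(2) by eventually_elim (auto intro!: B)
    qed measurable
  qed
  have cont: "(\<integral>x. f (exp (- x)) \<partial>M) = (\<integral>x. f (exp (- x)) \<partial>N)"
    if f: "continuous_on UNIV f" for f :: "real \<Rightarrow> real"
  proof -
    have eps: "\<bar>(\<integral>x. f (exp (- x)) \<partial>M) - (\<integral>x. f (exp (- x)) \<partial>N)\<bar> \<le> 0 + e" if e: "0 < e" for e
    proof -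
      obtain g where g: "real_polynomial_function g" "\<And>y. y \<in> {0..1} \<Longrightarrow> \<bar>f y - g y\<bar> < e / 2"
        using Stone_Weierstrass_real_polynomial_function[of "{0..1::real}" f "e/2"] f e
        by (auto intro: continuous_on_subset)
      then obtain a n where g_eq: "g = (\<lambda>x. \<Sum>i\<le>n. a i * x ^ i)"
        by (auto simp: real_polynomial_function_iff_sum)
      have gc: "continuous_on UNIV g" unfolding g_eq by (intro continuous_intros)
      have g_int: "(\<integral>x. g (exp (- x)) \<partial>K) = (\<Sum>i\<le>n. a i * (\<integral>x. exp (- (real i * x)) \<partial>K))"
        if "real_distribution K" "AE x in K. 0 \<le> x" for K
        unfolding g_eq
        using bnd[OF that, of "\<lambda>y. y ^ i" for i]
        by (simp add: exp_of_nat_mult[symmetric] continuous_intros)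
      have close: "\<bar>(\<integral>x. f (exp (- x)) \<partial>K) - (\<integral>x. g (exp (- x)) \<partial>K)\<bar> \<le> e / 2"
        if K: "real_distribution K" "AE x in K. 0 \<le> x" for K
      proof -
        interpret K: real_distribution K by fact
        have i: "integrable K (\<lambda>x. f (exp (- x)))" "integrable K (\<lambda>x. g (exp (- x)))"
          using bnd[OF K f] bnd[OF K gc] by auto
        have "\<bar>(\<integral>x. f (exp (- x)) \<partial>K) - (\<integral>x. g (exp (- x)) \<partial>K)\<bar>
            = \<bar>\<integral>x. f (exp (- x)) - g (exp (- x)) \<partial>K\<bar>" using i by simp
        also have "\<dots> \<le> (\<integral>x. \<bar>f (exp (- x)) - g (exp (- x))\<bar> \<partial>K)" by (rule integral_abs_bound)
        also have "\<dots> \<le> (\<integral>x. e / 2 \<partial>K)"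
        proof (rule integral_mono_AE)
          show "AE x in K. \<bar>f (exp (- x)) - g (exp (- x))\<bar> \<le> e / 2"
            using K(2) by eventually_elim (rule less_imp_le[OF g(2)], auto)
        qed (use i in auto)
        finally show ?thesis using K.prob_space by simp
      qed
      have "(\<integral>x. g (exp (- x)) \<partial>M) = (\<integral>x. g (exp (- x)) \<partial>N)"
        using g_int[OF assms(1) M0] g_int[OF assms(2) N0] eq by simp
      then show ?thesis
        using close[OF assms(1) M0] close[OF assms(2) N0] by linarith
    qed
    show ?thesis using field_le_epsilon[OF eps] by simp
  qed
  \<comment> \<open>Continuous in \<open>y\<close>, equal to 1 for \<open>y \<ge> exp (- a)\<close>
    and, for positive \<open>n\<close>, to 0 below \<open>exp (- a) - 1 / n\<close>: at
    \<open>y = exp (- x)\<close> these ramps decrease to the indicator of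
    \<open>{..a}\<close>.\<close>
  define r where "r = (\<lambda>(n::nat) a y :: real. max 0 (min 1 (1 + real n * (y - exp (- a)))))"
  have r_lim: "(\<lambda>n. \<integral>x. r n a (exp (- x)) \<partial>K) \<longlonglongrightarrow> (\<integral>x. indicator {..a} x \<partial>K)"
    if "real_distribution K" for K a
  proof -
    interpret K: real_distribution K by fact
    show ?thesis
    proof (rule integral_dominated_convergence[where w="\<lambda>_. 1"])
      show "AE x in K. (\<lambda>n. r n a (exp (- x))) \<longlonglongrightarrow> indicator {..a} x"
      proof (intro AE_I2)
        fix x
        show "(\<lambda>n. r n a (exp (- x))) \<longlonglongrightarrow> indicator {..a} x"
        proof (cases "x \<le> a")
          case True
          then show ?thesis by (simp add: r_def)
        next
          case False
          then have d: "exp (- a) - exp (- x) > 0" by simp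
          obtain m where m: "1 < real m * (exp (- a) - exp (- x))"
            using reals_Archimedean3[OF d] by auto
          have "r n a (exp (- x)) = 0" if "n \<ge> m" for n
          proof -
            have "real m * (exp (- a) - exp (- x)) \<le> real n * (exp (- a) - exp (- x))"
              using that d by (intro mult_right_mono) auto
            then show ?thesis using m by (simp add: r_def algebra_simps max_def min_def)
          qed
          then have "\<forall>\<^sub>F n in sequentially. r n a (exp (- x)) = 0"
            unfolding eventually_sequentially by blast
          then show ?thesis using False by (simp add: tendsto_eventually)
        qed
      qed
    qed (auto simp: r_def)
  qed
  have "(\<integral>x. indicator {..a} x \<partial>M) = (\<integral>x. indicator {..a} x \<partial>N :: real)" for a
  proof (rule LIMSEQ_unique[OF r_lim[OF assms(1)]])
    have "continuous_on UNIV (r n a)" for n unfolding r_def by (intro continuous_intros)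
    then show "(\<lambda>n. \<integral>x. r n a (exp (- x)) \<partial>M) \<longlonglongrightarrow> (\<integral>x. indicator {..a} x \<partial>N)"
      using r_lim[OF assms(2)] by (simp add: cont)
  qed
  then have "cdf M = cdf N" by (simp add: cdf_def fun_eq_iff)
  then show ?thesis by (intro cdf_unique assms)
qed

text \<open>Only the law at time one is fixed here. Its transform determines it, so density, moments
  and limits are derived without the paths, which enter only when the inverse process is
  identified.\<close>

locale stable_law = real_distribution D for D :: "real measure" +
  fixes \<alpha> :: real
  assumes alpha: "0 < \<alpha>" "\<alpha> < 1"
    and AE_nonneg: "AE x in D. 0 \<le> x"
    and laplace: "\<And>s. 0 \<le> s \<Longrightarrow> (\<integral>x. exp (- (s * x)) \<partial>D) = exp (- (s powr \<alpha>))"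
begin

text \<open>The Levy measure with Laplace exponent \<open>s powr \<alpha>\<close> has the density
  \<open>stable_const * r powr (- 1 - \<alpha>)\<close>.\<close>

definition stable_const :: real where "stable_const = \<alpha> / Gamma (1 - \<alpha>)"

lemma stable_const_pos: "0 < stable_const"
  using alpha by (simp add: stable_const_def Gamma_real_pos)

lemma nn_laplace:
  assumes "0 \<le> s"
  shows "(\<integral>\<^sup>+x. ennreal (exp (- (s * x))) \<partial>D) = ennreal (exp (- (s powr \<alpha>)))"
proof -
  have "integrable D (\<lambda>x. exp (- (s * x)))"
  proof (rule integrable_const_bound[where B=1])
    show "AE x in D. norm (exp (- (s * x))) \<le> 1"
      using AE_nonneg by eventually_elim (use assms in auto)
  qed measurable
  then show ?thesis
    by (subst nn_integral_eq_integral) (use assms laplace in auto)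
qed

text \<open>Mass at zero would keep the Laplace transform away from zero, but the transform tends to
  zero at infinity.\<close>

lemma AE_pos: "AE x in D. 0 < x"
proof -
  have "emeasure D {..0} \<le> ennreal (exp (- (real n powr \<alpha>)))" for n
  proof -
    have "emeasure D {..0} = (\<integral>\<^sup>+x. indicator {..0} x \<partial>D)" by simp
    also have "\<dots> \<le> (\<integral>\<^sup>+x. ennreal (exp (- (real n * x))) \<partial>D)"
      by (intro nn_integral_mono_AE, use AE_nonneg in eventually_elim)
         (auto simp: indicator_def simp flip: ennreal_1 intro!: ennreal_leI)
    finally show ?thesis by (simp add: nn_laplace)
  qed
  moreover have "(\<lambda>n. ennreal (exp (- (real n powr \<alpha>)))) \<longlonglongrightarrow> ennreal 0"
    using alpha by (intro tendsto_ennrealI) real_asymp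
  ultimately have "emeasure D {..0} \<le> ennreal 0"
    by (intro LIMSEQ_le_const) auto
  then have "{..0} \<in> null_sets D" by (auto simp: null_sets_def)
  then show ?thesis by (rule AE_I') auto
qed

text \<open>The integrand is the derivative of \<open>- exp (- (q powr \<alpha>))\<close>. For
  \<open>\<theta> = 0\<close> it is unbounded at the end point, so the fundamental theorem is used
  in the form for nonnegative functions with one-sided limits.\<close>

lemma nn_integral_stable_potential:
  assumes "0 \<le> \<theta>"
  shows "(\<integral>\<^sup>+q. ennreal (\<alpha> * q powr (\<alpha> - 1) * exp (- (q powr \<alpha>))) * indicator {\<theta><..} q \<partial>lborel)
    = ennreal (exp (- (\<theta> powr \<alpha>)))"
proof -
  let ?f = "\<lambda>q. \<alpha> * q powr (\<alpha> - 1) * exp (- (q powr \<alpha>))"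
  let ?F = "\<lambda>q. - exp (- (q powr \<alpha>))"
  have lim_at_top: "(?F \<longlongrightarrow> 0) at_top" using alpha by real_asymp
  have "((\<lambda>q. q powr \<alpha>) \<longlongrightarrow> \<theta> powr \<alpha>) (at_right \<theta>)"
  proof (cases "\<theta> = 0")
    case True
    then show ?thesis using alpha by simp real_asymp
  next
    case False
    then show ?thesis using assms by (intro tendsto_intros) auto
  qed
  then have lim_theta: "(?F \<longlongrightarrow> - exp (- (\<theta> powr \<alpha>))) (at_right \<theta>)"
    by (intro tendsto_minus tendsto_exp)
  have deriv: "DERIV ?F q :> ?f q" if "ereal \<theta> < ereal q" for q
    using that assms by (auto intro!: derivative_eq_intros)
  have cont: "isCont ?f q" if "ereal \<theta> < ereal q" for q
    using that assms by (auto intro!: continuous_intros)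
  have nonneg: "AE q in lborel. ereal \<theta> < ereal q \<longrightarrow> ereal q < \<infinity> \<longrightarrow> 0 \<le> ?f q"
    using alpha by simp
  have lims: "((?F \<circ> real_of_ereal) \<longlongrightarrow> - exp (- (\<theta> powr \<alpha>))) (at_right (ereal \<theta>))"
    "((?F \<circ> real_of_ereal) \<longlongrightarrow> 0) (at_left \<infinity>)"
    using lim_at_top lim_theta by (simp_all add: ereal_tendsto_simps)
  note FTC = interval_integral_FTC_nonneg[OF _ deriv cont nonneg lims, simplified]
  have "(\<integral>\<^sup>+q. ennreal (?f q) * indicator {\<theta><..} q \<partial>lborel)
      = (\<integral>\<^sup>+q. ennreal (indicator {\<theta><..} q *\<^sub>R ?f q) \<partial>lborel)"
    by (intro nn_integral_cong) (auto simp: indicator_def)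
  also have "\<dots> = ennreal (\<integral>q. indicator {\<theta><..} q *\<^sub>R ?f q \<partial>lborel)"
    using FTC(1) alpha by (subst nn_integral_eq_integral) (auto simp: set_integrable_def)
  also have "(\<integral>q. indicator {\<theta><..} q *\<^sub>R ?f q \<partial>lborel) = exp (- (\<theta> powr \<alpha>))"
    using FTC(2) by (simp add: interval_lebesgue_integral_def set_lebesgue_integral_def)
  finally show ?thesis .
qed

text \<open>The substitution \<open>r = t / q\<close> leaves the Gamma integral at
  \<open>1 - \<alpha>\<close>, which \<open>stable_const\<close> cancels; what remains is the
  derivative of the Laplace exponent \<open>q powr \<alpha>\<close>.\<close>

lemma nn_integral_stable_kernel:
  assumes q: "0 < q"
  shows "(\<integral>\<^sup>+r. ennreal (stable_const * r powr - \<alpha> * exp (- (q * r))) * indicator {0<..} r \<partial>lborel)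
    = ennreal (\<alpha> * q powr (\<alpha> - 1))"
proof -
  have G: "(\<integral>\<^sup>+t. ennreal (t powr - \<alpha> * exp (- t)) * indicator {0<..} t \<partial>lborel) = ennreal (Gamma (1 - \<alpha>))"
  proof -
    have "(\<integral>\<^sup>+t. ennreal (t powr - \<alpha> * exp (- t)) * indicator {0<..} t \<partial>lborel)
      = (\<integral>\<^sup>+t. ennreal (indicator {0..} t * t powr ((1 - \<alpha>) - 1) / exp t) \<partial>lborel)"
    by (intro nn_integral_cong) (auto simp: indicator_def exp_minus field_simps)
    then show ?thesis using alpha by (simp add: Gamma_conv_nn_integral_real)
  qed
  have scale: "(t / q) powr - \<alpha> = q powr \<alpha> * t powr - \<alpha>" if "0 < t" for t
    using q that by (simp add: powr_divide powr_minus field_simps)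
  have pointwise: "ennreal (stable_const * (0 + 1/q * t) powr - \<alpha> * exp (- (q * (0 + 1/q * t))))
      * indicator {0<..} (0 + 1/q * t)
    = ennreal (stable_const * q powr \<alpha>) * (ennreal (t powr - \<alpha> * exp (- t)) * indicator {0<..} t)" for t
  proof (cases "0 < t")
    case True
    have "stable_const * (0 + 1/q * t) powr - \<alpha> * exp (- (q * (0 + 1/q * t)))
        = (stable_const * q powr \<alpha>) * (t powr - \<alpha> * exp (- t))"
      using True q scale[OF True] by simp
    then have "ennreal (stable_const * (0 + 1/q * t) powr - \<alpha> * exp (- (q * (0 + 1/q * t))))
        = ennreal (stable_const * q powr \<alpha>) * ennreal (t powr - \<alpha> * exp (- t))"
      using stable_const_pos by (metis ennreal_mult' less_imp_le mult_nonneg_nonneg powr_ge_zero)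
    moreover have "indicator {0<..} (0 + 1/q * t) = (1::ennreal)" "indicator {0<..} t = (1::ennreal)"
      using True q by auto
    ultimately show ?thesis by (simp only: mult_1_right)
  next
    case False
    then show ?thesis using q by (simp add: zero_less_divide_iff)
  qed
  have "(\<integral>\<^sup>+r. ennreal (stable_const * r powr - \<alpha> * exp (- (q * r))) * indicator {0<..} r \<partial>lborel)
     = ennreal \<bar>1/q\<bar> * (\<integral>\<^sup>+t. ennreal (stable_const * (0 + 1/q * t) powr - \<alpha> * exp (- (q * (0 + 1/q * t))))
          * indicator {0<..} (0 + 1/q * t) \<partial>lborel)"
    using q by (intro nn_integral_real_affine) auto
  also have "\<dots> = ennreal (1/q) * (\<integral>\<^sup>+t. ennreal (stable_const * q powr \<alpha>) *
         (ennreal (t powr - \<alpha> * exp (- t)) * indicator {0<..} t) \<partial>lborel)"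
    using q by (simp only: pointwise abs_of_pos zero_less_divide_1_iff)
  also have "\<dots> = ennreal (1/q) * (ennreal (stable_const * q powr \<alpha>) * ennreal (Gamma (1 - \<alpha>)))"
    by (subst nn_integral_cmult) (auto simp: G)
  also have "\<dots> = ennreal (\<alpha> * q powr (\<alpha> - 1))"
  proof -
    have G0: "0 < Gamma (1 - \<alpha>)" using alpha by (intro Gamma_real_pos) simp
    have "1 / q * (stable_const * q powr \<alpha> * Gamma (1 - \<alpha>)) = \<alpha> * q powr (\<alpha> - 1)"
      using q G0 by (simp add: stable_const_def powr_diff)
    then show ?thesis
      using q G0 stable_const_pos
      by (metis ennreal_mult' less_imp_le mult_nonneg_nonneg powr_ge_zero zero_le_divide_1_iff)
  qed
  finally show ?thesis .
qed

abbreviation shift_weight :: "real \<Rightarrow> real \<Rightarrow> ennreal" where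
  "shift_weight x r \<equiv> ennreal (stable_const * r powr - \<alpha> / (x + r))"

text \<open>The right-hand side is integration of \<open>V\<close> against a measure
  \<open>N\<close>, the image of a weighted product measure under addition of \<open>x\<close> and
  \<open>r\<close>. Comparing transforms identifies \<open>N\<close> with \<open>D\<close>, which
  extends the identity from exponentials to all nonnegative Borel functions at once.\<close>

lemma nn_integral_stable_shift:
  assumes [measurable]: "V \<in> borel_measurable borel"
  shows "(\<integral>\<^sup>+x. V x \<partial>D) = (\<integral>\<^sup>+r. (\<integral>\<^sup>+x. shift_weight x r * V (x + r) \<partial>D)
      * indicator {0<..} r \<partial>lborel)"
proof -
  define w where "w = (\<lambda>(r, x). shift_weight x r * indicator ({0<..} \<times> {0..}) (r, x))"
  have w_meas [measurable]: "w \<in> borel_measurable (lborel \<Otimes>\<^sub>M D)"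
    unfolding w_def indicator_times by measurable
  define N where "N = distr (density (lborel \<Otimes>\<^sub>M D) w) borel (\<lambda>(r, x). x + r)"
  have sets_N [measurable_cong, simp]: "sets N = sets borel" by (simp add: N_def)
  interpret LD: pair_sigma_finite lborel D ..
  interpret DL: pair_sigma_finite D lborel ..
  have nnN: "(\<integral>\<^sup>+x. f x \<partial>N) = (\<integral>\<^sup>+r. (\<integral>\<^sup>+x. shift_weight x r * f (x + r) \<partial>D)
      * indicator {0<..} r \<partial>lborel)" if [measurable]: "f \<in> borel_measurable borel" for f
  proof -
    have "(\<integral>\<^sup>+x. f x \<partial>N) = (\<integral>\<^sup>+p. w p * f (snd p + fst p) \<partial>(lborel \<Otimes>\<^sub>M D))"
      unfolding N_def by (simp add: nn_integral_distr nn_integral_density case_prod_unfold)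
    also have "\<dots> = (\<integral>\<^sup>+r. \<integral>\<^sup>+x. w (r, x) * f (x + r) \<partial>D \<partial>lborel)"
      by (subst nn_integral_fst[symmetric]) auto
    also have "\<dots> = (\<integral>\<^sup>+r. (\<integral>\<^sup>+x. shift_weight x r * f (x + r) \<partial>D)
      * indicator {0<..} r \<partial>lborel)"
    proof (rule nn_integral_cong)
      fix r :: real
      have "(\<integral>\<^sup>+x. w (r, x) * f (x + r) \<partial>D)
        = (\<integral>\<^sup>+x. (shift_weight x r * f (x + r)) * indicator {0<..} r \<partial>D)"
        by (rule nn_integral_cong_AE, use AE_nonneg in eventually_elim)
           (auto simp: w_def indicator_def)
      then show "(\<integral>\<^sup>+x. w (r, x) * f (x + r) \<partial>D)
        = (\<integral>\<^sup>+x. shift_weight x r * f (x + r) \<partial>D) * indicator {0<..} r"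
        by (subst nn_integral_multc[symmetric]) auto
    qed
    finally show ?thesis .
  qed
  \<comment> \<open>Dividing by \<open>x + r\<close> integrates the Laplace transform over the transform variable from \<open>\<theta>\<close> to
    infinity, so both sides have transform \<open>exp (- (\<theta> powr \<alpha>))\<close> and nothing has to be differentiated.\<close>
  have exp_div: "(\<integral>\<^sup>+q. ennreal (exp (- (q * y))) * indicator {\<theta><..} q \<partial>lborel) = ennreal (exp (- (\<theta> * y)) / y)"
    if y: "0 < y" for y \<theta> :: real
  proof -
    have "(\<integral>\<^sup>+q. ennreal (exp (- (q * y))) * indicator {\<theta><..} q \<partial>lborel)
      = (\<integral>\<^sup>+q. ennreal (exp (- (q * y))) * indicator {\<theta>..} q \<partial>lborel)"
      using AE_lborel_singleton[of \<theta>]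
      by (intro nn_integral_cong_AE) (auto elim!: eventually_mono simp: indicator_def)
    also have "\<dots> = ennreal (0 - (- exp (- (\<theta> * y)) / y))"
    proof (rule nn_integral_FTC_atLeast)
      show "((\<lambda>q. - exp (- (q * y)) / y) \<longlongrightarrow> 0) at_top" using y by real_asymp
    qed (use y in \<open>auto intro!: derivative_eq_intros\<close>)
    finally show ?thesis by simp
  qed
  have lap: "(\<integral>\<^sup>+x. ennreal (exp (- (\<theta> * x))) \<partial>N) = ennreal (exp (- (\<theta> powr \<alpha>)))" if \<theta>: "0 \<le> \<theta>" for \<theta>
  proof -
    define A where "A = (\<lambda>r x q. (ennreal (stable_const * r powr - \<alpha> * exp (- (q * r))) * indicator {0<..} r)
       * ennreal (exp (- (q * x))) * indicator {\<theta><..} q)"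
    have [measurable]: "(\<lambda>p. A (f p) (g p) (h p)) \<in> borel_measurable K"
      if [measurable]: "f \<in> borel_measurable K" "g \<in> borel_measurable K" "h \<in> borel_measurable K"
      for f g h and K :: "'z measure"
      unfolding A_def by measurable
    have "(\<integral>\<^sup>+x. ennreal (exp (- (\<theta> * x))) \<partial>N)
      = (\<integral>\<^sup>+r. \<integral>\<^sup>+x. \<integral>\<^sup>+q. A r x q \<partial>lborel \<partial>D \<partial>lborel)"
    proof (subst nnN, measurable, intro nn_integral_cong)
      fix r :: real
      show "(\<integral>\<^sup>+x. shift_weight x r * ennreal (exp (- (\<theta> * (x + r)))) \<partial>D)
        * indicator {0<..} r = (\<integral>\<^sup>+x. \<integral>\<^sup>+q. A r x q \<partial>lborel \<partial>D)"
      proof (cases "0 < r")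
        case True
        have "(\<integral>\<^sup>+x. shift_weight x r * ennreal (exp (- (\<theta> * (x + r)))) \<partial>D)
          = (\<integral>\<^sup>+x. \<integral>\<^sup>+q. A r x q \<partial>lborel \<partial>D)"
        proof (rule nn_integral_cong_AE, use AE_nonneg in eventually_elim)
          fix x :: real assume "0 \<le> x"
          then have y: "0 < x + r" using True by simp
          have "(\<integral>\<^sup>+q. A r x q \<partial>lborel) = (\<integral>\<^sup>+q. ennreal (stable_const * r powr - \<alpha>) *
              (ennreal (exp (- (q * (x + r)))) * indicator {\<theta><..} q) \<partial>lborel)"
            using True stable_const_pos
            by (intro nn_integral_cong) (auto simp: A_def indicator_def exp_add[symmetric] algebra_simps
                simp flip: ennreal_mult)
          also have "\<dots> = ennreal (stable_const * r powr - \<alpha>) * ennreal (exp (- (\<theta> * (x + r))) / (x + r))"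
            by (subst nn_integral_cmult) (simp_all add: exp_div[OF y])
          also have "\<dots> = shift_weight x r * ennreal (exp (- (\<theta> * (x + r))))"
            using y stable_const_pos by (simp flip: ennreal_mult)
          finally show "shift_weight x r * ennreal (exp (- (\<theta> * (x + r))))
            = (\<integral>\<^sup>+q. A r x q \<partial>lborel)" ..
        qed
        then show ?thesis using True by simp
      qed (simp add: A_def)
    qed
    \<comment> \<open>With \<open>q\<close> outermost the three integrals are known:
      \<open>x\<close> gives the Laplace transform, \<open>r\<close> the derivative of its exponent,
      and \<open>q\<close> then integrates an exact derivative.\<close>
    also have "\<dots> = (\<integral>\<^sup>+r. \<integral>\<^sup>+q. \<integral>\<^sup>+x. A r x q \<partial>D \<partial>lborel \<partial>lborel)"
      by (intro nn_integral_cong LD.Fubini') measurable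
    also have "\<dots> = (\<integral>\<^sup>+q. \<integral>\<^sup>+r. \<integral>\<^sup>+x. A r x q \<partial>D \<partial>lborel \<partial>lborel)"
      by (intro lborel_pair.Fubini') measurable
    also have "\<dots> = (\<integral>\<^sup>+q. ennreal (\<alpha> * q powr (\<alpha> - 1) * exp (- (q powr \<alpha>))) * indicator {\<theta><..} q \<partial>lborel)"
    proof (rule nn_integral_cong)
      fix q :: real
      show "(\<integral>\<^sup>+r. \<integral>\<^sup>+x. A r x q \<partial>D \<partial>lborel)
        = ennreal (\<alpha> * q powr (\<alpha> - 1) * exp (- (q powr \<alpha>))) * indicator {\<theta><..} q"
      proof (cases "\<theta> < q")
        case True
        then have q: "0 < q" using \<theta> by simp
        have "(\<integral>\<^sup>+r. \<integral>\<^sup>+x. A r x q \<partial>D \<partial>lborel)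
          = (\<integral>\<^sup>+r. (ennreal (stable_const * r powr - \<alpha> * exp (- (q * r))) * indicator {0<..} r)
              * ennreal (exp (- (q powr \<alpha>))) \<partial>lborel)"
          using True q by (simp add: A_def nn_integral_cmult nn_laplace)
        also have "\<dots> = ennreal (\<alpha> * q powr (\<alpha> - 1)) * ennreal (exp (- (q powr \<alpha>)))"
          by (subst nn_integral_multc) (simp_all add: nn_integral_stable_kernel[OF q])
        finally show ?thesis using True alpha by (simp add: ennreal_mult'')
      qed (simp add: A_def)
    qed
    also have "\<dots> = ennreal (exp (- (\<theta> powr \<alpha>)))"
      by (rule nn_integral_stable_potential[OF \<theta>])
    finally show ?thesis .
  qed
  \<comment> \<open>At \<open>\<theta> = 0\<close> the transform is the total mass, and
    \<open>0 powr \<alpha> = 0\<close>.\<close>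
  have "emeasure N (space N) = 1" using lap[of 0] alpha by simp
  then interpret N: prob_space N by (rule prob_spaceI)
  have rN: "real_distribution N" by standard (simp add: N_def)
  have "N = D"
  proof (rule laplace_transform_unique[OF rN real_distribution_axioms _ AE_nonneg])
    have "emeasure N {..<0} = (\<integral>\<^sup>+x. indicator {..<0} x \<partial>N)" by (simp add: N_def)
    also have "\<dots> = (\<integral>\<^sup>+r. (\<integral>\<^sup>+x. shift_weight x r * indicator {..<0} (x + r) \<partial>D)
      * indicator {0<..} r \<partial>lborel)" by (rule nnN) simp
    also have "\<dots> = (\<integral>\<^sup>+(r::real). 0 \<partial>lborel)"
    proof (rule nn_integral_cong)
      fix r :: real
      have "(\<integral>\<^sup>+x. shift_weight x r * indicator {..<0} (x + r) \<partial>D)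
        = (\<integral>\<^sup>+x. 0 \<partial>D)" if "0 < r"
        by (rule nn_integral_cong_AE, use AE_nonneg in eventually_elim) (use that in auto)
      then show "(\<integral>\<^sup>+x. shift_weight x r * indicator {..<0} (x + r) \<partial>D)
        * indicator {0<..} r = 0" by (auto simp: indicator_def)
    qed
    finally have "{..<0} \<in> null_sets N" by (auto simp: null_sets_def N_def)
    then show "AE x in N. 0 \<le> x" by (rule AE_I') auto
    show "(\<integral>x. exp (- (real n * x)) \<partial>N) = (\<integral>x. exp (- (real n * x)) \<partial>D)" for n
      by (subst (1 2) integral_eq_nn_integral) (simp_all add: lap nn_laplace)
  qed
  then show ?thesis using nnN[of V] by simp
qed

end

section \<open>Smoothness of the stable distribution function\<close>

text \<open>The class of kernels met in the iteration. Multiplication by \<open>r\<close> and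
  convolution with a power stay inside it, and the lower bound \<open>\<beta>\<close> on the
  exponents is all that has to be tracked: once it is positive, the kernel is continuous and
  nondecreasing on the half-line and vanishes at zero.\<close>

inductive power_sum :: "real \<Rightarrow> (real \<Rightarrow> real) \<Rightarrow> bool" for \<beta> where
  power: "0 \<le> c \<Longrightarrow> \<beta> \<le> e \<Longrightarrow> power_sum \<beta> (\<lambda>r. c * r powr e)"
| add: "power_sum \<beta> f \<Longrightarrow> power_sum \<beta> g \<Longrightarrow> power_sum \<beta> (\<lambda>r. f r + g r)"

lemma power_sum_nonneg: "power_sum \<beta> f \<Longrightarrow> 0 \<le> f r"
  by (induction rule: power_sum.induct) auto

lemma power_sum_measurable: "power_sum \<beta> f \<Longrightarrow> f \<in> borel_measurable borel"
  by (induction rule: power_sum.induct) auto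

lemma power_sum_antimono: "power_sum \<beta> f \<Longrightarrow> \<gamma> \<le> \<beta> \<Longrightarrow> power_sum \<gamma> f"
  by (induction rule: power_sum.induct) (auto intro: power_sum.intros)

lemma power_sum_continuous_on: "power_sum \<beta> f \<Longrightarrow> 0 < \<beta> \<Longrightarrow> continuous_on {0..} f"
  by (induction rule: power_sum.induct)
     (auto intro!: continuous_on_add continuous_on_mult continuous_on_powr' continuous_on_const continuous_on_id)

lemma power_sum_0: "power_sum \<beta> f \<Longrightarrow> f 0 = 0"
  by (induction rule: power_sum.induct) auto

lemma power_sum_mono: "power_sum \<beta> f \<Longrightarrow> 0 < \<beta> \<Longrightarrow> 0 \<le> r \<Longrightarrow> r \<le> s \<Longrightarrow> f r \<le> f s"
  by (induction rule: power_sum.induct) (auto intro!: mult_left_mono powr_mono2 add_mono)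

lemma power_sum_times:
  assumes "power_sum \<beta> f"
  shows "\<exists>g. power_sum (\<beta> + 1) g \<and> (\<forall>r>0. g r = r * f r)"
  using assms
proof (induction rule: power_sum.induct)
  case (power c e)
  then show ?case
    by (intro exI[of _ "\<lambda>r. c * r powr (e + 1)"] conjI power_sum.power) (auto simp: powr_add)
next
  case (add f g)
  then obtain f' g' where "power_sum (\<beta> + 1) f'" "\<forall>r>0. f' r = r * f r"
    "power_sum (\<beta> + 1) g'" "\<forall>r>0. g' r = r * g r" by blast
  then show ?case
    by (intro exI[of _ "\<lambda>r. f' r + g' r"]) (auto intro!: power_sum.add simp: algebra_simps)
qed

lemma nn_integral_beta_scaled:
  assumes "-1 < a" "-1 < b" "0 < u"
  shows "(\<integral>\<^sup>+r. ennreal (r powr a * (u - r) powr b) * indicator {0<..<u} r \<partial>lborel)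
    = ennreal (Beta (a + 1) (b + 1) * u powr (a + b + 1))"
proof -
  have "(\<integral>\<^sup>+t. ennreal (t powr a * (1 - t) powr b) * indicator {0<..<1} t \<partial>lborel)
      = (\<integral>\<^sup>+t. ennreal (t powr a * (1 - t) powr b) * indicator {0..1} t \<partial>lborel)"
    by (intro nn_integral_cong) (auto simp: indicator_def)
  also have "\<dots> = ennreal (Beta (a + 1) (b + 1))"
    using has_integral_Beta_real[of "a + 1" "b + 1"] assms
    by (intro nn_integral_has_integral_lebesgue') auto
  finally have B: "(\<integral>\<^sup>+t. ennreal (t powr a * (1 - t) powr b) * indicator {0<..<1} t \<partial>lborel)
    = ennreal (Beta (a + 1) (b + 1))" .
  have pointwise: "ennreal ((0 + u * t) powr a * (u - (0 + u * t)) powr b) * indicator {0<..<u} (0 + u * t)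
     = ennreal (u powr (a + b)) * (ennreal (t powr a * (1 - t) powr b) * indicator {0<..<1} t)" for t
  proof (cases "0 < t \<and> t < 1")
    case True
    have "u - u * t = u * (1 - t)" by (simp add: algebra_simps)
    then have "(0 + u * t) powr a * (u - (0 + u * t)) powr b = u powr (a + b) * (t powr a * (1 - t) powr b)"
      using True assms by (simp add: powr_mult powr_add)
    then have "ennreal ((0 + u * t) powr a * (u - (0 + u * t)) powr b)
        = ennreal (u powr (a + b)) * ennreal (t powr a * (1 - t) powr b)"
      by (simp only: ennreal_mult' powr_ge_zero)
    then show ?thesis using True assms by simp
  next
    case False
    then show ?thesis using assms by (auto simp: indicator_def zero_less_mult_iff)
  qed
  have "(\<integral>\<^sup>+r. ennreal (r powr a * (u - r) powr b) * indicator {0<..<u} r \<partial>lborel)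
    = ennreal \<bar>u\<bar> * (\<integral>\<^sup>+t. ennreal ((0 + u * t) powr a * (u - (0 + u * t)) powr b)
        * indicator {0<..<u} (0 + u * t) \<partial>lborel)"
    using assms by (intro nn_integral_real_affine) auto
  also have "\<dots> = ennreal u * (ennreal (u powr (a + b)) * ennreal (Beta (a + 1) (b + 1)))"
    using assms by (simp only: pointwise abs_of_pos) (simp add: nn_integral_cmult B)
  also have "\<dots> = ennreal (Beta (a + 1) (b + 1) * u powr (a + b + 1))"
  proof -
    have "Beta (a + 1) (b + 1) * u powr (a + b + 1) = u * (u powr (a + b) * Beta (a + 1) (b + 1))"
      using assms by (simp add: powr_add)
    moreover have "ennreal (u * (u powr (a + b) * Beta (a + 1) (b + 1)))
      = ennreal u * (ennreal (u powr (a + b)) * ennreal (Beta (a + 1) (b + 1)))"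
      using assms by (subst ennreal_mult', simp, subst ennreal_mult') simp_all
    ultimately show ?thesis by (simp only:)
  qed
  finally show ?thesis .
qed

text \<open>Convolving \<open>r powr e\<close> with \<open>r powr b\<close> gives a Beta value times
  \<open>u powr (e + b + 1)\<close>, so every exponent rises by \<open>b + 1\<close>; additivity
  does the rest.\<close>

lemma power_sum_convolution:
  assumes "power_sum \<beta> f" "-1 < \<beta>" "b > -1" "0 \<le> c"
  shows "\<exists>g. power_sum (\<beta> + b + 1) g \<and>
    (\<forall>u>0. (\<integral>\<^sup>+r. ennreal (f r * (c * (u - r) powr b)) * indicator {0<..<u} r \<partial>lborel) = ennreal (g u))"
  using assms(1)
proof (induction rule: power_sum.induct)
  case (power d e)
  have B0: "0 \<le> Beta (e + 1) (b + 1)"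
    using power assms by (simp add: Beta_def Gamma_real_pos less_imp_le)
  show ?case
  proof (intro exI[of _ "\<lambda>u. (d * c * Beta (e + 1) (b + 1)) * u powr (e + b + 1)"] conjI allI impI)
    show "power_sum (\<beta> + b + 1) (\<lambda>u. (d * c * Beta (e + 1) (b + 1)) * u powr (e + b + 1))"
      using power assms B0 by (intro power_sum.power) auto
    fix u :: real assume u: "0 < u"
    have "(\<integral>\<^sup>+r. ennreal (d * r powr e * (c * (u - r) powr b)) * indicator {0<..<u} r \<partial>lborel)
      = (\<integral>\<^sup>+r. ennreal (d * c) * (ennreal (r powr e * (u - r) powr b) * indicator {0<..<u} r) \<partial>lborel)"
    proof (intro nn_integral_cong)
      fix r
      have "d * r powr e * (c * (u - r) powr b) = (d * c) * (r powr e * (u - r) powr b)" by simp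
      then have "ennreal (d * r powr e * (c * (u - r) powr b)) = ennreal (d * c) * ennreal (r powr e * (u - r) powr b)"
        using power assms by (simp only: ennreal_mult' mult_nonneg_nonneg)
      then show "ennreal (d * r powr e * (c * (u - r) powr b)) * indicator {0<..<u} r
        = ennreal (d * c) * (ennreal (r powr e * (u - r) powr b) * indicator {0<..<u} r)"
        by (simp only: mult.assoc)
    qed
    also have "\<dots> = ennreal (d * c) * ennreal (Beta (e + 1) (b + 1) * u powr (e + b + 1))"
      using power assms u by (subst nn_integral_cmult) (simp_all add: nn_integral_beta_scaled)
    also have "\<dots> = ennreal ((d * c) * (Beta (e + 1) (b + 1) * u powr (e + b + 1)))"
      using power assms by (intro ennreal_mult'[symmetric]) simp
    finally show "(\<integral>\<^sup>+r. ennreal (d * r powr e * (c * (u - r) powr b)) * indicator {0<..<u} r \<partial>lborel)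
      = ennreal ((d * c * Beta (e + 1) (b + 1)) * u powr (e + b + 1))" by (simp only: mult.assoc)
  qed
next
  case (add f1 f2)
  then obtain g1 g2 where g: "power_sum (\<beta> + b + 1) g1" "power_sum (\<beta> + b + 1) g2"
    "\<And>u. u > 0 \<Longrightarrow> (\<integral>\<^sup>+r. ennreal (f1 r * (c * (u - r) powr b)) * indicator {0<..<u} r \<partial>lborel) = ennreal (g1 u)"
    "\<And>u. u > 0 \<Longrightarrow> (\<integral>\<^sup>+r. ennreal (f2 r * (c * (u - r) powr b)) * indicator {0<..<u} r \<partial>lborel) = ennreal (g2 u)"
    by blast
  note [measurable] = add.hyps[THEN power_sum_measurable]
  have "(\<integral>\<^sup>+r. ennreal ((f1 r + f2 r) * (c * (u - r) powr b)) * indicator {0<..<u} r \<partial>lborel) = ennreal (g1 u + g2 u)"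
    if "u > 0" for u
  proof -
    have "(\<integral>\<^sup>+r. ennreal ((f1 r + f2 r) * (c * (u - r) powr b)) * indicator {0<..<u} r \<partial>lborel)
      = (\<integral>\<^sup>+r. ennreal (f1 r * (c * (u - r) powr b)) * indicator {0<..<u} r
           + ennreal (f2 r * (c * (u - r) powr b)) * indicator {0<..<u} r \<partial>lborel)"
    proof (intro nn_integral_cong)
      fix r
      have "ennreal ((f1 r + f2 r) * (c * (u - r) powr b))
         = ennreal (f1 r * (c * (u - r) powr b)) + ennreal (f2 r * (c * (u - r) powr b))"
        using add.hyps[THEN power_sum_nonneg] assms
        by (subst ennreal_plus[symmetric]) (simp_all add: algebra_simps)
      then show "ennreal ((f1 r + f2 r) * (c * (u - r) powr b)) * indicator {0<..<u} r =
        ennreal (f1 r * (c * (u - r) powr b)) * indicator {0<..<u} r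
           + ennreal (f2 r * (c * (u - r) powr b)) * indicator {0<..<u} r"
        by (simp only: distrib_right)
    qed
    also have "\<dots> = ennreal (g1 u) + ennreal (g2 u)"
      by (subst nn_integral_add) (simp_all add: g that)
    finally show ?thesis using g(1,2)[THEN power_sum_nonneg] by simp
  qed
  then show ?case
    using g by (intro exI[of _ "\<lambda>r. g1 r + g2 r"]) (auto intro: power_sum.add)
qed


section \<open>Iterated size-biasing and a continuous density\<close>

context stable_law
begin

text \<open>Applied to \<open>x * V x\<close>, the shift identity loses its denominator
  \<open>x + r\<close>; this is the size-biased form that can be iterated.\<close>

lemma nn_integral_stable_times:
  assumes [measurable]: "V \<in> borel_measurable borel"
  shows "(\<integral>\<^sup>+x. ennreal x * V x \<partial>D)
    = (\<integral>\<^sup>+r. ennreal (stable_const * r powr - \<alpha>) * (\<integral>\<^sup>+x. V (x + r) \<partial>D) * indicator {0<..} r \<partial>lborel)"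
proof (subst nn_integral_stable_shift, measurable, intro nn_integral_cong)
  fix r :: real
  show "(\<integral>\<^sup>+x. shift_weight x r * (ennreal (x + r) * V (x + r)) \<partial>D) * indicator {0<..} r
     = ennreal (stable_const * r powr - \<alpha>) * (\<integral>\<^sup>+x. V (x + r) \<partial>D) * indicator {0<..} r"
  proof (cases "0 < r")
    case True
    have "(\<integral>\<^sup>+x. shift_weight x r * (ennreal (x + r) * V (x + r)) \<partial>D)
      = (\<integral>\<^sup>+x. ennreal (stable_const * r powr - \<alpha>) * V (x + r) \<partial>D)"
    proof (rule nn_integral_cong_AE, use AE_nonneg in eventually_elim)
      fix x :: real assume "0 \<le> x"
      then have y: "0 < x + r" using True by simp
      have "shift_weight x r * ennreal (x + r) = ennreal (stable_const * r powr - \<alpha>)"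
        using y stable_const_pos by (subst ennreal_mult[symmetric]) auto
      then show "shift_weight x r * (ennreal (x + r) * V (x + r))
        = ennreal (stable_const * r powr - \<alpha>) * V (x + r)" by (simp only: mult.assoc[symmetric])
    qed
    also have "\<dots> = ennreal (stable_const * r powr - \<alpha>) * (\<integral>\<^sup>+x. V (x + r) \<partial>D)"
      by (rule nn_integral_cmult) simp
    finally show ?thesis by simp
  qed simp
qed

text \<open>Multiplication by the variable is a derivation for convolution, so the case \<open>n = 1\<close> can be iterated.
  Each step raises the lowest exponent of the kernel by at least \<open>1 - \<alpha>\<close>; once it is positive the kernel
  is continuous, and so is the density of the stable law on the positive half-line.\<close>

lemma nn_integral_stable_power:
  assumes "0 < n"
  shows "\<exists>K. power_sum (real n * (1 - \<alpha>) - 1) K \<and>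
    (\<forall>V \<in> borel_measurable borel. (\<integral>\<^sup>+x. ennreal x ^ n * V x \<partial>D)
      = (\<integral>\<^sup>+r. ennreal (K r) * (\<integral>\<^sup>+x. V (x + r) \<partial>D) * indicator {0<..} r \<partial>lborel))"
  using assms
proof (induction n rule: nat_induct_non_zero)
  case 1
  then show ?case
    using stable_const_pos nn_integral_stable_times
    by (intro exI[of _ "\<lambda>r. stable_const * r powr - \<alpha>"] conjI power_sum.power) auto
next
  case (Suc n)
  then obtain K where K: "power_sum (real n * (1 - \<alpha>) - 1) K"
    and K_eq: "\<And>V. V \<in> borel_measurable borel \<Longrightarrow> (\<integral>\<^sup>+x. ennreal x ^ n * V x \<partial>D)
      = (\<integral>\<^sup>+r. ennreal (K r) * (\<integral>\<^sup>+x. V (x + r) \<partial>D) * indicator {0<..} r \<partial>lborel)" by blast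
  note [measurable] = power_sum_measurable[OF K] and K_nonneg = power_sum_nonneg[OF K]
  \<comment> \<open>\<open>(x + r) * V (x + r)\<close> splits in two. The part with \<open>r\<close>
    multiplies the kernel by \<open>r\<close> and gives \<open>K1\<close>; the part with
    \<open>x\<close> is again size-biased and gives \<open>K2\<close>, the convolution of
    \<open>K\<close> with \<open>stable_const * r powr - \<alpha>\<close>.\<close>
  obtain K1 where K1: "power_sum (real n * (1 - \<alpha>) - 1 + 1) K1" "\<And>r. 0 < r \<Longrightarrow> K1 r = r * K r"
    using power_sum_times[OF K] by blast
  have "-1 < real n * (1 - \<alpha>) - 1" using alpha Suc.hyps by simp
  then obtain K2 where K2: "power_sum (real n * (1 - \<alpha>) - 1 + - \<alpha> + 1) K2"
    "\<And>u. 0 < u \<Longrightarrow> (\<integral>\<^sup>+r. ennreal (K r * (stable_const * (u - r) powr - \<alpha>)) * indicator {0<..<u} r \<partial>lborel)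
      = ennreal (K2 u)"
    using power_sum_convolution[OF K, of "- \<alpha>" stable_const] alpha stable_const_pos by force
  note [measurable] = power_sum_measurable[OF K1(1)] power_sum_measurable[OF K2(1)]
  \<comment> \<open>\<open>K2\<close> has exactly the lowest exponent required, since
    \<open>n * (1 - \<alpha>) - \<alpha> = (n + 1) * (1 - \<alpha>) - 1\<close>; that of
    \<open>K1\<close> is larger by \<open>\<alpha>\<close>.\<close>
  have ps: "power_sum (real (Suc n) * (1 - \<alpha>) - 1) (\<lambda>r. K1 r + K2 r)"
    by (intro power_sum.add power_sum_antimono[OF K1(1)] power_sum_antimono[OF K2(1)])
       (use alpha in \<open>simp_all add: algebra_simps\<close>)
  have "(\<integral>\<^sup>+x. ennreal x ^ Suc n * V x \<partial>D)
      = (\<integral>\<^sup>+r. ennreal (K1 r + K2 r) * (\<integral>\<^sup>+x. V (x + r) \<partial>D) * indicator {0<..} r \<partial>lborel)"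
    if [measurable]: "V \<in> borel_measurable borel" for V
  proof -
    define G where "G r = (\<integral>\<^sup>+x. V (x + r) \<partial>D)" for r
    have [measurable]: "G \<in> borel_measurable borel" unfolding G_def by measurable
    let ?I = "\<lambda>r. \<integral>\<^sup>+q. ennreal (stable_const * q powr - \<alpha>) * G (q + r) * indicator {0<..} q \<partial>lborel"
    let ?J = "\<lambda>u r. ennreal (K r * (stable_const * (u - r) powr - \<alpha>)) * indicator {0<..<u} r"
    have "(\<integral>\<^sup>+x. ennreal x ^ Suc n * V x \<partial>D) = (\<integral>\<^sup>+x. ennreal x ^ n * (ennreal x * V x) \<partial>D)"
      by (simp add: mult_ac)
    also have "\<dots> = (\<integral>\<^sup>+r. ennreal (K r) * (\<integral>\<^sup>+x. ennreal (x + r) * V (x + r) \<partial>D) * indicator {0<..} r \<partial>lborel)"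
      by (rule K_eq) measurable
    also have "\<dots> = (\<integral>\<^sup>+r. ennreal (K1 r) * G r * indicator {0<..} r +
        ennreal (K r) * ?I r
          * indicator {0<..} r \<partial>lborel)"
    proof (intro nn_integral_cong)
      fix r :: real
      show "ennreal (K r) * (\<integral>\<^sup>+x. ennreal (x + r) * V (x + r) \<partial>D) * indicator {0<..} r
        = ennreal (K1 r) * G r * indicator {0<..} r +
        ennreal (K r) * ?I r
          * indicator {0<..} r"
      proof (cases "0 < r")
        case True
        have "(\<integral>\<^sup>+x. ennreal (x + r) * V (x + r) \<partial>D)
           = (\<integral>\<^sup>+x. ennreal x * V (x + r) + ennreal r * V (x + r) \<partial>D)"
          by (rule nn_integral_cong_AE, use AE_nonneg in eventually_elim)
             (use True in \<open>simp add: distrib_right\<close>)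
        also have "\<dots> = (\<integral>\<^sup>+x. ennreal x * V (x + r) \<partial>D) + ennreal r * G r"
          by (simp add: nn_integral_add nn_integral_cmult G_def)
        also have "(\<integral>\<^sup>+x. ennreal x * V (x + r) \<partial>D)
          = ?I r"
          by (subst nn_integral_stable_times) (simp_all add: G_def add.assoc)
        finally show ?thesis
          using True K_nonneg by (simp add: K1 ennreal_mult' distrib_left mult_ac add.commute)
      qed simp
    qed
    also have "\<dots> = (\<integral>\<^sup>+r. ennreal (K1 r) * G r * indicator {0<..} r \<partial>lborel) +
        (\<integral>\<^sup>+r. ennreal (K r) * ?I r
          * indicator {0<..} r \<partial>lborel)"
      by (rule nn_integral_add) measurable
    also have "(\<integral>\<^sup>+r. ennreal (K r) * ?I r
          * indicator {0<..} r \<partial>lborel)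
      = (\<integral>\<^sup>+r. \<integral>\<^sup>+u. G u * ?J u r \<partial>lborel \<partial>lborel)"
    proof (intro nn_integral_cong)
      fix r :: real
      \<comment> \<open>The substitution \<open>u = q + r\<close> frees the argument of
        \<open>G\<close> from \<open>r\<close>, so that the integral over \<open>r\<close> becomes
        the convolution \<open>K2\<close>.\<close>
      have "?I r
        = (\<integral>\<^sup>+u. ennreal (stable_const * (u - r) powr - \<alpha>) * G u * indicator {0<..} (u - r) \<partial>lborel)"
        using nn_integral_real_affine[of "\<lambda>q. ennreal (stable_const * q powr - \<alpha>) * G (q + r) * indicator {0<..} q" 1 "- r"]
        by simp
      then have "ennreal (K r) * ?I r
          * indicator {0<..} r
        = (\<integral>\<^sup>+u. ennreal (K r) * (ennreal (stable_const * (u - r) powr - \<alpha>) * G u * indicator {0<..} (u - r)) * indicator {0<..} r \<partial>lborel)"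
        by (simp add: nn_integral_cmult nn_integral_multc)
      also have "\<dots> = (\<integral>\<^sup>+u. G u * ?J u r \<partial>lborel)"
        by (intro nn_integral_cong) (simp only: ennreal_mult'[OF K_nonneg], auto simp: indicator_def mult_ac)
      finally show "ennreal (K r) * ?I r
          * indicator {0<..} r
        = (\<integral>\<^sup>+u. G u * ?J u r \<partial>lborel)" .
    qed
    also have "\<dots> = (\<integral>\<^sup>+u. \<integral>\<^sup>+r. G u * ?J u r \<partial>lborel \<partial>lborel)"
      unfolding greaterThanLessThan_def indicator_inter_arith greaterThan_def lessThan_def
      by (intro lborel_pair.Fubini') measurable
    also have "\<dots> = (\<integral>\<^sup>+u. ennreal (K2 u) * G u * indicator {0<..} u \<partial>lborel)"
    proof (intro nn_integral_cong)
      fix u :: real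
      have "(\<integral>\<^sup>+r. G u * ?J u r \<partial>lborel)
        = G u * (\<integral>\<^sup>+r. ?J u r \<partial>lborel)"
        by (rule nn_integral_cmult) measurable
      then show "(\<integral>\<^sup>+r. G u * ?J u r \<partial>lborel)
        = ennreal (K2 u) * G u * indicator {0<..} u"
        using K2(2)[of u] by (cases "0 < u") (auto simp: mult_ac)
    qed
    also have "(\<integral>\<^sup>+r. ennreal (K1 r) * G r * indicator {0<..} r \<partial>lborel) + \<dots>
      = (\<integral>\<^sup>+r. ennreal (K1 r) * G r * indicator {0<..} r + ennreal (K2 r) * G r * indicator {0<..} r \<partial>lborel)"
      by (rule nn_integral_add[symmetric]) measurable
    also have "\<dots> = (\<integral>\<^sup>+r. ennreal (K1 r + K2 r) * G r * indicator {0<..} r \<partial>lborel)"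
      using power_sum_nonneg[OF K1(1)] power_sum_nonneg[OF K2(1)]
      by (intro nn_integral_cong) (simp add: distrib_right)
    finally show ?thesis by (simp add: G_def)
  qed
  with ps show ?case by blast
qed

text \<open>For \<open>n * (1 - \<alpha>) > 1\<close> the kernel is continuous, so
  \<open>x ^ n\<close> times the law has a continuous density \<open>h\<close>, the convolution of
  the kernel with the law. Dividing by \<open>s ^ n\<close> gives the density of the law itself,
  with continuity only away from zero.\<close>

lemma stable_density:
  "\<exists>g. continuous_on {0<..} g \<and> (\<forall>s. 0 \<le> g s) \<and> g \<in> borel_measurable borel
     \<and> D = density lborel (\<lambda>s. ennreal (g s) * indicator {0<..} s)"
proof -
  obtain n where n: "1 < real n * (1 - \<alpha>)" using reals_Archimedean3[of "1 - \<alpha>"] alpha by auto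
  then have "0 < n" by (intro gr0I) auto
  then obtain K where K: "power_sum (real n * (1 - \<alpha>) - 1) K"
    and K_eq: "\<And>V. V \<in> borel_measurable borel \<Longrightarrow> (\<integral>\<^sup>+x. ennreal x ^ n * V x \<partial>D)
      = (\<integral>\<^sup>+r. ennreal (K r) * (\<integral>\<^sup>+x. V (x + r) \<partial>D) * indicator {0<..} r \<partial>lborel)"
    using nn_integral_stable_power by blast
  have K_pos: "0 < real n * (1 - \<alpha>) - 1" using n by simp
  note K_nonneg = power_sum_nonneg[OF K]
  define k where "k r = K (max 0 r)" for r
  have k_cont: "continuous_on UNIV k" unfolding k_def
    by (intro continuous_on_compose2[OF power_sum_continuous_on[OF K K_pos]] continuous_intros) auto
  have [measurable]: "k \<in> borel_measurable borel" "K \<in> borel_measurable borel"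
    using k_cont K by (auto intro: borel_measurable_continuous_onI power_sum_measurable)
  have k_bound: "0 \<le> k r" "r \<le> s \<Longrightarrow> k r \<le> k s" for r s
    using power_sum_mono[OF K K_pos, of "max 0 r" "max 0 s"] K_nonneg by (auto simp: k_def)
  have k_bound_AE: "AE x in D. norm (k (s - x)) \<le> k B" if "s \<le> B" for s B
    using AE_nonneg by eventually_elim (use that k_bound in auto)
  have k_int: "integrable D (\<lambda>x. k (s - x))" for s
    by (rule integrable_const_bound[OF k_bound_AE[OF order_refl]]) measurable
  define h where "h s = (\<integral>x. k (s - x) \<partial>D)" for s
  have h_cont: "continuous_on UNIV h"
  proof (rule continuous_on_sequentiallyI)
    fix u :: "nat \<Rightarrow> real" and s assume u: "u \<longlonglongrightarrow> s"
    then obtain B where B: "\<And>i. \<bar>u i\<bar> \<le> B"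
      using convergent_imp_Bseq[of u] by (auto simp: convergent_def Bseq_def)
    show "(\<lambda>i. h (u i)) \<longlonglongrightarrow> h s" unfolding h_def
    proof (rule integral_dominated_convergence[where w="\<lambda>_. k B"])
      have "isCont k y" for y using k_cont by (simp add: continuous_on_eq_continuous_at)
      then show "AE x in D. (\<lambda>i. k (u i - x)) \<longlonglongrightarrow> k (s - x)"
        by (intro AE_I2 isCont_tendsto_compose[of _ k] tendsto_intros u)
      show "AE x in D. norm (k (u i - x)) \<le> k B" for i
        using B[of i] by (intro k_bound_AE) simp
    qed measurable
  qed
  have [measurable]: "h \<in> borel_measurable borel" using h_cont by (rule borel_measurable_continuous_onI)
  have h_nonneg: "0 \<le> h s" for s unfolding h_def by (intro integral_nonneg_AE AE_I2 k_bound)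
  define g where "g s = h s / \<bar>s\<bar> ^ n" for s
  let ?w = "\<lambda>s. ennreal (g s) * indicator {0<..} s"
  interpret DL: pair_sigma_finite D lborel ..
  have "D = density lborel ?w"
  proof (rule measure_eqI)
    fix A assume "A \<in> sets D"
    then have [measurable]: "A \<in> sets borel" by simp
    \<comment> \<open>Tests \<open>A\<close> on the positive half-line with the factor
      \<open>x ^ n\<close> divided out; the law charges nothing else.\<close>
    define V where "V = (\<lambda>y. ennreal (1 / \<bar>y\<bar> ^ n) * indicator ({0<..} \<inter> A) y)"
    have [measurable]: "V \<in> borel_measurable borel" unfolding V_def by measurable
    have "emeasure D A = (\<integral>\<^sup>+x. indicator A x \<partial>D)" by simp
    also have "\<dots> = (\<integral>\<^sup>+x. ennreal x ^ n * V x \<partial>D)"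
    proof (rule nn_integral_cong_AE, use AE_pos in eventually_elim)
      fix x :: real assume "0 < x"
      then have "ennreal x ^ n * ennreal (1 / \<bar>x\<bar> ^ n) = 1"
        by (subst ennreal_power, simp, subst ennreal_mult'[symmetric]) simp_all
      then show "indicator A x = ennreal x ^ n * V x"
        using \<open>0 < x\<close> by (auto simp: V_def indicator_def)
    qed
    also have "\<dots> = (\<integral>\<^sup>+r. ennreal (K r) * (\<integral>\<^sup>+x. V (x + r) \<partial>D) * indicator {0<..} r \<partial>lborel)"
      by (rule K_eq) measurable
    also have "\<dots> = (\<integral>\<^sup>+r. \<integral>\<^sup>+x. ennreal (k r) * V (x + r) \<partial>D \<partial>lborel)"
    proof (intro nn_integral_cong)
      fix r :: real
      have "k r = 0" if "r \<le> 0" using that power_sum_0[OF K] by (simp add: k_def)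
      then show "ennreal (K r) * (\<integral>\<^sup>+x. V (x + r) \<partial>D) * indicator {0<..} r = (\<integral>\<^sup>+x. ennreal (k r) * V (x + r) \<partial>D)"
        by (subst nn_integral_cmult) (auto simp: indicator_def k_def)
    qed
    also have "\<dots> = (\<integral>\<^sup>+x. \<integral>\<^sup>+r. ennreal (k r) * V (x + r) \<partial>lborel \<partial>D)"
      by (rule DL.Fubini') measurable
    also have "\<dots> = (\<integral>\<^sup>+x. \<integral>\<^sup>+s. ennreal (k (s - x)) * V s \<partial>lborel \<partial>D)"
    proof (rule nn_integral_cong)
      fix x :: real
      show "(\<integral>\<^sup>+r. ennreal (k r) * V (x + r) \<partial>lborel) = (\<integral>\<^sup>+s. ennreal (k (s - x)) * V s \<partial>lborel)"
        using nn_integral_real_affine[of "\<lambda>r. ennreal (k r) * V (x + r)" 1 "- x"] by simp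
    qed
    also have "\<dots> = (\<integral>\<^sup>+s. \<integral>\<^sup>+x. ennreal (k (s - x)) * V s \<partial>D \<partial>lborel)"
      by (rule DL.Fubini'[symmetric]) measurable
    also have "\<dots> = (\<integral>\<^sup>+s. ennreal (g s) * indicator {0<..} s * indicator A s \<partial>lborel)"
    proof (intro nn_integral_cong)
      fix s :: real
      have "(\<integral>\<^sup>+x. ennreal (k (s - x)) * V s \<partial>D) = ennreal (h s) * V s"
        by (subst nn_integral_multc) (simp_all add: h_def nn_integral_eq_integral[OF k_int] k_bound)
      also have "\<dots> = ennreal (g s) * indicator {0<..} s * indicator A s"
        using h_nonneg[of s] by (auto simp: V_def g_def indicator_def simp flip: ennreal_mult)
      finally show "(\<integral>\<^sup>+x. ennreal (k (s - x)) * V s \<partial>D) = ennreal (g s) * indicator {0<..} s * indicator A s" .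
    qed
    also have "\<dots> = emeasure (density lborel ?w) A"
      unfolding g_def by (subst emeasure_density) auto
    finally show "emeasure D A = emeasure (density lborel ?w) A" .
  qed simp
  moreover have "continuous_on {0<..} g" unfolding g_def
    by (intro continuous_intros continuous_on_subset[OF h_cont]) auto
  moreover have "0 \<le> g s" for s using h_nonneg by (simp add: g_def)
  moreover have "g \<in> borel_measurable borel" unfolding g_def by measurable
  ultimately show ?thesis by blast
qed

end

section \<open>Distribution functions and densities on the half-line\<close>

text \<open>Right continuity of \<open>cdf N\<close> at zero forces \<open>cdf M 0\<close> down to
  \<open>cdf N 0 = 0\<close>, and by monotonicity both functions vanish on the nonpositive
  axis.\<close>

lemma real_distribution_eqI_pos:
  assumes "real_distribution M" "real_distribution N"
    and eq: "\<And>x. 0 < x \<Longrightarrow> cdf M x = cdf N x" and N0: "cdf N 0 = 0"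
  shows "M = N"
proof -
  interpret M: real_distribution M by fact
  interpret N: real_distribution N by fact
  have "cdf M 0 \<le> cdf N 0"
  proof (rule tendsto_lowerbound)
    show "(cdf N \<longlongrightarrow> cdf N 0) (at_right 0)"
      using N.cdf_is_right_cont[of 0] by (simp add: continuous_within)
    show "\<forall>\<^sub>F x in at_right 0. cdf M 0 \<le> cdf N x"
      using M.cdf_nondecreasing by (auto simp: eventually_at_right_field eq[symmetric] intro!: exI[of _ 1])
  qed simp
  then have "cdf M x = cdf N x" if "x \<le> 0" for x
    using M.cdf_nondecreasing[OF that] N.cdf_nondecreasing[OF that] M.cdf_nonneg[of x] N.cdf_nonneg[of x] N0
    by linarith
  with eq have "cdf M = cdf N" by (auto simp: fun_eq_iff not_le[symmetric])
  then show ?thesis by (intro cdf_unique assms)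
qed

text \<open>The derivative may be unbounded near zero, so it is integrated over
  \<open>{0<..<x}\<close> with the limit 0 of the distribution function at the left end;
  nonnegativity, from monotonicity, makes it integrable. The density then has the right distribution
  function on the positive axis, hence total mass one.\<close>

lemma real_distribution_density_cdf_deriv:
  fixes f :: "real \<Rightarrow> real"
  assumes "real_distribution N" and N0: "cdf N 0 = 0"
    and f_cont: "continuous_on {0<..} f"
    and deriv: "\<And>x. 0 < x \<Longrightarrow> (cdf N has_real_derivative f x) (at x)"
  shows "(\<lambda>x. ennreal (f x) * indicator {0<..} x) \<in> borel_measurable borel"
    and "N = density lborel (\<lambda>x. ennreal (f x) * indicator {0<..} x)"
    and "0 < x \<Longrightarrow> 0 \<le> f x"
proof -
  interpret N: real_distribution N by fact
  let ?w = "\<lambda>x. ennreal (f x) * indicator {0<..} x"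
  have f_nonneg: "0 \<le> f x" if "0 < x" for x
  proof (rule mono_on_imp_deriv_nonneg[of UNIV "cdf N"])
    show "mono_on UNIV (cdf N)" by (auto intro!: mono_onI N.cdf_nondecreasing)
  qed (use deriv[OF that] in auto)
  then show "0 < x \<Longrightarrow> 0 \<le> f x" for x by simp
  have f_meas: "(\<lambda>x. f x * indicator {0<..} x) \<in> borel_measurable borel"
    using borel_measurable_continuous_on_indicator[OF _ f_cont] by (simp add: mult.commute)
  have "?w = (\<lambda>x. ennreal (f x * indicator {0<..} x))"
    by (auto simp: indicator_def)
  with f_meas show w [measurable]: "?w \<in> borel_measurable borel"
    by simp
  define R where "R = density lborel ?w"
  have R_pos: "emeasure R {..x} = ennreal (cdf N x)" if "0 < x" for x
  proof -
    have lim0: "((cdf N \<circ> real_of_ereal) \<longlongrightarrow> 0) (at_right (ereal 0))"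
      using N.cdf_is_right_cont[of 0] N0 by (simp add: ereal_tendsto_simps continuous_within)
    have "(cdf N \<longlongrightarrow> cdf N x) (at_left x)"
      using DERIV_isCont[OF deriv[OF that]] by (simp add: isCont_def filterlim_at_split)
    then have limx: "((cdf N \<circ> real_of_ereal) \<longlongrightarrow> cdf N x) (at_left (ereal x))"
      by (simp add: ereal_tendsto_simps)
    have cont: "isCont f y" if "ereal 0 < ereal y" for y
      using f_cont that by (simp add: continuous_on_eq_continuous_at)
    have nonneg: "AE y in lborel. ereal 0 < ereal y \<longrightarrow> ereal y < ereal x \<longrightarrow> 0 \<le> f y"
      using f_nonneg by simp
    have deriv': "DERIV (cdf N) y :> f y" if "ereal 0 < ereal y" for y using deriv that by simp
    have lt: "ereal 0 < ereal x" using that by simp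
    have FTC: "set_integrable lborel (einterval (ereal 0) (ereal x)) f" "(LBINT y=ereal 0..ereal x. f y) = cdf N x - 0"
      by (rule interval_integral_FTC_nonneg(1)[OF lt deriv' cont nonneg lim0 limx], assumption+)
         (rule interval_integral_FTC_nonneg(2)[OF lt deriv' cont nonneg lim0 limx], assumption+)
    have "emeasure R {..x} = (\<integral>\<^sup>+y. ennreal (f y) * indicator {0<..} y * indicator {..x} y \<partial>lborel)"
      unfolding R_def by (subst emeasure_density) auto
    also have "\<dots> = (\<integral>\<^sup>+y. ennreal (indicator {0<..<x} y *\<^sub>R f y) \<partial>lborel)"
      using AE_lborel_singleton[of x]
      by (intro nn_integral_cong_AE) (auto elim!: eventually_mono simp: indicator_def)
    also have "\<dots> = ennreal (\<integral>y. indicator {0<..<x} y *\<^sub>R f y \<partial>lborel)"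
      using FTC(1) f_nonneg by (intro nn_integral_eq_integral) (auto simp: set_integrable_def indicator_def)
    also have "(\<integral>y. indicator {0<..<x} y *\<^sub>R f y \<partial>lborel) = cdf N x"
      using FTC(2) that by (simp add: interval_lebesgue_integral_def set_lebesgue_integral_def)
    finally show ?thesis .
  qed
  have R0: "emeasure R {..0} = 0"
  proof -
    have "emeasure R {..0} = (\<integral>\<^sup>+x. ennreal (f x) * indicator {0<..} x * indicator {..0} x \<partial>lborel)"
      unfolding R_def by (subst emeasure_density) auto
    also have "\<dots> = (\<integral>\<^sup>+(x::real). 0 \<partial>lborel)" by (intro nn_integral_cong) (auto simp: indicator_def)
    finally show ?thesis by simp
  qed
  have "emeasure R (space R) = (SUP n. emeasure R {..real n})"
  proof -
    have "(\<Union>n. {..real n}) = space R"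
      using real_arch_simple by (auto simp: R_def)
    then show ?thesis
      by (subst SUP_emeasure_incseq) (auto simp: R_def incseq_def)
  qed
  also have "\<dots> = (SUP n. ennreal (cdf N (real (Suc n))))"
  proof (rule antisym; rule SUP_mono)
    show "\<exists>m\<in>UNIV. emeasure R {..real n} \<le> ennreal (cdf N (real (Suc m)))" for n
      by (intro bexI[of _ n]) (auto simp: R_def simp flip: R_pos intro!: emeasure_mono)
    show "\<exists>m\<in>UNIV. ennreal (cdf N (real (Suc n))) \<le> emeasure R {..real m}" for n
      by (intro bexI[of _ "Suc n"]) (simp_all add: R_pos)
  qed
  also have "\<dots> = 1"
  proof -
    have "(\<lambda>n. ennreal (cdf N (real (Suc n)))) \<longlonglongrightarrow> ennreal 1"
      using N.cdf_lim_infty_prob by (intro tendsto_ennrealI) (rule LIMSEQ_Suc)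
    moreover have "incseq (\<lambda>n. ennreal (cdf N (real (Suc n))))"
      by (auto simp: incseq_def intro!: ennreal_leI N.cdf_nondecreasing)
    ultimately show ?thesis using LIMSEQ_SUP LIMSEQ_unique by (metis ennreal_1)
  qed
  finally interpret R: prob_space R by (intro prob_spaceI) 
  have "real_distribution R" by standard (simp add: R_def)
  moreover have "cdf N x = cdf R x" if "0 < x" for x
    using R_pos[OF that] N.cdf_nonneg[of x] unfolding cdf_def2 measure_def[of R] by (simp add: measure_def)
  moreover have "cdf R 0 = 0" by (simp add: cdf_def2 measure_def R0)
  ultimately show "N = density lborel ?w"
    unfolding R_def[symmetric] using real_distribution_eqI_pos assms(1) by blast
qed

context stable_law
begin

text \<open>\<open>process_density\<close> is a pointwise derivative, so the distribution function
  must be differentiable at every positive point; continuity of the stable density provides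
  this.\<close>

lemma stable_cdf_derivative:
  "\<exists>g. continuous_on {0<..} g \<and> (\<forall>s>0. (cdf D has_real_derivative g s) (at s))"
proof -
  obtain g where g: "continuous_on {0<..} g" "\<And>s. 0 \<le> g s" "g \<in> borel_measurable borel"
    and D: "D = density lborel (\<lambda>s. ennreal (g s) * indicator {0<..} s)" using stable_density by blast
  note [measurable] = g(3)
  have "(cdf D has_real_derivative g s) (at s)" if s: "0 < s" for s
  proof -
    \<comment> \<open>Half of \<open>s\<close> keeps the interval of integration away from zero,
      where \<open>g\<close> need not be continuous.\<close>
    define a where "a = s / 2"
    have a: "0 < a" "a < s" using s by (auto simp: a_def)
    have cont: "continuous_on {a..s + 1} g" using a by (intro continuous_on_subset[OF g(1)]) auto
    have cdf_eq: "cdf D u = cdf D a + integral {a..u} g" if u: "u \<in> {a<..<s+1}" for u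
    proof -
      have int: "set_integrable lborel {a..u} g"
        using cont u by (intro borel_integrable_atLeastAtMost' continuous_on_subset[OF cont]) auto
      have "emeasure D {a<..u} = (\<integral>\<^sup>+x. ennreal (g x) * indicator {0<..} x * indicator {a<..u} x \<partial>lborel)"
        by (subst D, subst emeasure_density) auto
      also have "\<dots> = (\<integral>\<^sup>+x. ennreal (indicator {a..u} x *\<^sub>R g x) \<partial>lborel)"
        using AE_lborel_singleton[of a] a
        by (intro nn_integral_cong_AE) (auto elim!: eventually_mono simp: indicator_def)
      also have "\<dots> = ennreal (LBINT x:{a..u}. g x)"
        using int g(2) by (subst nn_integral_eq_integral) (auto simp: set_integrable_def set_lebesgue_integral_def)
      also have "(LBINT x:{a..u}. g x) = integral {a..u} g"
        using int by (rule set_borel_integral_eq_integral)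
      finally have "measure D {a<..u} = integral {a..u} g"
        using g(2) set_borel_integral_eq_integral(1)[OF int]
        by (simp add: measure_def integral_nonneg)
      then show ?thesis using cdf_diff_eq[of a u] u by simp
    qed
    have "((\<lambda>u. cdf D a + integral {a..u} g) has_real_derivative 0 + g s) (at s within {a..s+1})"
      using a by (intro DERIV_add DERIV_const integral_has_real_derivative cont) auto
    then have "((\<lambda>u. cdf D a + integral {a..u} g) has_real_derivative g s) (at s within {a<..<s+1})"
      using DERIV_subset[of _ "0 + g s" s "{a..s+1}" "{a<..<s+1}"] by (simp add: subset_iff)
    then have "((\<lambda>u. cdf D a + integral {a..u} g) has_real_derivative g s) (at s)"
      using a at_within_open[of s "{a<..<s+1}"] by simp
    then show ?thesis
      by (rule has_field_derivative_transform_within_open[where S="{a<..<s+1}"]) (use a in \<open>simp_all add: cdf_eq\<close>)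
  qed
  with g(1) show ?thesis by blast
qed

lemma stable_no_atoms: "measure D {x} = 0"
proof -
  obtain g where g: "g \<in> borel_measurable borel"
    and D: "D = density lborel (\<lambda>s. ennreal (g s) * indicator {0<..} s)" using stable_density by blast
  note [measurable] = g
  have "emeasure D {x} = 0"
    by (subst D, subst emeasure_density) (auto simp: nn_integral_indicator_singleton)
  then show ?thesis by (simp add: measure_def)
qed

lemma isCont_stable_cdf: "isCont (cdf D) x"
  by (simp add: isCont_cdf stable_no_atoms)

lemma stable_cdf_0: "cdf D 0 = 0"
proof -
  have "{..0} \<in> null_sets D"
    using AE_pos by (subst AE_iff_null_sets) (auto simp: not_le elim!: eventually_mono)
  then show ?thesis by (simp add: cdf_def measure_def null_sets_def)
qed

section \<open>The Caputo identity in one variable\<close>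

text \<open>With \<open>r = x * (t - \<tau>) / \<tau>\<close> one has
  \<open>x + r = x * t / \<tau>\<close>, and \<open>{0<..<t}\<close> is mapped onto the positive
  axis. The substitution is done on compact intervals \<open>{0..b n}\<close> in the increasing
  variable \<open>v = t - \<tau>\<close>, followed by monotone convergence; \<open>f 0 = 0\<close>
  makes their closed left end harmless.\<close>

lemma nn_integral_shift_to_ratio:
  fixes f :: "real \<Rightarrow> ennreal"
  assumes [measurable]: "f \<in> borel_measurable borel" and x: "0 < x" and t: "0 < t" and f0: "f 0 = 0"
  shows "(\<integral>\<^sup>+r. f r * indicator {0<..} r \<partial>lborel)
    = (\<integral>\<^sup>+\<tau>. f (x * (t - \<tau>) / \<tau>) * ennreal (x * t / \<tau>\<^sup>2) * indicator {0<..<t} \<tau> \<partial>lborel)"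
proof -
  define g where "g v = x * v / (t - v)" for v
  define g' where "g' v = x * t / (t - v)\<^sup>2" for v
  \<comment> \<open>Solves \<open>g (b n) = x * (n + 1)\<close>, so that the images
    \<open>{0..x * (n + 1)}\<close> exhaust the half-line.\<close>
  define b where "b n = t * (real n + 1) / (real n + 2)" for n :: nat
  have b: "0 < b n" "b n < t" for n
    using t unfolding b_def by (intro divide_pos_pos mult_pos_pos, auto simp: field_simps)
  have g_b: "g (b n) = x * (real n + 1)" for n
  proof -
    have "t - b n = t / (real n + 2)" by (simp add: b_def field_simps)
    moreover have "x * (t * (d - 1) / d) / (t / d) = x * (d - 1)" if "0 < d" for d
      using t that by simp
    from this[of "real n + 2"] have "x * b n / (t / (real n + 2)) = x * (real n + 1)"
      by (simp add: b_def add.commute)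
    ultimately show ?thesis by (simp add: g_def)
  qed
  have b_incseq: "b m \<le> b n" if "m \<le> n" for m n
    using that t unfolding b_def by (simp add: frac_le divide_simps algebra_simps) 
  have [measurable]: "g \<in> borel_measurable borel" "g' \<in> borel_measurable borel"
    unfolding g_def g'_def by measurable
  have fin: "(\<integral>\<^sup>+r. f r * indicator {0..x * (real n + 1)} r \<partial>lborel)
    = (\<integral>\<^sup>+v. f (g v) * ennreal (g' v) * indicator {0..b n} v \<partial>lborel)" for n
  proof -
    have "(\<integral>\<^sup>+r. f r * indicator {g 0..g (b n)} r \<partial>lborel)
      = (\<integral>\<^sup>+v. f (g v) * ennreal (g' v) * indicator {0..b n} v \<partial>lborel)"
    proof (rule nn_integral_substitution_aux)
      fix v assume v: "v \<in> {0..b n}"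
      then have "t - v \<noteq> 0" using b[of n] by auto
      then show "(g has_real_derivative g' v) (at v)"
        unfolding g_def g'_def
        by (auto intro!: derivative_eq_intros simp: power2_eq_square field_simps)
      show "0 \<le> g' v" using x t by (simp add: g'_def)
    next
      show "continuous_on {0..b n} g'" unfolding g'_def
        using b[of n] by (intro continuous_intros) auto
    qed (use b in auto)
    then show ?thesis by (simp only: g_b) (simp add: g_def)
  qed
  have "(\<integral>\<^sup>+r. f r * indicator {0<..} r \<partial>lborel)
      = (\<integral>\<^sup>+r. (SUP n::nat. f r * indicator {0..x * (real n + 1)} r) \<partial>lborel)"
  proof (rule nn_integral_cong)
    fix r :: real
    obtain m :: nat where m: "r / x < real m" using reals_Archimedean2 by blast
    then have m': "r \<le> x * (real m + 1)" using x by (simp add: field_simps)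
    show "f r * indicator {0<..} r = (SUP n::nat. f r * indicator {0..x * (real n + 1)} r)"
      using m' f0
      by (cases r "0::real" rule: linorder_cases)
         (auto intro!: antisym SUP_least SUP_upper2[of m] simp: indicator_def)
  qed
  also have "\<dots> = (SUP n::nat. \<integral>\<^sup>+r. f r * indicator {0..x * (real n + 1)} r \<partial>lborel)"
  proof (rule nn_integral_monotone_convergence_SUP)
    show "incseq (\<lambda>(n::nat) r. f r * indicator {0..x * (real n + 1)} r)"
    proof (intro incseq_SucI le_funI)
      fix n :: nat and r
      have "x * (real n + 1) \<le> x * (real (Suc n) + 1)" using x by simp
      then show "f r * indicator {0..x * (real n + 1)} r \<le> f r * indicator {0..x * (real (Suc n) + 1)} r"
        by (auto simp: indicator_def)
    qed
  qed measurable
  also have "\<dots> = (SUP n. \<integral>\<^sup>+v. f (g v) * ennreal (g' v) * indicator {0..b n} v \<partial>lborel)"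
    by (simp only: fin)
  also have "\<dots> = (\<integral>\<^sup>+v. (SUP n. f (g v) * ennreal (g' v) * indicator {0..b n} v) \<partial>lborel)"
  proof (rule nn_integral_monotone_convergence_SUP[symmetric])
    show "incseq (\<lambda>n v. f (g v) * ennreal (g' v) * indicator {0..b n} v)"
    proof (intro incseq_SucI le_funI)
      fix n v
      have "b n \<le> b (Suc n)" by (rule b_incseq) simp
      then show "f (g v) * ennreal (g' v) * indicator {0..b n} v \<le> f (g v) * ennreal (g' v) * indicator {0..b (Suc n)} v"
        by (auto simp: indicator_def)
    qed
  qed measurable
  also have "\<dots> = (\<integral>\<^sup>+v. f (g v) * ennreal (g' v) * indicator {0..<t} v \<partial>lborel)"
  proof (rule nn_integral_cong)
    fix v :: real
    show "(SUP n. f (g v) * ennreal (g' v) * indicator {0..b n} v) = f (g v) * ennreal (g' v) * indicator {0..<t} v"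
    proof (cases "v \<in> {0..<t}")
      case True
      have "b \<longlonglongrightarrow> t" unfolding b_def by real_asymp
      then have "\<forall>\<^sub>F n in sequentially. v < b n" using True by (auto intro: order_tendstoD)
      then obtain m where "v < b m" by (auto dest: eventually_happens)
      then show ?thesis using True
        by (auto intro!: antisym SUP_least SUP_upper2[of m] simp: indicator_def)
    next
      case False
      then have "v \<notin> {0..b n}" for n using b[of n] by auto
      then show ?thesis using False by simp
    qed
  qed
  also have "\<dots> = (\<integral>\<^sup>+\<tau>. f (g (t - \<tau>)) * ennreal (g' (t - \<tau>)) * indicator {0..<t} (t - \<tau>) \<partial>lborel)"
    using nn_integral_real_affine[of "\<lambda>v. f (g v) * ennreal (g' v) * indicator {0..<t} v" "-1" t] by simp
  also have "\<dots> = (\<integral>\<^sup>+\<tau>. f (x * (t - \<tau>) / \<tau>) * ennreal (x * t / \<tau>\<^sup>2) * indicator {0<..<t} \<tau> \<partial>lborel)"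
    using AE_lborel_singleton[of t]
    by (intro nn_integral_cong_AE) (auto elim!: eventually_mono simp: indicator_def g_def g'_def)
  finally show ?thesis .
qed

text \<open>The substitution \<open>x + r = x * t / \<tau>\<close> turns the shift identity into the statement that the Caputo derivative
  of \<open>t \<mapsto> E g((t / S) powr \<alpha>)\<close> is \<open>E g'((t / S) powr \<alpha>)\<close>, with \<open>v = g'\<close>.\<close>

lemma nn_integral_stable_caputo:
  assumes [measurable]: "v \<in> borel_measurable borel" and t: "0 < t"
  shows "(\<integral>\<^sup>+\<tau>. ennreal (stable_const * \<tau> powr (\<alpha> - 1) * (t - \<tau>) powr - \<alpha>) *
      (\<integral>\<^sup>+x. ennreal (x powr - \<alpha>) * v ((\<tau> / x) powr \<alpha>) \<partial>D) * indicator {0<..<t} \<tau> \<partial>lborel)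
    = (\<integral>\<^sup>+x. v ((t / x) powr \<alpha>) \<partial>D)"
proof -
  interpret DL: pair_sigma_finite D lborel ..
  define V where "V s = v ((t / s) powr \<alpha>)" for s
  have [measurable]: "V \<in> borel_measurable borel" unfolding V_def by measurable
  define w where "w \<tau> = stable_const * \<tau> powr (\<alpha> - 1) * (t - \<tau>) powr - \<alpha>" for \<tau>
  have [measurable]: "w \<in> borel_measurable borel" unfolding w_def by measurable
  let ?G = "\<lambda>x \<tau>. ennreal (w \<tau>) * indicator {0<..<t} \<tau> * (ennreal (x powr - \<alpha>) * v ((\<tau> / x) powr \<alpha>))"
  have "(\<integral>\<^sup>+x. V x \<partial>D) = (\<integral>\<^sup>+r. (\<integral>\<^sup>+x. shift_weight x r * V (x + r) \<partial>D)
      * indicator {0<..} r \<partial>lborel)" by (rule nn_integral_stable_shift) measurable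
  also have "\<dots> = (\<integral>\<^sup>+r. \<integral>\<^sup>+x. shift_weight x r * V (x + r)
      * indicator {0<..} r \<partial>D \<partial>lborel)" by (simp add: nn_integral_multc)
  also have "\<dots> = (\<integral>\<^sup>+x. \<integral>\<^sup>+r. shift_weight x r * V (x + r)
      * indicator {0<..} r \<partial>lborel \<partial>D)" by (rule DL.Fubini') measurable
  also have "\<dots> = (\<integral>\<^sup>+x. \<integral>\<^sup>+\<tau>. ?G x \<tau>
        \<partial>lborel \<partial>D)"
  proof (rule nn_integral_cong_AE, use AE_pos in eventually_elim)
    fix x :: real assume x: "0 < x"
    have "(\<integral>\<^sup>+r. shift_weight x r * V (x + r) * indicator {0<..} r \<partial>lborel)
      = (\<integral>\<^sup>+\<tau>. (shift_weight x (x * (t - \<tau>) / \<tau>) * V (x + x * (t - \<tau>) / \<tau>))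
          * ennreal (x * t / \<tau>\<^sup>2) * indicator {0<..<t} \<tau> \<partial>lborel)"
      \<comment> \<open>The convention \<open>0 powr - \<alpha> = 0\<close> supplies the condition
        \<open>f 0 = 0\<close>.\<close>
      by (rule nn_integral_shift_to_ratio[OF _ x t, of "\<lambda>r. shift_weight x r * V (x + r)"])
         auto
    also have "\<dots> = (\<integral>\<^sup>+\<tau>. ?G x \<tau> \<partial>lborel)"
    proof (rule nn_integral_cong)
      fix \<tau> :: real
      show "(shift_weight x (x * (t - \<tau>) / \<tau>) * V (x + x * (t - \<tau>) / \<tau>))
          * ennreal (x * t / \<tau>\<^sup>2) * indicator {0<..<t} \<tau>
        = ?G x \<tau>"
      proof (cases "\<tau> \<in> {0<..<t}")
        case True
        then have \<tau>: "0 < \<tau>" "\<tau> < t" by auto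
        have sum: "x + x * (t - \<tau>) / \<tau> = x * t / \<tau>" using \<tau> by (simp add: field_simps)
        have "V (x + x * (t - \<tau>) / \<tau>) = v ((\<tau> / x) powr \<alpha>)"
          unfolding V_def sum using t by simp
        \<comment> \<open>The Jacobian divided by \<open>x + r\<close> is \<open>1 / \<tau>\<close>,
          and \<open>r powr - \<alpha>\<close> splits off \<open>x powr - \<alpha>\<close>; the
          remaining factors are those of \<open>w \<tau>\<close>.\<close>
        moreover have "stable_const * (x * (t - \<tau>) / \<tau>) powr - \<alpha> / (x * t / \<tau>) * (x * t / \<tau>\<^sup>2)
            = w \<tau> * x powr - \<alpha>"
        proof -
          have split: "c * p / d * e = c * p * (1 / d * e)" for c p d e :: real by simp
          have e1: "(x * (t - \<tau>) / \<tau>) powr - \<alpha> = x powr - \<alpha> * (t - \<tau>) powr - \<alpha> * \<tau> powr \<alpha>"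
            using x \<tau> by (simp add: powr_divide powr_mult powr_minus_divide)
          have e2: "\<tau> powr (\<alpha> - 1) = \<tau> powr \<alpha> / \<tau>" using \<tau> by (simp add: powr_diff)
          have e3: "1 / (x * t / \<tau>) * (x * t / \<tau>\<^sup>2) = 1 / \<tau>"
            using x t \<tau> by (simp add: field_simps power2_eq_square)
          show ?thesis unfolding w_def by (subst split) (simp only: e1 e2 e3, simp)
        qed
        moreover have "0 \<le> stable_const * (x * (t - \<tau>) / \<tau>) powr - \<alpha> / (x * t / \<tau>)" "0 \<le> w \<tau>"
          using stable_const_pos x t \<tau> by (auto simp: w_def)
        ultimately have "ennreal (stable_const * (x * (t - \<tau>) / \<tau>) powr - \<alpha> / (x * t / \<tau>)) * ennreal (x * t / \<tau>\<^sup>2)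
            = ennreal (w \<tau>) * ennreal (x powr - \<alpha>)" "V (x + x * (t - \<tau>) / \<tau>) = v ((\<tau> / x) powr \<alpha>)"
          by (simp_all only: ennreal_mult'[symmetric])
        then show ?thesis using True by (simp add: sum mult_ac)
      qed simp
    qed
    finally show "(\<integral>\<^sup>+r. shift_weight x r * V (x + r) * indicator {0<..} r \<partial>lborel)
      = (\<integral>\<^sup>+\<tau>. ?G x \<tau> \<partial>lborel)" .
  qed
  also have "\<dots> = (\<integral>\<^sup>+\<tau>. \<integral>\<^sup>+x. ?G x \<tau>
        \<partial>D \<partial>lborel)"
  proof -
    have [measurable]: "Measurable.pred (D \<Otimes>\<^sub>M lborel) (\<lambda>p. snd p \<in> {0<..<t})" by measurable
    show ?thesis by (rule DL.Fubini'[symmetric]) measurable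
  qed
  also have "\<dots> = (\<integral>\<^sup>+\<tau>. ennreal (w \<tau>) * indicator {0<..<t} \<tau> * (\<integral>\<^sup>+x. ennreal (x powr - \<alpha>) * v ((\<tau> / x) powr \<alpha>) \<partial>D) \<partial>lborel)"
    by (intro nn_integral_cong nn_integral_cmult) measurable
  finally show ?thesis by (simp add: V_def w_def mult_ac)
qed

text \<open>For \<open>v = 1\<close> and \<open>t = 1\<close> the right-hand side of the Caputo
  identity is 1, whereas an infinite moment would make the left-hand side 0 or infinite.\<close>

lemma stable_moment_finite: "(\<integral>\<^sup>+x. ennreal (x powr - \<alpha>) \<partial>D) < \<infinity>"
proof (rule ccontr)
  let ?k = "\<lambda>\<tau>. ennreal (stable_const * \<tau> powr (\<alpha> - 1) * (1 - \<tau>) powr - \<alpha>)"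
  assume "\<not> ?thesis"
  then have top: "(\<integral>\<^sup>+x. ennreal (x powr - \<alpha>) \<partial>D) = \<top>" by (simp add: less_top[symmetric])
  have "(\<integral>\<^sup>+\<tau>. ?k \<tau> * \<top> * indicator {0<..<1} \<tau> \<partial>lborel)
    = (\<integral>\<^sup>+x. 1 \<partial>D)"
    using nn_integral_stable_caputo[of "\<lambda>_. 1" 1] top by simp
  also have "(\<integral>\<^sup>+\<tau>. ?k \<tau> * \<top> * indicator {0<..<1} \<tau> \<partial>lborel)
    = (\<integral>\<^sup>+\<tau>. \<top> * (?k \<tau> * indicator {0<..<1} \<tau>) \<partial>lborel)"
    by (simp add: mult_ac)
  also have "\<dots> = \<top> * (\<integral>\<^sup>+\<tau>. ?k \<tau> * indicator {0<..<1} \<tau> \<partial>lborel)"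
    by (rule nn_integral_cmult) measurable
  also have "(\<integral>\<^sup>+x. 1 \<partial>D) = 1" using emeasure_space_1 by simp
  finally show False by (auto simp: ennreal_top_mult split: if_splits)
qed

end

section \<open>The law of the inverse stable subordinator\<close>

text \<open>Self-similarity: both sides have the transform
  \<open>exp (- (u * s powr \<alpha>))\<close>, and transforms are unique.\<close>

lemma (in stable_law) stable_distr_eq:
  assumes "prob_space M" and X [measurable]: "X \<in> borel_measurable M" and X0: "AE \<omega> in M. 0 \<le> X \<omega>" and u: "0 < u"
    and lap: "\<And>s. 0 \<le> s \<Longrightarrow> (\<integral>\<omega>. exp (- (s * X \<omega>)) \<partial>M) = exp (- (u * s powr \<alpha>))"
  shows "distr M borel X = distr D borel (\<lambda>x. u powr (1 / \<alpha>) * x)"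
proof -
  interpret M: prob_space M by fact
  show ?thesis
  proof (rule laplace_transform_unique)
    show "real_distribution (distr M borel X)" by (rule M.real_distribution_distr) measurable
    show "real_distribution (distr D borel (\<lambda>x. u powr (1 / \<alpha>) * x))" by (rule real_distribution_distr) measurable
    show "AE x in distr M borel X. 0 \<le> x" using X0 by (simp add: AE_distr_iff)
    show "AE x in distr D borel (\<lambda>x. u powr (1 / \<alpha>) * x). 0 \<le> x"
      using AE_nonneg by (subst AE_distr_iff) (auto elim!: eventually_mono)
    fix n :: nat
    have "(\<integral>x. exp (- (real n * x)) \<partial>distr D borel (\<lambda>x. u powr (1 / \<alpha>) * x))
        = (\<integral>x. exp (- ((real n * u powr (1 / \<alpha>)) * x)) \<partial>D)"
      by (subst integral_distr) (auto simp: mult_ac)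
    also have "\<dots> = exp (- (u * real n powr \<alpha>))"
      using u alpha by (subst laplace) (auto simp: powr_mult powr_powr)
    finally show "(\<integral>x. exp (- (real n * x)) \<partial>distr M borel X)
      = (\<integral>x. exp (- (real n * x)) \<partial>distr D borel (\<lambda>x. u powr (1 / \<alpha>) * x))"
      by (subst integral_distr) (simp_all add: lap)
  qed
qed

lemma (in stable_law) stable_inverse_prob:
  assumes t: "0 < t" and x: "0 < x"
  shows "measure D {s. (t / s) powr \<alpha> \<le> x} = measure D {t / x powr (1 / \<alpha>)..}"
proof (rule finite_measure_eq_AE)
  show "AE s in D. s \<in> {s. (t / s) powr \<alpha> \<le> x} \<longleftrightarrow> s \<in> {t / x powr (1 / \<alpha>)..}"
    using AE_pos
  proof eventually_elim
    fix s :: real assume s: "0 < s"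
    have "(t / s) powr \<alpha> \<le> x \<longleftrightarrow> (t / s) powr \<alpha> \<le> (x powr (1 / \<alpha>)) powr \<alpha>"
      using x alpha by (simp add: powr_powr)
    also have "\<dots> \<longleftrightarrow> t / s \<le> x powr (1 / \<alpha>)"
      using s t alpha powr_mono2[of \<alpha> "t / s" "x powr (1 / \<alpha>)"]
        powr_less_mono2[of \<alpha> "x powr (1 / \<alpha>)" "t / s"]
      by (cases "t / s \<le> x powr (1 / \<alpha>)") (simp_all add: not_le)
    also have "\<dots> \<longleftrightarrow> t / x powr (1 / \<alpha>) \<le> s" using s x by (simp add: field_simps)
    finally show "s \<in> {s. (t / s) powr \<alpha> \<le> x} \<longleftrightarrow> s \<in> {t / x powr (1 / \<alpha>)..}" by simp
  qed
qed measurable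

text \<open>Up to null sets, the event \<open>Y t \<le> x\<close> lies between
  \<open>t < L x\<close> and \<open>t \<le> L x\<close>, which are equally likely because
  \<open>L x\<close> has no atoms; self-similarity of \<open>L x\<close> then gives the law. The
  same \<open>D\<close> serves all \<open>t\<close>.\<close>

lemma inverse_stable_law:
  assumes inv: "inverse_stable_subordinator M \<alpha> Y" and \<alpha>: "0 < \<alpha>" "\<alpha> < 1"
  obtains D where "stable_law D \<alpha>" "\<And>t. 0 \<le> t \<Longrightarrow> distr M borel (Y t) = distr D borel (\<lambda>x. (t / x) powr \<alpha>)"
proof -
  obtain L where L: "stable_subordinator M \<alpha> L"
    and Y: "AE \<omega> in M. \<forall>t\<ge>0. Y t \<omega> = Inf {u. 0 \<le> u \<and> L u \<omega> > t}"
    and Y_meas: "\<And>t. 0 \<le> t \<Longrightarrow> Y t \<in> borel_measurable M"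
    using inv by (auto simp: inverse_stable_subordinator_def)
  interpret M: prob_space M
    using L by (auto simp: stable_subordinator_def levy_subordinator_def levy_process_def)
  have L_meas: "\<And>t. 0 \<le> t \<Longrightarrow> L t \<in> borel_measurable M"
    and L0: "AE \<omega> in M. L 0 \<omega> = 0"
    and L_mono: "AE \<omega> in M. mono_on {0..} (\<lambda>t. L t \<omega>)"
    and L_lap: "\<And>t s. 0 \<le> t \<Longrightarrow> 0 \<le> s \<Longrightarrow> (\<integral>\<omega>. exp (- (s * L t \<omega>)) \<partial>M) = exp (- (t * s powr \<alpha>))"
    using L by (auto simp: stable_subordinator_def levy_subordinator_def levy_process_def)
  have L_right: "AE \<omega> in M. \<forall>t\<ge>0. ((\<lambda>u. L u \<omega>) \<longlongrightarrow> L t \<omega>) (at_right t)"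
    using L by (auto simp: stable_subordinator_def levy_subordinator_def levy_process_def elim!: eventually_mono)
  have L_nonneg: "AE \<omega> in M. 0 \<le> L t \<omega>" if "0 \<le> t" for t
    using L0 L_mono
  proof eventually_elim
    case (elim \<omega>)
    then show ?case using that mono_onD[of "{0..}" "\<lambda>t. L t \<omega>" 0 t] by simp
  qed
  define D where "D = distr M borel (L 1)"
  note [measurable] = L_meas[of 1, simplified]
  have "stable_law D \<alpha>"
  proof (intro stable_law.intro stable_law_axioms.intro \<alpha>)
    show "real_distribution D" unfolding D_def by (rule M.real_distribution_distr) measurable
    show "AE x in D. 0 \<le> x" using L_nonneg[of 1] unfolding D_def by (subst AE_distr_iff) auto
    show "(\<integral>x. exp (- (s * x)) \<partial>D) = exp (- (s powr \<alpha>))" if "0 \<le> s" for s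
      using that by (simp add: D_def integral_distr L_lap)
  qed
  then interpret D: stable_law D \<alpha> .
  have L_distr: "distr M borel (L u) = distr D borel (\<lambda>x. u powr (1 / \<alpha>) * x)" if "0 < u" for u
    using that by (intro D.stable_distr_eq M.prob_space_axioms L_meas L_nonneg L_lap) auto
  have L_prob: "measure M {\<omega> \<in> space M. L u \<omega> \<in> A} = measure D {x. u powr (1 / \<alpha>) * x \<in> A}"
    if u: "0 < u" and [measurable]: "A \<in> sets borel" for u A
  proof -
    have "measure (distr M borel (L u)) A = measure (distr D borel (\<lambda>x. u powr (1 / \<alpha>) * x)) A"
      by (simp add: L_distr u)
    then show ?thesis
      using u L_meas[of u] by (simp add: measure_distr vimage_def Int_def conj_commute)
  qed
  have scale: "u powr (1 / \<alpha>) * x \<le> y \<longleftrightarrow> x \<le> y / u powr (1 / \<alpha>)" if "0 < u" for u x y :: real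
    using that by (simp add: field_simps)
  have L_pos: "AE \<omega> in M. 0 < L u \<omega>" if "0 < u" for u
  proof -
    have "measure M {\<omega> \<in> space M. L u \<omega> \<in> {..0}} = measure D {x. x \<le> 0}"
      using that by (subst L_prob) (auto simp: scale)
    then have "measure M {\<omega> \<in> space M. L u \<omega> \<le> 0} = 0"
      using D.stable_cdf_0 by (simp add: cdf_def atMost_def)
    then have "AE \<omega> in M. \<not> L u \<omega> \<le> 0"
      using that L_meas[of u] by (subst M.prob_Collect_eq_0[symmetric]) auto
    then show ?thesis by (auto simp: not_le)
  qed
  \<comment> \<open>The infimum defining \<open>Y t\<close> is meaningful only if the level
    \<open>t\<close> is passed. The probability of never passing it is at most the distribution
    function of \<open>D\<close> at points tending to zero, where that function is continuous and
    vanishes.\<close>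
  have L_unbounded: "AE \<omega> in M. \<exists>n::nat. t < L (real n) \<omega>" for t
  proof -
    have [measurable]: "L (real n) \<in> borel_measurable M" for n :: nat by (intro L_meas) simp
    define E where "E = {\<omega> \<in> space M. \<forall>n::nat. L (real n) \<omega> \<le> t}"
    have [measurable]: "E \<in> sets M" unfolding E_def by measurable
    have bound: "measure M E \<le> cdf D (t / real (Suc n) powr (1 / \<alpha>))" for n
    proof -
      have "measure M E \<le> measure M {\<omega> \<in> space M. L (real (Suc n)) \<omega> \<in> {..t}}"
        by (intro M.finite_measure_mono) (auto simp: E_def simp del: of_nat_Suc)
      also have "\<dots> = cdf D (t / real (Suc n) powr (1 / \<alpha>))"
        by (subst L_prob) (auto simp: scale cdf_def atMost_def simp del: of_nat_Suc)
      finally show ?thesis .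
    qed
    have "(\<lambda>n. t / real (Suc n) powr (1 / \<alpha>)) \<longlonglongrightarrow> 0" using \<alpha> by real_asymp
    then have "(\<lambda>n. cdf D (t / real (Suc n) powr (1 / \<alpha>))) \<longlonglongrightarrow> cdf D 0"
      by (rule isCont_tendsto_compose[OF D.isCont_stable_cdf])
    then have "measure M E \<le> 0" unfolding D.stable_cdf_0
      by (rule LIMSEQ_le_const) (use bound in auto)
    then have "measure M E = 0" using measure_nonneg[of M E] by linarith
    then have "AE \<omega> in M. \<not> (\<forall>n::nat. L (real n) \<omega> \<le> t)"
      unfolding E_def by (subst M.prob_Collect_eq_0[symmetric]) auto
    then show ?thesis by (auto simp: not_le)
  qed
  \<comment> \<open>The first implication is the definition of the infimum. The second gets
    \<open>t \<le> L u\<close> for all \<open>u > x\<close> from monotonicity and lets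
    \<open>u\<close> decrease to \<open>x\<close> by right continuity; a strict inequality would not
    survive this limit.\<close>
  have Y_le: "AE \<omega> in M. (t < L x \<omega> \<longrightarrow> Y t \<omega> \<le> x) \<and> (Y t \<omega> \<le> x \<longrightarrow> t \<le> L x \<omega>)"
    if t: "0 \<le> t" and x: "0 \<le> x" for t x
    using Y L_mono L_right L_unbounded[of t]
  proof eventually_elim
    case (elim \<omega>)
    let ?A = "{u. 0 \<le> u \<and> L u \<omega> > t}"
    have Y_eq: "Y t \<omega> = Inf ?A" using elim(1) t by blast
    have bdd: "bdd_below ?A" by (rule bdd_belowI[of _ 0]) auto
    have ne: "?A \<noteq> {}" using elim(4) by (auto intro: of_nat_0_le_iff)
    show ?case
    proof (intro conjI impI)
      assume "t < L x \<omega>"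
      then show "Y t \<omega> \<le> x" unfolding Y_eq using x by (intro cInf_lower bdd) auto
    next
      assume le: "Y t \<omega> \<le> x"
      have "t \<le> L u \<omega>" if u: "x < u" for u
      proof -
        have "Inf ?A < u" using le u Y_eq by simp
        then obtain v where v: "v \<in> ?A" "v < u" using cInf_less_iff[OF ne bdd] by blast
        then have "L v \<omega> \<le> L u \<omega>" using elim(2) x u by (intro mono_onD[OF elim(2)]) auto
        then show ?thesis using v by auto
      qed
      then have "\<forall>\<^sub>F u in at_right x. t \<le> L u \<omega>"
        by (auto simp: eventually_at_right_field intro!: exI[of _ "x + 1"])
      then show "t \<le> L x \<omega>"
        using elim(3) x by (intro tendsto_lowerbound[of "\<lambda>u. L u \<omega>" _ "at_right x"]) auto
    qed
  qed
  have law: "distr M borel (Y t) = distr D borel (\<lambda>x. (t / x) powr \<alpha>)" if t: "0 < t" for t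
  proof (rule real_distribution_eqI_pos)
    have Yt [measurable]: "Y t \<in> borel_measurable M" using t by (intro Y_meas) simp
    show "real_distribution (distr M borel (Y t))" by (rule M.real_distribution_distr) measurable
    show "real_distribution (distr D borel (\<lambda>x. (t / x) powr \<alpha>))" by (rule D.real_distribution_distr) measurable
    show "cdf (distr D borel (\<lambda>x. (t / x) powr \<alpha>)) 0 = 0"
    proof -
      have "measure D {x. (t / x) powr \<alpha> \<le> 0} = 0"
      proof (subst D.prob_eq_0)
        show "AE x in D. x \<notin> {x. (t / x) powr \<alpha> \<le> 0}"
          using D.AE_pos by eventually_elim (use t in \<open>auto simp: not_le\<close>)
      qed simp
      then show ?thesis by (simp add: cdf_def measure_distr vimage_def)
    qed
    fix x :: real assume x: "0 < x"
    have Lx [measurable]: "L x \<in> borel_measurable M" using x by (intro L_meas) simp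
    define y where "y = t / x powr (1 / \<alpha>)"
    have y: "0 < y" using t x by (simp add: y_def)
    have "measure M {\<omega> \<in> space M. L x \<omega> \<in> {t<..}} = measure D {y<..}"
      using x scale[OF x, of _ t] by (subst L_prob) (auto simp: y_def not_le[symmetric] greaterThan_def)
    also have "\<dots> = measure D {y..}"
    proof -
      have "{y..} = {y<..} \<union> {y}" by auto
      then show ?thesis using D.finite_measure_Union[of "{y<..}" "{y}"] by (simp add: D.stable_no_atoms)
    qed
    also have gt: "\<dots> = measure D {s. t \<le> x powr (1 / \<alpha>) * s}"
      by (rule arg_cong[where f="measure D"]) (use x in \<open>auto simp: y_def field_simps\<close>)
    also have "\<dots> = measure M {\<omega> \<in> space M. L x \<omega> \<in> {t..}}"
      using x by (subst L_prob) auto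
    finally have eq: "measure M {\<omega> \<in> space M. t < L x \<omega>} = measure M {\<omega> \<in> space M. t \<le> L x \<omega>}" by simp
    have ge: "measure M {\<omega> \<in> space M. t \<le> L x \<omega>} = measure D {y..}"
      using x unfolding gt by (subst L_prob[of x "{t..}", simplified, symmetric]) auto
    have "measure M {\<omega> \<in> space M. t < L x \<omega>} \<le> measure M {\<omega> \<in> space M. Y t \<omega> \<le> x}"
      by (rule M.finite_measure_mono_AE) (use Y_le[of t x] t x in \<open>auto elim!: eventually_mono\<close>)
    moreover have "measure M {\<omega> \<in> space M. Y t \<omega> \<le> x} \<le> measure M {\<omega> \<in> space M. t \<le> L x \<omega>}"
      by (rule M.finite_measure_mono_AE) (use Y_le[of t x] t x in \<open>auto elim!: eventually_mono\<close>)
    ultimately have "measure M {\<omega> \<in> space M. Y t \<omega> \<le> x} = measure D {y..}" using eq ge by linarith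
    also have "\<dots> = measure D {s. (t / s) powr \<alpha> \<le> x}"
      unfolding y_def by (rule D.stable_inverse_prob[symmetric]) fact+
    finally show "cdf (distr M borel (Y t)) x = cdf (distr D borel (\<lambda>x. (t / x) powr \<alpha>)) x"
      by (simp add: cdf_def measure_distr vimage_def Int_def conj_commute)
  qed
  \<comment> \<open>\<open>L\<close> is almost surely positive at all times
    \<open>1 / (n + 1)\<close>, so level zero is passed immediately.\<close>
  have Y0: "AE \<omega> in M. Y 0 \<omega> = 0"
  proof -
    have "AE \<omega> in M. \<forall>n::nat. 0 < L (1 / real (Suc n)) \<omega>"
      unfolding AE_all_countable by (auto intro!: L_pos simp del: of_nat_Suc)
    with Y show ?thesis
    proof eventually_elim
      case (elim \<omega>)
      let ?A = "{u. 0 \<le> u \<and> L u \<omega> > 0}"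
      have Y_eq: "Y 0 \<omega> = Inf ?A" using elim(1) by blast
      have bdd: "bdd_below ?A" by (rule bdd_belowI[of _ 0]) auto
      have mem: "1 / real (Suc n) \<in> ?A" for n using elim(2) by simp
      have "Y 0 \<omega> \<le> 0"
      proof (rule LIMSEQ_le_const)
        show "(\<lambda>n. 1 / real (Suc n)) \<longlonglongrightarrow> 0" by real_asymp
        show "\<exists>N. \<forall>n\<ge>N. Y 0 \<omega> \<le> 1 / real (Suc n)"
          unfolding Y_eq using cInf_lower[OF mem bdd] by blast
      qed
      moreover have "0 \<le> Y 0 \<omega>" unfolding Y_eq using mem[of 0] by (intro cInf_greatest) (blast, simp)
      ultimately show ?case by simp
    qed
  qed
  have "distr M borel (Y t) = distr D borel (\<lambda>x. (t / x) powr \<alpha>)" if t: "0 \<le> t" for t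
  proof (cases "t = 0")
    \<comment> \<open>As \<open>0 / x = 0\<close> and \<open>0 powr \<alpha> = 0\<close>, both laws
      are the point mass at zero.\<close>
    case True
    have "distr M borel (Y 0) = distr M borel (\<lambda>_. 0)"
      using Y0 by (intro distr_cong_AE refl Y_meas) auto
    then show ?thesis using True by (simp add: M.distr_const D.distr_const)
  qed (use t law in auto)
  with \<open>stable_law D \<alpha>\<close> show thesis by (rule that)
qed

text \<open>The distribution function of \<open>Y t\<close> at \<open>x > 0\<close> is the upper
  tail of the stable law at \<open>t / x powr (1 / \<alpha>)\<close>. The chain rule shows that the
  total function \<open>deriv\<close> in \<open>process_density\<close> is a genuine, continuous
  derivative there.\<close>

lemma process_density_law:
  assumes inv: "inverse_stable_subordinator M \<alpha> Y" and \<alpha>: "0 < \<alpha>" "\<alpha> < 1" and t: "0 < t"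
  shows "(\<lambda>x. ennreal (process_density M Y t x) * indicator {0<..} x) \<in> borel_measurable borel"
    and "distr M borel (Y t) = density lborel (\<lambda>x. ennreal (process_density M Y t x) * indicator {0<..} x)"
    and "0 < x \<Longrightarrow> 0 \<le> process_density M Y t x"
proof -
  obtain D where "stable_law D \<alpha>" and law: "distr M borel (Y t) = distr D borel (\<lambda>x. (t / x) powr \<alpha>)"
    using inverse_stable_law[OF inv \<alpha>] t by (metis less_imp_le)
  then interpret D: stable_law D \<alpha> by simp
  have [measurable]: "Y t \<in> borel_measurable M"
    using inv t by (simp add: inverse_stable_subordinator_def)
  define N where "N = distr M borel (Y t)"
  have N: "real_distribution N" unfolding N_def law by (rule D.real_distribution_distr) measurable
  obtain g where g: "continuous_on {0<..} g" "\<And>s. 0 < s \<Longrightarrow> (cdf D has_real_derivative g s) (at s)"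
    using D.stable_cdf_derivative by blast
  define y where "y x = t / x powr (1 / \<alpha>)" for x
  have y_pos: "0 < y x" if "0 < x" for x using t that by (simp add: y_def)
  have cdf_D: "cdf N x = measure D {s. (t / s) powr \<alpha> \<le> x}" for x
    unfolding N_def law by (simp add: cdf_def measure_distr vimage_def)
  have cdf_N: "cdf N x = 1 - cdf D (y x)" if "0 < x" for x
  proof -
    have "{y x..} = space D - {..<y x}" by auto
    then have "measure D {y x..} = 1 - measure D {..<y x}"
      by (simp only:) (rule D.prob_compl, simp)
    also have "measure D {..<y x} = cdf D (y x)"
    proof -
      have "{..y x} = {..<y x} \<union> {y x}" by auto
      then show ?thesis
        using D.finite_measure_Union[of "{..<y x}" "{y x}"] by (simp add: cdf_def D.stable_no_atoms)
    qed
    finally show ?thesis using that t by (simp add: cdf_D D.stable_inverse_prob y_def)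
  qed
  define y' where "y' x = - (t / \<alpha>) * x powr (- (1 / \<alpha>) - 1)" for x
  have y_deriv: "(y has_real_derivative y' x) (at x)" if "0 < x" for x
  proof -
    have "((\<lambda>x. t * x powr - (1 / \<alpha>)) has_real_derivative y' x) (at x)"
      unfolding y'_def using that by (auto intro!: derivative_eq_intros)
    then show ?thesis by (simp add: y_def[abs_def] powr_minus divide_inverse)
  qed
  define f where "f x = - (g (y x) * y' x)" for x
  have cdf_deriv: "(cdf N has_real_derivative f x) (at x)" if x: "0 < x" for x
  proof -
    have "((\<lambda>x. 1 - cdf D (y x)) has_real_derivative 0 - g (y x) * y' x) (at x)"
      using y_pos[OF x] by (intro DERIV_diff DERIV_const DERIV_chain2[of "cdf D"] g y_deriv x)
    then have "((\<lambda>x. 1 - cdf D (y x)) has_real_derivative f x) (at x)" by (simp add: f_def)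
    then show ?thesis
      by (rule has_field_derivative_transform_within_open[where S="{0<..}"]) (use x in \<open>simp_all add: cdf_N\<close>)
  qed
  have "(\<lambda>y. measure M {\<omega> \<in> space M. Y t \<omega> \<le> y}) = cdf N"
    by (auto simp: N_def cdf_def measure_distr vimage_def Int_def conj_commute)
  then have density_eq: "process_density M Y t x = f x" if "0 < x" for x
    using cdf_deriv[OF that] by (simp add: process_density_def DERIV_imp_deriv)
  have y_cont: "continuous_on {0<..} y"
    using y_deriv by (auto intro!: continuous_at_imp_continuous_on DERIV_isCont)
  have f_cont: "continuous_on {0<..} f"
    unfolding f_def y'_def
    by (intro continuous_intros continuous_on_compose2[OF g(1) y_cont]) (use y_pos in auto)
  have N0: "cdf N 0 = 0"
    unfolding cdf_D
  proof (subst D.prob_eq_0)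
    show "AE s in D. s \<notin> {s. (t / s) powr \<alpha> \<le> 0}"
      using D.AE_pos by eventually_elim (use t in \<open>auto simp: not_le\<close>)
  qed simp
  let ?w = "\<lambda>x. ennreal (process_density M Y t x) * indicator {0<..} x"
  have eq: "?w = (\<lambda>x. ennreal (f x) * indicator {0<..} x)"
    using density_eq by (auto simp: fun_eq_iff indicator_def)
  note * = real_distribution_density_cdf_deriv[OF N N0 f_cont cdf_deriv]
  show "?w \<in> borel_measurable borel"
    unfolding eq by (rule *(1))
  show "distr M borel (Y t) = density lborel ?w"
    unfolding eq N_def[symmetric] by (rule *(2))
  show "0 \<le> process_density M Y t x" if "0 < x" for x
    using *(3)[OF _ that] density_eq[OF that] by simp
qed

section \<open>The marginal distributions of the fractional field\<close>

lemma power_div_fact_le_exp: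
  fixes z :: real
  assumes "0 \<le> z"
  shows "z ^ k / fact k \<le> exp z"
proof -
  have "(\<Sum>n\<in>{k}. z ^ n /\<^sub>R fact n) \<le> exp z"
    unfolding exp_def using summable_exp_generic[of z] assms by (intro sum_le_suminf) auto
  then show ?thesis by (simp add: divide_inverse mult.commute)
qed

lemma classical_prob_bounds:
  assumes "0 < lam" "0 \<le> x1" "0 \<le> x2"
  shows "0 \<le> classical_prob lam k x1 x2" "classical_prob lam k x1 x2 \<le> 1"
proof -
  have z: "0 \<le> lam * x1 * x2" using assms by simp
  then show "0 \<le> classical_prob lam k x1 x2" by (simp add: classical_prob_def)
  show "classical_prob lam k x1 x2 \<le> 1"
    using power_div_fact_le_exp[OF z, of k] by (simp add: classical_prob_def exp_minus field_simps)
qed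

lemma continuous_classical_prob:
  "continuous_on UNIV (\<lambda>p. classical_prob lam k (fst p) (snd p))"
  unfolding classical_prob_def by (intro continuous_intros) auto

text \<open>Right continuity of the counts: the larger rectangles eventually lie in a fixed bounded
  one with finitely many points, and each point outside the limit rectangle is eventually left
  out.\<close>

lemma count_field_eventually_eq:
  fixes u v :: "nat \<Rightarrow> real"
  assumes fin: "\<And>B. bounded B \<Longrightarrow> finite (P \<omega> \<inter> B)"
    and u: "u \<longlonglongrightarrow> y1" "\<And>n. y1 \<le> u n" and v: "v \<longlonglongrightarrow> y2" "\<And>n. y2 \<le> v n"
  shows "\<forall>\<^sub>F n in sequentially. count_field P (u n) (v n) \<omega> = count_field P y1 y2 \<omega>"
proof -
  define F where "F = P \<omega> \<inter> ({0..y1 + 1} \<times> {0..y2 + 1})"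
  have "finite F" unfolding F_def by (intro fin bounded_Times) auto
  moreover have "\<forall>\<^sub>F n in sequentially. p \<in> {0..u n} \<times> {0..v n} \<longleftrightarrow> p \<in> {0..y1} \<times> {0..y2}" for p
  proof (cases "fst p \<le> y1 \<and> snd p \<le> y2")
    case True
    then show ?thesis using u(2) v(2) by (auto simp: mem_Times_iff intro: order_trans intro!: always_eventually)
  next
    case False
    then consider "y1 < fst p" | "y2 < snd p" by linarith
    then show ?thesis
    proof cases
      case 1
      then have "\<forall>\<^sub>F n in sequentially. u n < fst p" using u(1) by (auto intro: order_tendstoD)
      then show ?thesis using 1 by (auto simp: mem_Times_iff elim!: eventually_mono)
    next
      case 2
      then have "\<forall>\<^sub>F n in sequentially. v n < snd p" using v(1) by (auto intro: order_tendstoD)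
      then show ?thesis using 2 by (auto simp: mem_Times_iff elim!: eventually_mono)
    qed
  qed
  ultimately have "\<forall>\<^sub>F n in sequentially. \<forall>p\<in>F. p \<in> {0..u n} \<times> {0..v n} \<longleftrightarrow> p \<in> {0..y1} \<times> {0..y2}"
    by (intro eventually_ball_finite) auto
  moreover have "\<forall>\<^sub>F n in sequentially. u n < y1 + 1" "\<forall>\<^sub>F n in sequentially. v n < y2 + 1"
    using u(1) v(1) by (auto intro: order_tendstoD)
  ultimately show ?thesis
  proof eventually_elim
    case (elim n)
    have "P \<omega> \<inter> ({0..u n} \<times> {0..v n}) = F \<inter> ({0..u n} \<times> {0..v n})"
      using elim by (auto simp: F_def)
    also have "\<dots> = F \<inter> ({0..y1} \<times> {0..y2})" using elim(1) by blast
    also have "\<dots> = P \<omega> \<inter> ({0..y1} \<times> {0..y2})" by (auto simp: F_def)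
    finally show ?case by (simp add: count_field_def)
  qed
qed

lemma poisson_count_field:
  assumes P: "poisson_point_process M lam P"
  shows poisson_count_field_measurable: "(\<lambda>\<omega>. count_field P s1 s2 \<omega>) \<in> measurable M (count_space UNIV)"
    and poisson_count_field_prob: "0 \<le> s1 \<Longrightarrow> 0 \<le> s2 \<Longrightarrow>
      measure M {\<omega> \<in> space M. count_field P s1 s2 \<omega> = k} = classical_prob lam k s1 s2"
proof -
  let ?B = "{0..s1} \<times> {0..s2}"
  have B: "?B \<in> sets borel" "bounded ?B" "?B \<subseteq> {0..} \<times> {0..}"
    by (auto intro!: bounded_Times borel_closed closed_Times)
  then show "(\<lambda>\<omega>. count_field P s1 s2 \<omega>) \<in> measurable M (count_space UNIV)"
    using P unfolding poisson_point_process_def count_field_def by (simp add: Let_def)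
  assume s: "0 \<le> s1" "0 \<le> s2"
  have "measure lborel ?B = measure (lborel \<Otimes>\<^sub>M lborel) ?B" by (simp add: lborel_prod)
  also have "\<dots> = s1 * s2"
    using s by (simp add: measure_def lborel.emeasure_pair_measure_Times enn2real_mult)
  finally have leb: "measure lborel ?B = s1 * s2" .
  have "measure M {\<omega> \<in> space M. card (P \<omega> \<inter> ?B) = k} = exp (- (lam * measure lborel ?B)) * (lam * measure lborel ?B) ^ k / fact k"
    using P B unfolding poisson_point_process_def by (simp add: Let_def)
  then show "measure M {\<omega> \<in> space M. count_field P s1 s2 \<omega> = k} = classical_prob lam k s1 s2"
    by (simp add: leb count_field_def classical_prob_def mult.assoc)
qed

lemma inverse_stable_AE_nonneg:
  assumes inv: "inverse_stable_subordinator M \<alpha> Y" and \<alpha>: "0 < \<alpha>" "\<alpha> < 1" and t: "0 \<le> t"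
  shows "AE \<omega> in M. 0 \<le> Y t \<omega>"
proof -
  obtain D where "stable_law D \<alpha>" and law: "distr M borel (Y t) = distr D borel (\<lambda>x. (t / x) powr \<alpha>)"
    using inverse_stable_law[OF inv \<alpha>] t by metis
  then interpret D: stable_law D \<alpha> by simp
  have [measurable]: "Y t \<in> borel_measurable M"
    using inv t by (simp add: inverse_stable_subordinator_def)
  have "AE x in distr M borel (Y t). 0 \<le> x" unfolding law by (subst AE_distr_iff) auto
  then show ?thesis by (subst (asm) AE_distr_iff) auto
qed

section \<open>Independence and evaluation at random times\<close>

context
  fixes M :: "'a measure" and lam \<alpha>1 \<alpha>2 :: real and P Y1 Y2 and t1 t2 :: real
  assumes fpf: "fractional_poisson_field M lam \<alpha>1 \<alpha>2 P Y1 Y2"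
    and \<alpha>: "0 < \<alpha>1" "\<alpha>1 < 1" "0 < \<alpha>2" "\<alpha>2 < 1" and lam: "0 < lam"
    and t: "0 \<le> t1" "0 \<le> t2"
begin

lemma fpf_parts:
  shows fpf_poisson: "poisson_point_process M lam P"
    and fpf_inverse1: "inverse_stable_subordinator M \<alpha>1 Y1"
    and fpf_inverse2: "inverse_stable_subordinator M \<alpha>2 Y2"
    and fpf_prob_space: "prob_space M"
  using fpf by (auto simp: fractional_poisson_field_def poisson_point_process_def Let_def)

lemma fpf_measurable: "Y1 t1 \<in> borel_measurable M" "Y2 t2 \<in> borel_measurable M"
  using fpf_inverse1 fpf_inverse2 t by (auto simp: inverse_stable_subordinator_def)

lemma process_events_vimage:
  "s \<in> T \<Longrightarrow> A \<in> sets borel \<Longrightarrow> X s -` A \<inter> space M \<in> process_events M T X"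
  unfolding process_events_def by (intro sigma_sets.Basic) auto

lemma fpf_indep_prob:
  assumes A: "A \<in> process_events M {0..} Y1" and B: "B \<in> process_events M {0..} Y2"
    and s: "0 \<le> s1" "0 \<le> s2"
  shows "measure M (A \<inter> B \<inter> {\<omega> \<in> space M. count_field P s1 s2 \<omega> = k})
    = measure M A * measure M B * measure M {\<omega> \<in> space M. count_field P s1 s2 \<omega> = k}"
proof -
  interpret prob_space M by (rule fpf_prob_space)
  define C where "C = {\<omega> \<in> space M. count_field P s1 s2 \<omega> = k}"
  have "C = (\<lambda>(t1, t2) \<omega>. real (count_field P t1 t2 \<omega>)) (s1, s2) -` {real k} \<inter> space M"
    by (auto simp: C_def)
  then have C: "C \<in> process_events M ({0..} \<times> {0..}) (\<lambda>(t1, t2) \<omega>. real (count_field P t1 t2 \<omega>))"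
    using s by (simp only:) (rule process_events_vimage, auto)
  have "prob (\<Inter>i\<in>{..<3::nat}. [A, B, C] ! i) = (\<Prod>i\<in>{..<3}. prob ([A, B, C] ! i))"
    using fpf A B C unfolding fractional_poisson_field_def
    by (intro indep_setsD) (auto simp: less_Suc_eq numeral_eq_Suc)
  then show ?thesis
    by (simp add: numeral_eq_Suc lessThan_Suc C_def[symmetric] Int_ac mult_ac)
qed

lemma fpf_indep_set: "prob_space.indep_set M (process_events M {0..} Y1) (process_events M {0..} Y2)"
proof -
  interpret prob_space M by (rule fpf_prob_space)
  let ?F = "\<lambda>i. [process_events M {0..} Y1, process_events M {0..} Y2,
             process_events M ({0..} \<times> {0..}) (\<lambda>(t1, t2) \<omega>. real (count_field P t1 t2 \<omega>))] ! i"
  have F: "indep_sets ?F {..<3}" using fpf unfolding fractional_poisson_field_def by (elim conjE)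
  show ?thesis
  proof (rule indep_setI)
    have sub: "\<forall>i\<in>{..<3}. ?F i \<subseteq> events" using F unfolding indep_sets_def by (rule conjunct1)
    show "process_events M {0..} Y1 \<subseteq> events" using bspec[OF sub, of 0] by simp
    show "process_events M {0..} Y2 \<subseteq> events" using bspec[OF sub, of 1] by simp
    fix A B assume AB: "A \<in> process_events M {0..} Y1" "B \<in> process_events M {0..} Y2"
    have "prob (\<Inter>i\<in>{..<2::nat}. [A, B] ! i) = (\<Prod>i\<in>{..<2}. prob ([A, B] ! i))"
      using F AB by (intro indep_setsD[OF F]) (auto simp: less_Suc_eq numeral_eq_Suc)
    then show "prob (A \<inter> B) = prob A * prob B"
      by (simp add: numeral_eq_Suc lessThan_Suc Int_ac mult_ac)
  qed
qed

lemma fpf_indep_var: "prob_space.indep_var M borel (Y1 t1) borel (Y2 t2)"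
proof -
  interpret prob_space M by (rule fpf_prob_space)
  note [measurable] = fpf_measurable
  have sub: "sigma_sets (space M) {Y s -` A \<inter> space M |A. A \<in> sets borel} \<subseteq> process_events M {0..} Y"
    if "0 \<le> s" for s and Y :: "real \<Rightarrow> 'a \<Rightarrow> real"
    unfolding process_events_def using that by (intro sigma_sets_mono') auto
  have "indep_set (process_events M {0..} Y1) (process_events M {0..} Y2)" by (rule fpf_indep_set)
  then have "indep_set (sigma_sets (space M) {Y1 t1 -` A \<inter> space M |A. A \<in> sets borel})
      (sigma_sets (space M) {Y2 t2 -` A \<inter> space M |A. A \<in> sets borel})"
    unfolding indep_set_def
    by (rule indep_sets_mono_sets) (use sub t in \<open>auto split: bool.split\<close>)
  then show ?thesis by (simp add: indep_var_eq fpf_measurable)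
qed

text \<open>Independence is assumed for the field at deterministic times, and joint measurability in
  times and outcome is not among the assumptions. Both the law and the measurability of the count at
  random times are therefore obtained as limits of counts at discretised times.\<close>

lemma fpf_prob_eq_expectation:
  "fpf_prob M P Y1 Y2 k t1 t2 = (\<integral>\<omega>. classical_prob lam k (Y1 t1 \<omega>) (Y2 t2 \<omega>) \<partial>M)"
proof -
  interpret prob_space M by (rule fpf_prob_space)
  note [measurable] = fpf_measurable
  have nonneg: "AE \<omega> in M. 0 \<le> Y1 t1 \<omega>" "AE \<omega> in M. 0 \<le> Y2 t2 \<omega>"
    using fpf_inverse1 fpf_inverse2 \<alpha> t inverse_stable_AE_nonneg by auto
  have fin: "finite (P \<omega> \<inter> B)" if "\<omega> \<in> space M" "bounded B" for \<omega> B
    using fpf_poisson that by (auto simp: poisson_point_process_def Let_def)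
  note [measurable] = poisson_count_field_measurable[OF fpf_poisson]
  \<comment> \<open>Rounds up to the next multiple of \<open>1 / (n + 1)\<close>. The rounded pair
    takes countably many values, indexed by the integers in \<open>X n\<close>, so counts at rounded
    times are measurable by a countable case split.\<close>
  define d where "d n y = (of_int \<lfloor>y * real (Suc n)\<rfloor> + 1) / real (Suc n)" for n :: nat and y :: real
  have d_ge: "y \<le> d n y" and d_le: "d n y \<le> y + 1 / real (Suc n)" for n y
  proof -
    have "y * real (Suc n) \<le> of_int \<lfloor>y * real (Suc n)\<rfloor> + 1" "of_int \<lfloor>y * real (Suc n)\<rfloor> + 1 \<le> y * real (Suc n) + 1"
      by linarith+
    then show "y \<le> d n y" "d n y \<le> y + 1 / real (Suc n)"
      by (simp_all add: d_def field_simps del: of_nat_Suc)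
  qed
  have d_lim: "(\<lambda>n. d n y) \<longlonglongrightarrow> y" for y
  proof (rule tendsto_sandwich[of "\<lambda>_. y" _ _ "\<lambda>n. y + 1 / real (Suc n)"])
    show "(\<lambda>n. y + 1 / real (Suc n)) \<longlonglongrightarrow> y" by real_asymp
  qed (use d_ge d_le in auto)
  define X where "X n \<omega> = (\<lfloor>Y1 t1 \<omega> * real (Suc n)\<rfloor>, \<lfloor>Y2 t2 \<omega> * real (Suc n)\<rfloor>)" for n :: nat and \<omega>
  have X_meas [measurable]: "X n \<in> measurable M (count_space UNIV)" for n
    unfolding X_def by measurable
  define N where "N n \<omega> = count_field P (d n (Y1 t1 \<omega>)) (d n (Y2 t2 \<omega>)) \<omega>" for n \<omega>
  define h where "h n i = (of_int i + 1) / real (Suc n)" for n :: nat and i :: int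
  have N_X: "N n \<omega> = count_field P (h n (fst (X n \<omega>))) (h n (snd (X n \<omega>))) \<omega>" for n \<omega>
    by (simp add: N_def X_def d_def h_def)
  have N_meas [measurable]: "N n \<in> measurable M (count_space UNIV)" for n
    unfolding N_X[abs_def]
    by (rule measurable_compose_countable[where f="\<lambda>i \<omega>. count_field P (h n (fst i)) (h n (snd i)) \<omega>"]) measurable
  define N0 where "N0 \<omega> = count_field P (Y1 t1 \<omega>) (Y2 t2 \<omega>) \<omega>" for \<omega>
  have N_ev: "\<forall>\<^sub>F n in sequentially. N n \<omega> = N0 \<omega>" if "\<omega> \<in> space M" for \<omega>
    unfolding N_def N0_def by (intro count_field_eventually_eq fin that d_lim d_ge)
  have "(\<lambda>\<omega>. real (N0 \<omega>)) \<in> borel_measurable M"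
  proof (rule borel_measurable_LIMSEQ_real)
    show "(\<lambda>n. real (N n \<omega>)) \<longlonglongrightarrow> real (N0 \<omega>)" if "\<omega> \<in> space M" for \<omega>
      using N_ev[OF that] by (intro tendsto_eventually) (auto elim!: eventually_mono)
  qed measurable
  then have "{\<omega> \<in> space M. real (N0 \<omega>) = real k} \<in> events" by measurable
  then have N0_meas [measurable]: "{\<omega> \<in> space M. N0 \<omega> = k} \<in> events" by simp
  let ?c = "\<lambda>x1 x2. classical_prob lam k x1 x2"
  \<comment> \<open>On a grid cell of the two inverse subordinators the field is evaluated at a fixed point, so independence
    applies cell by cell; the random sheet is right continuous, so the grid may be refined from above.\<close>
  have grid: "emeasure M {\<omega> \<in> space M. N n \<omega> = k} = (\<integral>\<^sup>+\<omega>. ennreal (?c (d n (Y1 t1 \<omega>)) (d n (Y2 t2 \<omega>))) \<partial>M)" for n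
  proof -
    let ?G = "{\<omega> \<in> space M. N n \<omega> = k}"
    let ?C = "\<lambda>p. ennreal (?c (h n (fst p)) (h n (snd p)))"
    \<comment> \<open>Both measures live on the countable set of cells: comparing single cells gives
      equality, and the total masses are the two sides of the claim.\<close>
    define \<nu> where "\<nu> = distr (density M (indicator ?G)) (count_space UNIV) (X n)"
    define \<nu>' where "\<nu>' = density (distr M (count_space UNIV) (X n)) ?C"
    have "\<nu> = \<nu>'"
    proof (rule measure_eqI_countable)
      show "sets \<nu> = Pow UNIV" "sets \<nu>' = Pow UNIV" by (simp_all add: \<nu>_def \<nu>'_def)
      fix p :: "int \<times> int"
      let ?Xp = "{\<omega> \<in> space M. X n \<omega> = p}"
      have Xp [measurable]: "?Xp \<in> events" by measurable
      have "emeasure \<nu> {p} = emeasure (density M (indicator ?G)) ?Xp"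
        unfolding \<nu>_def by (subst emeasure_distr) (auto intro!: arg_cong2[where f=emeasure])
      also have "\<dots> = emeasure M (?G \<inter> ?Xp)"
        by (simp add: emeasure_density indicator_inter_arith[symmetric])
      finally have \<nu>_p: "emeasure \<nu> {p} = emeasure M (?G \<inter> ?Xp)" .
      have "emeasure \<nu>' {p} = ?C p * emeasure (distr M (count_space UNIV) (X n)) {p}"
        unfolding \<nu>'_def by (simp add: emeasure_density)
      also have "emeasure (distr M (count_space UNIV) (X n)) {p} = emeasure M ?Xp"
        by (subst emeasure_distr) (auto intro!: arg_cong2[where f=emeasure])
      finally have \<nu>'_p: "emeasure \<nu>' {p} = ?C p * emeasure M ?Xp" .
      show "emeasure \<nu> {p} = emeasure \<nu>' {p}"
      proof (cases "0 \<le> fst p \<and> 0 \<le> snd p")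
        case True
        then have h: "0 \<le> h n (fst p)" "0 \<le> h n (snd p)" by (auto simp: h_def)
        have floor_set: "{y::real. \<lfloor>y * real (Suc n)\<rfloor> = i} \<in> sets borel" for i by measurable
        define A where "A = Y1 t1 -` {y. \<lfloor>y * real (Suc n)\<rfloor> = fst p} \<inter> space M"
        define B where "B = Y2 t2 -` {y. \<lfloor>y * real (Suc n)\<rfloor> = snd p} \<inter> space M"
        let ?K = "{\<omega> \<in> space M. count_field P (h n (fst p)) (h n (snd p)) \<omega> = j}"
        have A: "A \<in> process_events M {0..} Y1" and B: "B \<in> process_events M {0..} Y2"
          unfolding A_def B_def using t floor_set by (auto intro!: process_events_vimage simp del: vimage_Collect_eq of_nat_Suc)
        have Xp_eq: "?Xp = A \<inter> B" by (auto simp: A_def B_def X_def)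
        have "?G \<inter> ?Xp = A \<inter> B \<inter> {\<omega> \<in> space M. count_field P (h n (fst p)) (h n (snd p)) \<omega> = k}"
          unfolding Xp_eq[symmetric] by (auto simp: N_X)
        then have "measure M (?G \<inter> ?Xp) = measure M A * measure M B * ?c (h n (fst p)) (h n (snd p))"
          using fpf_indep_prob[OF A B h] poisson_count_field_prob[OF fpf_poisson h] by simp
        also have "measure M A * measure M B = measure M ?Xp"
        proof -
          have "measure M (A \<inter> B) = measure M A * measure M B"
            by (rule indep_setD[OF fpf_indep_set A B])
          then show ?thesis by (simp only: Xp_eq)
        qed
        finally show ?thesis
          using classical_prob_bounds[OF lam h]
          by (simp add: \<nu>_p \<nu>'_p emeasure_eq_measure mult.commute flip: ennreal_mult)
      next
        \<comment> \<open>Cells with a negative index are null because the inverse subordinators are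
          almost surely nonnegative.\<close>
        case False
        have "emeasure M ?Xp = 0"
        proof -
          have "AE \<omega> in M. \<not> X n \<omega> = p"
            using nonneg by eventually_elim (use False in \<open>auto simp: X_def\<close>)
          then show ?thesis by (subst (asm) AE_iff_measurable[OF Xp]) auto
        qed
        moreover from this have "emeasure M (?G \<inter> ?Xp) = 0"
          using emeasure_mono[of "?G \<inter> ?Xp" ?Xp M] by simp
        ultimately show ?thesis by (simp add: \<nu>_p \<nu>'_p)
      qed
    qed simp
    moreover have "emeasure \<nu> UNIV = emeasure M ?G"
      unfolding \<nu>_def by (subst emeasure_distr) (auto simp: emeasure_density indicator_inter_arith[symmetric])
    moreover have "emeasure \<nu>' UNIV = (\<integral>\<^sup>+\<omega>. ?C (X n \<omega>) \<partial>M)"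
      unfolding \<nu>'_def by (simp add: emeasure_density nn_integral_distr)
    ultimately show ?thesis by (simp add: X_def h_def d_def)
  qed
  have c_int: "integrable M (\<lambda>\<omega>. ?c (u (Y1 t1 \<omega>)) (u (Y2 t2 \<omega>)))"
    and c_nonneg: "AE \<omega> in M. 0 \<le> ?c (u (Y1 t1 \<omega>)) (u (Y2 t2 \<omega>))"
    and c_le: "AE \<omega> in M. norm (?c (u (Y1 t1 \<omega>)) (u (Y2 t2 \<omega>))) \<le> 1"
    and c_meas: "(\<lambda>\<omega>. ?c (u (Y1 t1 \<omega>)) (u (Y2 t2 \<omega>))) \<in> borel_measurable M"
    if u: "\<And>y. 0 \<le> y \<Longrightarrow> 0 \<le> u y" "u \<in> borel_measurable borel" for u
  proof -
    note [measurable] = u(2)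
    show "AE \<omega> in M. 0 \<le> ?c (u (Y1 t1 \<omega>)) (u (Y2 t2 \<omega>))"
      using nonneg by eventually_elim (use u in \<open>auto intro!: classical_prob_bounds lam\<close>)
    show le: "AE \<omega> in M. norm (?c (u (Y1 t1 \<omega>)) (u (Y2 t2 \<omega>))) \<le> 1"
      using nonneg by eventually_elim (use u lam in \<open>simp add: classical_prob_bounds\<close>)
    show meas: "(\<lambda>\<omega>. ?c (u (Y1 t1 \<omega>)) (u (Y2 t2 \<omega>))) \<in> borel_measurable M"
      unfolding classical_prob_def by measurable
    show "integrable M (\<lambda>\<omega>. ?c (u (Y1 t1 \<omega>)) (u (Y2 t2 \<omega>)))"
      by (rule integrable_const_bound[OF le meas])
  qed
  have d_u: "0 \<le> d n y" if "0 \<le> y" for n y using d_ge[of y n] that by linarith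
  have d_meas: "d n \<in> borel_measurable borel" for n unfolding d_def[abs_def] by measurable
  have prob_N: "prob {\<omega> \<in> space M. N n \<omega> = k} = (\<integral>\<omega>. ?c (d n (Y1 t1 \<omega>)) (d n (Y2 t2 \<omega>)) \<partial>M)" for n
    using grid[of n] c_nonneg[of "d n", OF d_u d_meas] c_meas[of "d n", OF d_u d_meas]
    by (simp add: integral_eq_nn_integral measure_def)
  have "(\<lambda>n. prob {\<omega> \<in> space M. N n \<omega> = k}) \<longlonglongrightarrow> prob {\<omega> \<in> space M. N0 \<omega> = k}"
  proof -
    have "(\<lambda>n. \<integral>\<omega>. indicator {\<omega> \<in> space M. N n \<omega> = k} \<omega> \<partial>M) \<longlonglongrightarrow> (\<integral>\<omega>. indicator {\<omega> \<in> space M. N0 \<omega> = k} \<omega> \<partial>M :: real)"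
    proof (rule integral_dominated_convergence[where w="\<lambda>_. 1"])
      show "AE \<omega> in M. (\<lambda>n. indicator {\<omega> \<in> space M. N n \<omega> = k} \<omega>) \<longlonglongrightarrow> (indicator {\<omega> \<in> space M. N0 \<omega> = k} \<omega> :: real)"
      proof (rule AE_I2)
        fix \<omega> assume "\<omega> \<in> space M"
        from N_ev[OF this] show "(\<lambda>n. indicator {\<omega> \<in> space M. N n \<omega> = k} \<omega>) \<longlonglongrightarrow> (indicator {\<omega> \<in> space M. N0 \<omega> = k} \<omega> :: real)"
          by (intro tendsto_eventually) (auto elim!: eventually_mono simp: indicator_def)
      qed
    qed (auto simp: indicator_def)
    then show ?thesis by simp
  qed
  moreover have "(\<lambda>n. prob {\<omega> \<in> space M. N n \<omega> = k}) \<longlonglongrightarrow> (\<integral>\<omega>. ?c (Y1 t1 \<omega>) (Y2 t2 \<omega>) \<partial>M)"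
    unfolding prob_N
  proof (rule integral_dominated_convergence[where w="\<lambda>_. 1"])
    show "AE \<omega> in M. (\<lambda>n. ?c (d n (Y1 t1 \<omega>)) (d n (Y2 t2 \<omega>))) \<longlonglongrightarrow> ?c (Y1 t1 \<omega>) (Y2 t2 \<omega>)"
      unfolding classical_prob_def by (intro AE_I2 tendsto_intros d_lim) auto
    show "AE \<omega> in M. norm (?c (d n (Y1 t1 \<omega>)) (d n (Y2 t2 \<omega>))) \<le> 1" for n
      by (rule c_le[OF d_u d_meas])
    show "(\<lambda>\<omega>. ?c (d n (Y1 t1 \<omega>)) (d n (Y2 t2 \<omega>))) \<in> borel_measurable M" for n
      by (rule c_meas[OF d_u d_meas])
    show "(\<lambda>\<omega>. ?c (Y1 t1 \<omega>) (Y2 t2 \<omega>)) \<in> borel_measurable M"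
      using c_meas[of "\<lambda>y. y"] by simp
  qed simp
  ultimately have "prob {\<omega> \<in> space M. N0 \<omega> = k} = (\<integral>\<omega>. ?c (Y1 t1 \<omega>) (Y2 t2 \<omega>) \<partial>M)"
    by (rule LIMSEQ_unique)
  then show ?thesis by (simp add: fpf_prob_def fractional_count_field_def N0_def)
qed

end

section \<open>Derivatives of Poisson mixtures\<close>

text \<open>Dominated convergence along sequences; convexity of \<open>U\<close> lets the mean value
  inequality bound the difference quotients by \<open>w\<close>.\<close>

lemma has_real_derivative_integral:
  fixes f f' :: "real \<Rightarrow> 'a \<Rightarrow> real"
  assumes U: "open U" "convex U" "z \<in> U"
    and f_int: "\<And>y. y \<in> U \<Longrightarrow> integrable M (f y)"
    and deriv: "\<And>y x. y \<in> U \<Longrightarrow> x \<in> space M \<Longrightarrow> ((\<lambda>y. f y x) has_real_derivative f' y x) (at y)"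
    and bound: "\<And>y x. y \<in> U \<Longrightarrow> x \<in> space M \<Longrightarrow> \<bar>f' y x\<bar> \<le> w x"
    and w: "integrable M w" and f'_meas: "f' z \<in> borel_measurable M"
  shows "((\<lambda>y. \<integral>x. f y x \<partial>M) has_real_derivative (\<integral>x. f' z x \<partial>M)) (at z)"
  unfolding has_field_derivative_iff
proof (subst tendsto_at_iff_sequentially, intro allI impI)
  fix s :: "nat \<Rightarrow> real" assume s: "\<forall>i. s i \<in> UNIV - {z}" "s \<longlonglongrightarrow> z"
  have "\<forall>\<^sub>F i in sequentially. s i \<in> U" using s(2) U by (auto dest: topological_tendstoD)
  then obtain n where n: "\<And>i. n \<le> i \<Longrightarrow> s i \<in> U" by (auto simp: eventually_sequentially)
  have "(\<lambda>i. \<integral>x. (f (s (i + n)) x - f z x) / (s (i + n) - z) \<partial>M) \<longlonglongrightarrow> (\<integral>x. f' z x \<partial>M)"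
  proof (rule integral_dominated_convergence[where w=w])
    show "f' z \<in> borel_measurable M" "integrable M w" by fact+
    show "(\<lambda>x. (f (s (i + n)) x - f z x) / (s (i + n) - z)) \<in> borel_measurable M" for i
      using f_int[of z] f_int[of "s (i + n)"] n[of "i + n"] U by auto
    have lim: "(\<lambda>i. s (i + n)) \<longlonglongrightarrow> z" using s(2) by (rule LIMSEQ_ignore_initial_segment)
    show "AE x in M. (\<lambda>i. (f (s (i + n)) x - f z x) / (s (i + n) - z)) \<longlonglongrightarrow> f' z x"
    proof (rule AE_I2)
      fix x assume "x \<in> space M"
      then have "((\<lambda>y. (f y x - f z x) / (y - z)) \<longlongrightarrow> f' z x) (at z)"
        using deriv[OF U(3)] by (simp add: has_field_derivative_iff)
      then show "(\<lambda>i. (f (s (i + n)) x - f z x) / (s (i + n) - z)) \<longlonglongrightarrow> f' z x"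
        using lim s(1) unfolding tendsto_at_iff_sequentially by (auto simp: comp_def)
    qed
    show "AE x in M. norm ((f (s (i + n)) x - f z x) / (s (i + n) - z)) \<le> w x" for i
    proof (rule AE_I2)
      fix x assume x: "x \<in> space M"
      have si: "s (i + n) \<in> U" "s (i + n) \<noteq> z" using n s(1) by auto
      have "norm (f (s (i + n)) x - f z x) \<le> w x * norm (s (i + n) - z)"
        using U si x bound
        by (intro field_differentiable_bound[of U "\<lambda>y. f y x" "\<lambda>y. f' y x"])
           (auto intro!: DERIV_subset[OF deriv])
      then show "norm ((f (s (i + n)) x - f z x) / (s (i + n) - z)) \<le> w x"
        using si by (simp add: divide_le_eq)
    qed
  qed
  moreover have "(\<integral>x. (f (s (i + n)) x - f z x) / (s (i + n) - z) \<partial>M)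
      = ((\<integral>x. f (s (i + n)) x \<partial>M) - (\<integral>x. f z x \<partial>M)) / (s (i + n) - z)" for i
    using f_int[of z] f_int[of "s (i + n)"] n[of "i + n"] U by simp
  ultimately have "(\<lambda>i. ((\<integral>x. f (s (i + n)) x \<partial>M) - (\<integral>x. f z x \<partial>M)) / (s (i + n) - z)) \<longlonglongrightarrow> (\<integral>x. f' z x \<partial>M)"
    by (simp only:)
  then have "(\<lambda>i. ((\<integral>x. f (s i) x \<partial>M) - (\<integral>x. f z x \<partial>M)) / (s i - z)) \<longlonglongrightarrow> (\<integral>x. f' z x \<partial>M)"
    by (rule LIMSEQ_offset)
  then show "((\<lambda>y. ((\<integral>x. f y x \<partial>M) - (\<integral>x. f z x \<partial>M)) / (y - z)) \<circ> s) \<longlonglongrightarrow> (\<integral>x. f' z x \<partial>M)"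
    by (simp add: comp_def)
qed

section \<open>Poisson weights and their derivatives\<close>

definition pois :: "nat \<Rightarrow> real \<Rightarrow> real" where
  "pois k z = exp (- z) * z ^ k / fact k"

text \<open>Differentiating a Poisson weight in \<open>z\<close> is a difference in the index, with
  the weight of index \<open>-1\<close> read as zero. Iterating the operator names the first two
  derivatives \<open>pois1\<close> and \<open>pois2\<close>.\<close>

definition pois_pred :: "(nat \<Rightarrow> real \<Rightarrow> real) \<Rightarrow> nat \<Rightarrow> real \<Rightarrow> real" where
  "pois_pred f k z = (if k = 0 then 0 else f (k - 1) z) - f k z"

abbreviation pois1 where "pois1 \<equiv> pois_pred pois"
abbreviation pois2 where "pois2 \<equiv> pois_pred pois1"

lemma pois_deriv: "(pois k has_real_derivative pois1 k z) (at z)"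
proof (cases k)
  case 0
  have "((\<lambda>z. exp (- z)) has_real_derivative - exp (- z)) (at z)" by (auto intro!: derivative_eq_intros)
  then show ?thesis using 0 by (simp add: pois_pred_def pois_def[abs_def])
next
  case (Suc n)
  have "((\<lambda>z. exp (- z) * z ^ Suc n / fact (Suc n)) has_real_derivative
      (exp (- z) * (real (Suc n) * z ^ n) - exp (- z) * z ^ Suc n) / fact (Suc n)) (at z)"
    by (rule derivative_eq_intros refl | simp)+
  also have "(exp (- z) * (real (Suc n) * z ^ n) - exp (- z) * z ^ Suc n) / fact (Suc n) = pois1 k z"
    using Suc by (simp add: pois_pred_def pois_def diff_divide_distrib)
  finally show ?thesis using Suc by (simp add: pois_def[abs_def])
qed

lemma pois1_deriv: "(pois1 k has_real_derivative pois2 k z) (at z)"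
proof -
  have "((\<lambda>z. (if k = 0 then 0 else pois (k - 1) z) - pois k z) has_real_derivative
    (if k = 0 then 0 else pois1 (k - 1) z) - pois1 k z) (at z)"
    by (intro DERIV_diff pois_deriv) (auto intro: pois_deriv)
  moreover have "pois1 k = (\<lambda>z. (if k = 0 then 0 else pois (k - 1) z) - pois k z)"
    by (rule ext) (rule pois_pred_def)
  moreover have "pois2 k z = (if k = 0 then 0 else pois1 (k - 1) z) - pois1 k z" by (rule pois_pred_def)
  ultimately show ?thesis by metis
qed

lemma continuous_on_pois: "continuous_on UNIV (pois k)" "continuous_on UNIV (pois1 k)" "continuous_on UNIV (pois2 k)"
proof -
  show "continuous_on UNIV (pois k)" for k
    by (rule continuous_at_imp_continuous_on) (use pois_deriv in \<open>blast intro: DERIV_isCont\<close>)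
  show c1: "continuous_on UNIV (pois1 k)" for k
    by (rule continuous_at_imp_continuous_on) (use pois1_deriv in \<open>blast intro: DERIV_isCont\<close>)
  have "pois2 k = (\<lambda>z. (if k = 0 then 0 else pois1 (k - 1) z) - pois1 k z)"
    by (rule ext) (rule pois_pred_def)
  moreover have "continuous_on UNIV (\<lambda>z. (if k = 0 then 0 else pois1 (k - 1) z) - pois1 k z)"
    using c1 by (cases "k = 0") (auto intro: continuous_on_diff continuous_on_minus)
  ultimately show "continuous_on UNIV (pois2 k)" by (simp only:)
qed

lemma pois_measurable [measurable]:
  "pois k \<in> borel_measurable borel" "pois1 k \<in> borel_measurable borel" "pois2 k \<in> borel_measurable borel"
  using continuous_on_pois by (auto intro: borel_measurable_continuous_onI)

lemma pois_bounds:
  assumes "0 \<le> z"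
  shows "0 \<le> pois k z" "pois k z \<le> 1"
  using power_div_fact_le_exp[OF assms, of k] assms by (auto simp: pois_def exp_minus field_simps)

lemma times_pois: "z * pois k z = real (Suc k) * pois (Suc k) z"
  by (simp add: pois_def del: of_nat_Suc)

lemma pois1_bound: "0 \<le> z \<Longrightarrow> \<bar>pois1 k z\<bar> \<le> 1"
  using pois_bounds[of z k] pois_bounds[of z "k - 1"] by (auto simp: pois_pred_def)

lemma times_pois_bound:
  assumes "0 \<le> z"
  shows "\<bar>z * pois k z\<bar> \<le> real k + 1"
proof -
  have "real (Suc k) * pois (Suc k) z \<le> real (Suc k) * 1"
    using assms by (intro mult_left_mono pois_bounds) auto
  moreover have "0 \<le> real (Suc k) * pois (Suc k) z"
    using assms by (intro mult_nonneg_nonneg pois_bounds) auto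
  ultimately have "\<bar>real (Suc k) * pois (Suc k) z\<bar> \<le> real (Suc k) * 1" by (simp only: abs_of_nonneg)
  then show ?thesis by (simp only: times_pois of_nat_Suc mult_1_right add.commute)
qed

text \<open>\<open>z * pois k z\<close> is a multiple of the next weight, so multiplication by
  \<open>z\<close> keeps the weights bounded. This replaces a second moment when mixtures are
  differentiated twice. Counted with multiplicity, \<open>pois2\<close> has at most four terms, each
  contributing at most \<open>k + 1\<close>.\<close>

lemma times_pois2_bound:
  assumes "0 \<le> z"
  shows "\<bar>z * pois2 k z\<bar> \<le> 4 * (real k + 1)"
proof -
  have 1: "\<bar>z * pois1 j z\<bar> \<le> 2 * (real j + 1)" for j
  proof (cases j)
    case 0
    then show ?thesis using times_pois_bound[OF assms, of 0] by (simp add: pois_pred_def)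
  next
    case (Suc i)
    then have "z * pois1 j z = z * pois i z - z * pois j z" by (simp add: pois_pred_def right_diff_distrib)
    then show ?thesis using times_pois_bound[OF assms, of i] times_pois_bound[OF assms, of j] Suc by simp
  qed
  show ?thesis
  proof (cases k)
    case 0
    then show ?thesis using 1[of 0] by (simp add: pois_pred_def)
  next
    case (Suc i)
    then have "z * pois2 k z = z * pois1 i z - z * pois1 k z"
      by (simp add: pois_pred_def[of pois1] right_diff_distrib)
    then show ?thesis using 1[of i] 1[of k] Suc by simp
  qed
qed

lemma classical_prob_eq_pois: "classical_prob lam k x1 x2 = pois k (lam * x1 * x2)"
  by (simp add: classical_prob_def pois_def)

text \<open>The mixed second derivative of \<open>pois k (x * y)\<close> in \<open>x\<close> and
  \<open>y\<close>, as a function of \<open>z = x * y\<close>.\<close>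

definition pois_mixed :: "nat \<Rightarrow> real \<Rightarrow> real" where
  "pois_mixed k z = pois1 k z + z * pois2 k z"

lemma pois_mixed_bound: "0 \<le> z \<Longrightarrow> \<bar>pois_mixed k z\<bar> \<le> 4 * real k + 5"
  using pois1_bound[of z k] times_pois2_bound[of z k] by (simp add: pois_mixed_def)

lemma continuous_on_pois_mixed: "continuous_on UNIV (pois_mixed k)"
  unfolding pois_mixed_def by (intro continuous_intros continuous_on_pois)

text \<open>Expanding \<open>pois_mixed\<close> in Poisson weights gives the coefficients of the
  general equation; the cases \<open>k = 0\<close> and \<open>k = 1\<close> are the same expansion
  with weights of negative index read as zero.\<close>

lemma recurrence_rhs_classical:
  "recurrence_rhs lam (classical_prob lam) k x1 x2 = lam * pois_mixed k (lam * x1 * x2)"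
proof -
  let ?z = "lam * x1 * x2"
  consider "k = 0" | "k = 1" | j where "k = Suc (Suc j)" by (metis One_nat_def not0_implies_Suc)
  then show ?thesis
  proof cases
    case 1
    then show ?thesis
      by (simp add: recurrence_rhs_def classical_prob_eq_pois pois_mixed_def pois_pred_def algebra_simps power2_eq_square)
  next
    case 2
    \<comment> \<open>For \<open>k = 1\<close> the general coefficients leave
      \<open>- 2 * z * pois 0 z\<close>, which equals \<open>- 2 * pois 1 z\<close>; hence the
      coefficient \<open>-3\<close> in place of \<open>-1\<close>.\<close>
    have "lam * x1 * x2 * pois 0 ?z = pois 1 ?z" by (simp add: pois_def)
    then show ?thesis using 2
      by (simp add: recurrence_rhs_def classical_prob_eq_pois pois_mixed_def pois_pred_def algebra_simps power2_eq_square)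
  next
    case 3
    then show ?thesis
      by (simp add: recurrence_rhs_def classical_prob_eq_pois pois_mixed_def pois_pred_def algebra_simps power2_eq_square)
  qed
qed

text \<open>A function of a product needs only one-variable calculus. Linear factors give the
  classical probabilities, powers of the times the fractional ones.\<close>

lemma mixed_deriv_comp_product:
  fixes \<Phi> \<Phi>1 \<Phi>2 g1 g2 g1' g2' :: "real \<Rightarrow> real"
  assumes U: "open U1" "open U2" "t1 \<in> U1" "t2 \<in> U2"
    and u: "\<And>r1 r2. r1 \<in> U1 \<Longrightarrow> r2 \<in> U2 \<Longrightarrow> u r1 r2 = \<Phi> (g1 r1 * g2 r2)"
    and g1: "\<And>r. r \<in> U1 \<Longrightarrow> (g1 has_real_derivative g1' r) (at r)"
    and g2: "\<And>r. r \<in> U2 \<Longrightarrow> (g2 has_real_derivative g2' r) (at r)"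
    and \<Phi>: "\<And>r1 r2. r1 \<in> U1 \<Longrightarrow> r2 \<in> U2 \<Longrightarrow> (\<Phi> has_real_derivative \<Phi>1 (g1 r1 * g2 r2)) (at (g1 r1 * g2 r2))"
    and \<Phi>1: "\<And>r1 r2. r1 \<in> U1 \<Longrightarrow> r2 \<in> U2 \<Longrightarrow> (\<Phi>1 has_real_derivative \<Phi>2 (g1 r1 * g2 r2)) (at (g1 r1 * g2 r2))"
  shows "mixed_differentiable u t1 t2"
    and "mixed_deriv u t1 t2 = g1' t1 * g2' t2 * (\<Phi>1 (g1 t1 * g2 t2) + g1 t1 * g2 t2 * \<Phi>2 (g1 t1 * g2 t2))"
proof -
  have d2: "(u r1 has_real_derivative \<Phi>1 (g1 r1 * g2 t2) * (g1 r1 * g2' t2)) (at t2)" if r1: "r1 \<in> U1" for r1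
  proof -
    have "((\<lambda>r2. \<Phi> (g1 r1 * g2 r2)) has_real_derivative \<Phi>1 (g1 r1 * g2 t2) * (g1 r1 * g2' t2)) (at t2)"
      using r1 U by (intro DERIV_chain2[of \<Phi>] \<Phi> DERIV_cmult g2) auto
    then show ?thesis
      by (rule has_field_derivative_transform_within_open[where S=U2]) (use U r1 u in auto)
  qed
  have "((\<lambda>r1. \<Phi>1 (g1 r1 * g2 t2) * (g1 r1 * g2' t2)) has_real_derivative
      (\<Phi>2 (g1 t1 * g2 t2) * (g1' t1 * g2 t2)) * (g1 t1 * g2' t2) + (g1' t1 * g2' t2) * \<Phi>1 (g1 t1 * g2 t2)) (at t1)"
    using U by (intro DERIV_mult DERIV_chain2[of \<Phi>1] \<Phi>1 DERIV_cmult_right g1) auto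
  then have d1: "((\<lambda>r1. deriv (u r1) t2) has_real_derivative
      (\<Phi>2 (g1 t1 * g2 t2) * (g1' t1 * g2 t2)) * (g1 t1 * g2' t2) + (g1' t1 * g2' t2) * \<Phi>1 (g1 t1 * g2 t2)) (at t1)"
    by (rule has_field_derivative_transform_within_open[where S=U1])
       (use U DERIV_imp_deriv[OF d2] in auto)
  show "mixed_deriv u t1 t2 = g1' t1 * g2' t2 * (\<Phi>1 (g1 t1 * g2 t2) + g1 t1 * g2 t2 * \<Phi>2 (g1 t1 * g2 t2))"
    unfolding mixed_deriv_def DERIV_imp_deriv[OF d1] by (simp add: algebra_simps)
  have "\<forall>\<^sub>F r1 in nhds t1. r1 \<in> U1" using U by (auto intro: eventually_nhds_in_open)
  then have "\<forall>\<^sub>F r1 in nhds t1. u r1 differentiable at t2"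
    by eventually_elim (use d2 in \<open>auto simp: real_differentiable_def\<close>)
  then show "mixed_differentiable u t1 t2"
    using d1 by (auto simp: mixed_differentiable_def real_differentiable_def)
qed

lemma classical_prob_mixed:
  shows "mixed_differentiable (classical_prob lam k) t1 t2"
    and "mixed_deriv (classical_prob lam k) t1 t2 = recurrence_rhs lam (classical_prob lam) k t1 t2"
proof -
  have d: "((\<lambda>r. lam * r) has_real_derivative lam) (at r)" "((\<lambda>r. r) has_real_derivative 1) (at r)" for r
    by (auto intro!: derivative_eq_intros)
  note * = mixed_deriv_comp_product[where u="classical_prob lam k" and ?U1.0=UNIV and ?U2.0=UNIV and \<Phi>="pois k"
      and ?\<Phi>1.0="pois1 k" and ?\<Phi>2.0="pois2 k" and ?g1.0="\<lambda>r. lam * r" and ?g2.0="\<lambda>r. r" and ?g1'.0="\<lambda>_. lam" and ?g2'.0="\<lambda>_. 1"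
      and ?t1.0=t1 and ?t2.0=t2, OF open_UNIV open_UNIV UNIV_I UNIV_I classical_prob_eq_pois d pois_deriv pois1_deriv]
  show "mixed_differentiable (classical_prob lam k) t1 t2" by (rule *(1))
  show "mixed_deriv (classical_prob lam k) t1 t2 = recurrence_rhs lam (classical_prob lam) k t1 t2"
    unfolding *(2) recurrence_rhs_classical by (simp add: pois_mixed_def)
qed

text \<open>The first moment of \<open>V\<close> dominates the first derivative directly; for the
  second, one factor \<open>V\<close> is absorbed by \<open>times_pois2_bound\<close> at the price
  of a factor \<open>1 / z\<close>.\<close>

lemma pois_mixture_derivs:
  fixes V :: "'a \<Rightarrow> real"
  assumes "prob_space M" and V: "integrable M V" "\<And>x. x \<in> space M \<Longrightarrow> 0 \<le> V x" and z: "0 < z"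
  shows "((\<lambda>z. \<integral>x. pois k (z * V x) \<partial>M) has_real_derivative (\<integral>x. V x * pois1 k (z * V x) \<partial>M)) (at z)"
    and "((\<lambda>z. \<integral>x. V x * pois1 k (z * V x) \<partial>M) has_real_derivative (\<integral>x. (V x)\<^sup>2 * pois2 k (z * V x) \<partial>M)) (at z)"
    and "(\<integral>x. V x * pois1 k (z * V x) \<partial>M) + z * (\<integral>x. (V x)\<^sup>2 * pois2 k (z * V x) \<partial>M)
      = (\<integral>x. V x * pois_mixed k (z * V x) \<partial>M)"
proof -
  interpret prob_space M by fact
  have [measurable]: "V \<in> borel_measurable M" using V by simp
  \<comment> \<open>On \<open>y > z / 2\<close> the factor \<open>1 / y\<close> stays below
    \<open>2 / z\<close>, so a fixed multiple of \<open>V\<close> dominates the second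
    derivative.\<close>
  define U where "U = {z / 2<..}"
  have U: "open U" "convex U" "z \<in> U" using z by (auto simp: U_def)
  have U_pos: "0 < y" if "y \<in> U" for y using that z by (simp add: U_def)
  have int0: "integrable M (\<lambda>x. pois k (y * V x))" if "y \<in> U" for y
  proof (rule integrable_const_bound[where B=1])
    show "AE x in M. norm (pois k (y * V x)) \<le> 1"
    proof (rule AE_I2)
      fix x assume "x \<in> space M"
      then have "0 \<le> y * V x" using U_pos[OF that] V by simp
      from pois_bounds[OF this, of k] show "norm (pois k (y * V x)) \<le> 1" by simp
    qed
  qed measurable
  have bound1: "\<bar>V x * pois1 k (y * V x)\<bar> \<le> V x" if "y \<in> U" "x \<in> space M" for x y
  proof -
    have V0: "0 \<le> V x" using V that by simp
    have "\<bar>V x\<bar> * \<bar>pois1 k (y * V x)\<bar> \<le> \<bar>V x\<bar> * 1"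
      using U_pos[OF that(1)] V0 by (intro mult_left_mono pois1_bound) auto
    then show ?thesis using V0 by (simp add: abs_mult)
  qed
  have int1: "integrable M (\<lambda>x. V x * pois1 k (y * V x))" if "y \<in> U" for y
    by (rule Bochner_Integration.integrable_bound[OF V(1)]) (use bound1[OF that] V(2) in \<open>auto intro!: AE_I2\<close>)
  have bound2: "\<bar>(V x)\<^sup>2 * pois2 k (y * V x)\<bar> \<le> 8 * (real k + 1) / z * V x" if "y \<in> U" "x \<in> space M" for x y
  proof -
    have V0: "0 \<le> V x" using V that by simp
    have y: "0 < y" "z / 2 < y" using U_pos that by (auto simp: U_def)
    have "\<bar>(V x)\<^sup>2 * pois2 k (y * V x)\<bar> = V x / y * \<bar>(y * V x) * pois2 k (y * V x)\<bar>"
      using y V0 by (simp add: abs_mult power2_eq_square)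
    also have "\<dots> \<le> V x / y * (4 * (real k + 1))"
      using y V0 by (intro mult_left_mono times_pois2_bound) auto
    also have "\<dots> \<le> V x / (z / 2) * (4 * (real k + 1))"
      using y V0 z by (intro mult_right_mono divide_left_mono) auto
    finally show ?thesis by (simp add: field_simps)
  qed
  have int2: "integrable M (\<lambda>x. (V x)\<^sup>2 * pois2 k (z * V x))"
    by (rule Bochner_Integration.integrable_bound[OF integrable_mult_right[OF V(1), of "8 * (real k + 1) / z"]])
       (use bound2[OF U(3)] V(2) z in \<open>auto intro!: AE_I2\<close>)
  show "((\<lambda>z. \<integral>x. pois k (z * V x) \<partial>M) has_real_derivative (\<integral>x. V x * pois1 k (z * V x) \<partial>M)) (at z)"
  proof (rule has_real_derivative_integral[OF U int0 _ bound1 V(1)])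
    fix y x
    have "((\<lambda>y. pois k (y * V x)) has_real_derivative pois1 k (y * V x) * (1 * V x)) (at y)"
      by (intro DERIV_chain2[OF pois_deriv] DERIV_cmult_right DERIV_ident)
    then show "((\<lambda>y. pois k (y * V x)) has_real_derivative V x * pois1 k (y * V x)) (at y)"
      by (simp add: mult.commute)
  qed measurable
  show "((\<lambda>z. \<integral>x. V x * pois1 k (z * V x) \<partial>M) has_real_derivative (\<integral>x. (V x)\<^sup>2 * pois2 k (z * V x) \<partial>M)) (at z)"
  proof (rule has_real_derivative_integral[OF U int1 _ bound2])
    fix y x
    have "((\<lambda>y. V x * pois1 k (y * V x)) has_real_derivative V x * (pois2 k (y * V x) * (1 * V x))) (at y)"
      by (intro DERIV_cmult DERIV_chain2[OF pois1_deriv] DERIV_cmult_right DERIV_ident)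
    then show "((\<lambda>y. V x * pois1 k (y * V x)) has_real_derivative (V x)\<^sup>2 * pois2 k (y * V x)) (at y)"
      by (simp add: power2_eq_square mult_ac)
    show "integrable M (\<lambda>x. 8 * (real k + 1) / z * V x)" using V(1) by (rule integrable_mult_right)
  qed measurable
  show "(\<integral>x. V x * pois1 k (z * V x) \<partial>M) + z * (\<integral>x. (V x)\<^sup>2 * pois2 k (z * V x) \<partial>M)
      = (\<integral>x. V x * pois_mixed k (z * V x) \<partial>M)"
    using int1[OF U(3)] int2
    by (subst integral_mult_right_zero[symmetric], subst Bochner_Integration.integral_add[symmetric])
       (auto simp: pois_mixed_def power2_eq_square algebra_simps)
qed

section \<open>The mixed Caputo derivative\<close>

locale stable_law_pair = D1: stable_law D1 \<alpha>1 + D2: stable_law D2 \<alpha>2 for D1 D2 \<alpha>1 \<alpha>2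
begin

abbreviation Q :: "(real \<times> real) measure" where "Q \<equiv> D1 \<Otimes>\<^sub>M D2"

sublocale pair_prob_space D1 D2 ..

text \<open>If \<open>x\<close> is distributed according to the product of the stable laws, then \<open>scaled t1 t2 x\<close> is distributed like
  the pair of inverse subordinators at times \<open>t1\<close> and \<open>t2\<close>.\<close>

definition scaled :: "real \<Rightarrow> real \<Rightarrow> real \<times> real \<Rightarrow> real \<times> real" where
  "scaled t1 t2 x = ((t1 / fst x) powr \<alpha>1, (t2 / snd x) powr \<alpha>2)"

text \<open>What remains of the product of the two coordinates of \<open>scaled\<close> once
  \<open>t1 powr \<alpha>1 * t2 powr \<alpha>2\<close> is taken out; it also collects the factors
  \<open>x powr - \<alpha>\<close> of the two Caputo identities.\<close>

definition weight :: "real \<times> real \<Rightarrow> real" where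
  "weight x = fst x powr - \<alpha>1 * snd x powr - \<alpha>2"

lemma scaled_measurable [measurable]:
  assumes [measurable]: "f \<in> borel_measurable N" "g \<in> borel_measurable N" "h \<in> measurable N (borel \<Otimes>\<^sub>M borel)"
  shows "(\<lambda>x. scaled (f x) (g x) (h x)) \<in> measurable N (borel \<Otimes>\<^sub>M borel)"
  unfolding scaled_def by measurable

lemma weight_measurable [measurable]: "weight \<in> borel_measurable (borel \<Otimes>\<^sub>M borel)"
  unfolding weight_def[abs_def] by measurable

lemma weight_nonneg: "0 \<le> weight x"
  by (simp add: weight_def)

lemma integrable_weight: "integrable Q weight"
proof (rule integrableI_nonneg)
  show "weight \<in> borel_measurable Q" by measurable
  have "(\<integral>\<^sup>+x. ennreal (weight x) \<partial>Q) = (\<integral>\<^sup>+x1. \<integral>\<^sup>+x2. ennreal (x1 powr - \<alpha>1) * ennreal (x2 powr - \<alpha>2) \<partial>D2 \<partial>D1)"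
    by (subst D2.nn_integral_fst[symmetric]) (auto simp: weight_def ennreal_mult)
  also have "\<dots> = (\<integral>\<^sup>+x1. ennreal (x1 powr - \<alpha>1) \<partial>D1) * (\<integral>\<^sup>+x2. ennreal (x2 powr - \<alpha>2) \<partial>D2)"
    by (simp add: nn_integral_cmult nn_integral_multc)
  also have "\<dots> < \<infinity>"
    using D1.stable_moment_finite D2.stable_moment_finite by (simp add: ennreal_mult_less_top)
  finally show "(\<integral>\<^sup>+x. ennreal (weight x) \<partial>Q) < \<infinity>" .
qed (simp add: weight_nonneg)

lemma AE_Q_pos: "AE x in Q. 0 < fst x \<and> 0 < snd x"
proof -
  have "AE x in D1. AE y in D2. 0 < fst (x, y) \<and> 0 < snd (x, y)"
    using D1.AE_pos
  proof eventually_elim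
    case (elim x)
    show ?case using D2.AE_pos by eventually_elim (simp add: elim)
  qed
  then show ?thesis by (intro AE_pair_measure) (measurable)
qed

text \<open>In each coordinate, \<open>\<alpha> * r powr (\<alpha> - 1)\<close> from the chain rule
  times the Caputo kernel \<open>(t - r) powr - \<alpha> / Gamma (1 - \<alpha>)\<close>, the
  constants being merged in \<open>stable_const\<close>.\<close>

definition kernel :: "real \<Rightarrow> real \<Rightarrow> real \<times> real \<Rightarrow> real" where
  "kernel t1 t2 r = (D1.stable_const * fst r powr (\<alpha>1 - 1) * (t1 - fst r) powr - \<alpha>1)
     * (D2.stable_const * snd r powr (\<alpha>2 - 1) * (t2 - snd r) powr - \<alpha>2)"

lemma kernel_measurable [measurable]: "kernel t1 t2 \<in> borel_measurable (borel \<Otimes>\<^sub>M borel)"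
  unfolding kernel_def[abs_def] by measurable

lemma kernel_nonneg: "0 \<le> kernel t1 t2 r"
  using D1.stable_const_pos D2.stable_const_pos by (simp add: kernel_def)

text \<open>Tonelli reduces this to the identity in one variable, used first in the second
  coordinate with the first one frozen, then in the first coordinate for the function averaged over
  \<open>D2\<close>.\<close>

lemma nn_integral_caputo_pair:
  assumes [measurable]: "v \<in> borel_measurable (borel \<Otimes>\<^sub>M borel)" and t: "0 < t1" "0 < t2"
  shows "(\<integral>\<^sup>+r. ennreal (kernel t1 t2 r) *
      (\<integral>\<^sup>+x. ennreal (weight x) * v (scaled (fst r) (snd r) x) \<partial>Q)
      * indicator ({0<..<t1} \<times> {0<..<t2}) r \<partial>lborel)
    = (\<integral>\<^sup>+x. v (scaled t1 t2 x) \<partial>Q)"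
proof -
  let ?v2 = "\<lambda>r1 x1. \<integral>\<^sup>+x2. v ((r1 / x1) powr \<alpha>1, (t2 / x2) powr \<alpha>2) \<partial>D2"
  let ?ind = "indicator ({0<..<t1} \<times> {0<..<t2}) :: real \<times> real \<Rightarrow> ennreal"
  let ?w = "\<lambda>r1 r2. \<integral>\<^sup>+x. ennreal (weight x) * v (scaled r1 r2 x) \<partial>Q"
  define k1 where "k1 r = ennreal (D1.stable_const * r powr (\<alpha>1 - 1) * (t1 - r) powr - \<alpha>1)" for r
  define k2 where "k2 r = ennreal (D2.stable_const * r powr (\<alpha>2 - 1) * (t2 - r) powr - \<alpha>2)" for r
  have [measurable]: "k1 \<in> borel_measurable borel" "k2 \<in> borel_measurable borel"
    unfolding k1_def k2_def by measurable
  interpret LD1: pair_sigma_finite D1 lborel ..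
  have inner: "?w r1 r2
      = (\<integral>\<^sup>+x1. ennreal (x1 powr - \<alpha>1) * (\<integral>\<^sup>+x2. ennreal (x2 powr - \<alpha>2) * v ((r1 / x1) powr \<alpha>1, (r2 / x2) powr \<alpha>2) \<partial>D2) \<partial>D1)"
    for r1 r2
    by (subst D2.nn_integral_fst[symmetric], measurable)
       (simp add: weight_def scaled_def ennreal_mult mult.assoc nn_integral_cmult)
  have "(\<integral>\<^sup>+r. ennreal (kernel t1 t2 r) * (\<integral>\<^sup>+x. ennreal (weight x) * v (scaled (fst r) (snd r) x) \<partial>Q)
      * indicator ({0<..<t1} \<times> {0<..<t2}) r \<partial>lborel)
    = (\<integral>\<^sup>+r1. \<integral>\<^sup>+r2. ennreal (kernel t1 t2 (r1, r2)) * ?w r1 r2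
      * ?ind (r1, r2) \<partial>lborel \<partial>lborel)"
    unfolding lborel_prod[symmetric] indicator_times
    by (subst lborel.nn_integral_fst[symmetric]) auto
  also have "\<dots> = (\<integral>\<^sup>+r1. k1 r1 * (\<integral>\<^sup>+x1. ennreal (x1 powr - \<alpha>1) *
      ?v2 r1 x1 \<partial>D1) * indicator {0<..<t1} r1 \<partial>lborel)"
  proof (rule nn_integral_cong)
    fix r1 :: real
    define g where "g x1 r2 = (\<integral>\<^sup>+x2. ennreal (x2 powr - \<alpha>2) * v ((r1 / x1) powr \<alpha>1, (r2 / x2) powr \<alpha>2) \<partial>D2)" for x1 r2
    have g_meas [measurable]: "(\<lambda>p. g (a p) (b p)) \<in> borel_measurable N"
      if [measurable]: "a \<in> borel_measurable N" "b \<in> borel_measurable N" for a b and N :: "'z measure"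
      unfolding g_def by measurable
    have "(\<integral>\<^sup>+r2. ennreal (kernel t1 t2 (r1, r2)) * ?w r1 r2
        * ?ind (r1, r2) \<partial>lborel)
      = (\<integral>\<^sup>+r2. (k1 r1 * indicator {0<..<t1} r1) * ((k2 r2 * indicator {0<..<t2} r2) *
          (\<integral>\<^sup>+x1. ennreal (x1 powr - \<alpha>1) * g x1 r2 \<partial>D1)) \<partial>lborel)"
      unfolding inner g_def[symmetric] using D1.stable_const_pos D2.stable_const_pos
      by (intro nn_integral_cong) (simp add: kernel_def k1_def k2_def indicator_times ennreal_mult mult_ac)
    also have "\<dots> = (k1 r1 * indicator {0<..<t1} r1) * (\<integral>\<^sup>+r2. (k2 r2 * indicator {0<..<t2} r2) *
          (\<integral>\<^sup>+x1. ennreal (x1 powr - \<alpha>1) * g x1 r2 \<partial>D1) \<partial>lborel)"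
      by (rule nn_integral_cmult) measurable
    also have "(\<integral>\<^sup>+r2. (k2 r2 * indicator {0<..<t2} r2) * (\<integral>\<^sup>+x1. ennreal (x1 powr - \<alpha>1) * g x1 r2 \<partial>D1) \<partial>lborel)
      = (\<integral>\<^sup>+r2. \<integral>\<^sup>+x1. ennreal (x1 powr - \<alpha>1) * (k2 r2 * g x1 r2 * indicator {0<..<t2} r2) \<partial>D1 \<partial>lborel)"
      by (intro nn_integral_cong, subst nn_integral_cmult[symmetric]) (auto simp: mult_ac)
    also have "\<dots> = (\<integral>\<^sup>+x1. \<integral>\<^sup>+r2. ennreal (x1 powr - \<alpha>1) * (k2 r2 * g x1 r2 * indicator {0<..<t2} r2) \<partial>lborel \<partial>D1)"
    proof -
      have [measurable]: "Measurable.pred (D1 \<Otimes>\<^sub>M lborel) (\<lambda>p. snd p \<in> {0<..<t2})" by measurable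
      show ?thesis by (rule LD1.Fubini') measurable
    qed
    also have "\<dots> = (\<integral>\<^sup>+x1. ennreal (x1 powr - \<alpha>1) * ?v2 r1 x1 \<partial>D1)"
    proof (rule nn_integral_cong)
      fix x1 :: real
      have "(\<integral>\<^sup>+r2. k2 r2 * g x1 r2 * indicator {0<..<t2} r2 \<partial>lborel) = ?v2 r1 x1"
        unfolding k2_def g_def
        by (rule D2.nn_integral_stable_caputo[of "\<lambda>y. v ((r1 / x1) powr \<alpha>1, y)"]) (use t in measurable)
      then show "(\<integral>\<^sup>+r2. ennreal (x1 powr - \<alpha>1) * (k2 r2 * g x1 r2 * indicator {0<..<t2} r2) \<partial>lborel)
        = ennreal (x1 powr - \<alpha>1) * ?v2 r1 x1"
        by (subst nn_integral_cmult) auto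
    qed
    finally show "(\<integral>\<^sup>+r2. ennreal (kernel t1 t2 (r1, r2)) * ?w r1 r2
        * ?ind (r1, r2) \<partial>lborel)
      = k1 r1 * (\<integral>\<^sup>+x1. ennreal (x1 powr - \<alpha>1) *
      ?v2 r1 x1 \<partial>D1) * indicator {0<..<t1} r1"
      by (simp add: mult_ac)
  qed
  also have "\<dots> = (\<integral>\<^sup>+x1. \<integral>\<^sup>+x2. v ((t1 / x1) powr \<alpha>1, (t2 / x2) powr \<alpha>2) \<partial>D2 \<partial>D1)"
    unfolding k1_def
    by (rule D1.nn_integral_stable_caputo[of "\<lambda>y. \<integral>\<^sup>+x2. v (y, (t2 / x2) powr \<alpha>2) \<partial>D2"]) (use t in measurable)
  also have "\<dots> = (\<integral>\<^sup>+x. v (scaled t1 t2 x) \<partial>Q)"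
    by (subst D2.nn_integral_fst[symmetric]) (auto simp: scaled_def)
  finally show ?thesis .
qed

lemma integrable_bounded_scaled:
  fixes h :: "real \<times> real \<Rightarrow> real"
  assumes [measurable]: "h \<in> borel_measurable (borel \<Otimes>\<^sub>M borel)"
    and h: "\<And>y1 y2. 0 \<le> y1 \<Longrightarrow> 0 \<le> y2 \<Longrightarrow> \<bar>h (y1, y2)\<bar> \<le> C"
  shows "integrable Q (\<lambda>x. h (scaled r1 r2 x))" "integrable Q (\<lambda>x. weight x * h (scaled r1 r2 x))"
proof -
  have b: "\<bar>h (scaled r1 r2 x)\<bar> \<le> C" for r1 r2 x by (simp add: scaled_def h)
  show "integrable Q (\<lambda>x. h (scaled r1 r2 x))"
    by (rule P.integrable_const_bound[where B=C]) (use b in auto)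
  have "\<bar>weight x * h (scaled r1 r2 x)\<bar> \<le> weight x * C" for x
    by (simp add: abs_mult abs_of_nonneg weight_nonneg mult_left_mono b)
  moreover have "weight x * C \<le> \<bar>weight x * C\<bar>" for x by simp
  ultimately have "\<bar>weight x * h (scaled r1 r2 x)\<bar> \<le> \<bar>weight x * C\<bar>" for x using order_trans by blast
  then show "integrable Q (\<lambda>x. weight x * h (scaled r1 r2 x))"
    by (intro Bochner_Integration.integrable_bound[OF integrable_mult_left[OF integrable_weight, of C]]) auto
qed

lemma has_bochner_integral_caputo_pair:
  fixes h :: "real \<times> real \<Rightarrow> real"
  assumes h_meas [measurable]: "h \<in> borel_measurable (borel \<Otimes>\<^sub>M borel)" and t: "0 < t1" "0 < t2"
    and h: "\<And>y1 y2. 0 \<le> y1 \<Longrightarrow> 0 \<le> y2 \<Longrightarrow> \<bar>h (y1, y2)\<bar> \<le> C"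
  shows "has_bochner_integral lborel (\<lambda>r. indicator ({0<..<t1} \<times> {0<..<t2}) r *\<^sub>R
      (kernel t1 t2 r * (\<integral>x. weight x * h (scaled (fst r) (snd r) x) \<partial>Q))) (\<integral>x. h (scaled t1 t2 x) \<partial>Q)"
proof -
  let ?F = "\<lambda>h r. indicator ({0<..<t1} \<times> {0<..<t2}) r *\<^sub>R (kernel t1 t2 r * (\<integral>x. weight x * h (scaled (fst r) (snd r) x) \<partial>Q))"
  have pos: "has_bochner_integral lborel (?F h) (\<integral>x. h (scaled t1 t2 x) \<partial>Q)"
    if h_meas [measurable]: "h \<in> borel_measurable (borel \<Otimes>\<^sub>M borel)"
      and h: "\<And>y1 y2. 0 \<le> y1 \<Longrightarrow> 0 \<le> y2 \<Longrightarrow> \<bar>h (y1, y2)\<bar> \<le> C"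
      and h0: "\<And>y1 y2. 0 \<le> y1 \<Longrightarrow> 0 \<le> y2 \<Longrightarrow> 0 \<le> h (y1, y2)" for h C
  proof (rule has_bochner_integral_nn_integral)
    have nn: "0 \<le> h (scaled r1 r2 x)" for r1 r2 x by (simp add: scaled_def h0)
    note int = integrable_bounded_scaled[OF h_meas h]
    have [measurable]: "?F h \<in> borel_measurable (borel \<Otimes>\<^sub>M borel)"
      unfolding indicator_times by measurable
    then show "?F h \<in> borel_measurable lborel" by (simp add: borel_prod)
    show "AE r in lborel. 0 \<le> ?F h r"
      by (intro AE_I2) (auto intro!: mult_nonneg_nonneg integral_nonneg_AE AE_I2 simp: kernel_nonneg weight_nonneg nn)
    show "0 \<le> (\<integral>x. h (scaled t1 t2 x) \<partial>Q)" by (simp add: nn)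
    have "(\<integral>\<^sup>+r. ennreal (?F h r) \<partial>lborel) = (\<integral>\<^sup>+r. ennreal (kernel t1 t2 r) *
      (\<integral>\<^sup>+x. ennreal (weight x) * ennreal (h (scaled (fst r) (snd r) x)) \<partial>Q)
      * indicator ({0<..<t1} \<times> {0<..<t2}) r \<partial>lborel)"
    proof (rule nn_integral_cong)
      fix r :: "real \<times> real"
      have "(\<integral>\<^sup>+x. ennreal (weight x) * ennreal (h (scaled (fst r) (snd r) x)) \<partial>Q)
        = (\<integral>\<^sup>+x. ennreal (weight x * h (scaled (fst r) (snd r) x)) \<partial>Q)"
        by (intro nn_integral_cong) (simp add: ennreal_mult weight_nonneg nn)
      also have "\<dots> = ennreal (\<integral>x. weight x * h (scaled (fst r) (snd r) x) \<partial>Q)"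
        by (rule nn_integral_eq_integral) (auto simp: int weight_nonneg nn)
      finally show "ennreal (?F h r) = ennreal (kernel t1 t2 r) *
        (\<integral>\<^sup>+x. ennreal (weight x) * ennreal (h (scaled (fst r) (snd r) x)) \<partial>Q)
        * indicator ({0<..<t1} \<times> {0<..<t2}) r"
        by (simp add: indicator_def ennreal_mult' kernel_nonneg)
    qed
    also have "\<dots> = (\<integral>\<^sup>+x. ennreal (h (scaled t1 t2 x)) \<partial>Q)"
      by (rule nn_integral_caputo_pair) (use t in measurable)
    also have "\<dots> = ennreal (\<integral>x. h (scaled t1 t2 x) \<partial>Q)"
      by (rule nn_integral_eq_integral) (auto simp: int nn)
    finally show "(\<integral>\<^sup>+r. ennreal (?F h r) \<partial>lborel) = ennreal (\<integral>x. h (scaled t1 t2 x) \<partial>Q)" .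
  qed
  have C0: "0 \<le> C" using h[of 0 0] by simp
  note int = integrable_bounded_scaled[OF h_meas h]
  have shifted: "\<bar>h (y1, y2) + C\<bar> \<le> 2 * C" "0 \<le> h (y1, y2) + C" if "0 \<le> y1" "0 \<le> y2" for y1 y2
    using h[OF that] by linarith+
  \<comment> \<open>A signed \<open>h\<close> is the difference of \<open>h + C\<close> and
    \<open>C\<close>, both nonnegative on the quadrant, where \<open>scaled\<close> takes its
    values.\<close>
  have "has_bochner_integral lborel (\<lambda>r. ?F (\<lambda>y. h y + C) r - ?F (\<lambda>_. C) r)
      ((\<integral>x. h (scaled t1 t2 x) + C \<partial>Q) - (\<integral>x. C \<partial>Q))"
    by (intro has_bochner_integral_diff pos[of "\<lambda>y. h y + C" "2 * C"] pos[of "\<lambda>_. C" C])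
       (use shifted C0 in auto)
  also have "(\<lambda>r. ?F (\<lambda>y. h y + C) r - ?F (\<lambda>_. C) r) = ?F h"
  proof
    fix r
    have "(\<integral>x. weight x * (h (scaled (fst r) (snd r) x) + C) \<partial>Q)
      = (\<integral>x. weight x * h (scaled (fst r) (snd r) x) \<partial>Q) + (\<integral>x. weight x * C \<partial>Q)"
      using int(2) integrable_weight by (simp add: distrib_left)
    then show "?F (\<lambda>y. h y + C) r - ?F (\<lambda>_. C) r = ?F h r"
      by (simp add: indicator_def distrib_left)
  qed
  also have "(\<integral>x. h (scaled t1 t2 x) + C \<partial>Q) - (\<integral>x. C \<partial>Q) = (\<integral>x. h (scaled t1 t2 x) \<partial>Q)"
    using int(1) by simp
  finally show ?thesis .
qed

lemma scaled_eq:
  assumes "0 < r1" "0 < r2" "0 < fst x" "0 < snd x"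
  shows "fst (scaled r1 r2 x) * snd (scaled r1 r2 x) = r1 powr \<alpha>1 * r2 powr \<alpha>2 * weight x"
  using assms by (simp add: scaled_def weight_def powr_divide powr_minus_divide)

text \<open>By self-similarity \<open>u\<close> is a function \<open>\<Phi>\<close> of
  \<open>r1 powr \<alpha>1 * r2 powr \<alpha>2\<close> alone, the Poisson mixture over
  \<open>V = lam * weight\<close>. Its mixed derivative is the chain-rule factor times the
  expectation of \<open>weight\<close> times \<open>h\<close> at the scaled point, which is what the
  two-variable identity integrates.\<close>

lemma caputo_pois_mixture:
  fixes lam :: real
  assumes lam: "0 < lam" and t: "0 < t1" "0 < t2"
    and u: "\<And>r1 r2. 0 < r1 \<Longrightarrow> 0 < r2 \<Longrightarrow>
      u r1 r2 = (\<integral>x. pois k (lam * (fst (scaled r1 r2 x) * snd (scaled r1 r2 x))) \<partial>Q)"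
  defines "h \<equiv> \<lambda>y. lam * pois_mixed k (lam * (fst y * snd y))"
  shows "caputo_mixed_exists \<alpha>1 \<alpha>2 u t1 t2"
    and "caputo_mixed \<alpha>1 \<alpha>2 u t1 t2 = (\<integral>x. h (scaled t1 t2 x) \<partial>Q)"
proof -
  define V where "V x = lam * weight x" for x
  have V: "integrable Q V" "\<And>x. x \<in> space Q \<Longrightarrow> 0 \<le> V x"
    using integrable_weight lam weight_nonneg by (auto simp: V_def[abs_def])
  define \<Phi> where "\<Phi> z = (\<integral>x. pois k (z * V x) \<partial>Q)" for z
  define \<Phi>1 where "\<Phi>1 z = (\<integral>x. V x * pois1 k (z * V x) \<partial>Q)" for z
  define \<Phi>2 where "\<Phi>2 z = (\<integral>x. (V x)\<^sup>2 * pois2 k (z * V x) \<partial>Q)" for z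
  have [measurable]: "pois_mixed k \<in> borel_measurable borel"
    by (rule borel_measurable_continuous_onI[OF continuous_on_pois_mixed])
  have [measurable]: "V \<in> borel_measurable (borel \<Otimes>\<^sub>M borel)" unfolding V_def[abs_def] by measurable
  have u_eq: "u r1 r2 = \<Phi> (r1 powr \<alpha>1 * r2 powr \<alpha>2)" if r: "0 < r1" "0 < r2" for r1 r2
    unfolding u[OF r] \<Phi>_def
  proof (rule integral_cong_AE)
    show "AE x in Q. pois k (lam * (fst (scaled r1 r2 x) * snd (scaled r1 r2 x))) = pois k (r1 powr \<alpha>1 * r2 powr \<alpha>2 * V x)"
      using AE_Q_pos by eventually_elim (simp add: scaled_eq r V_def mult_ac)
  qed measurable
  have powr_deriv: "((\<lambda>r. r powr a) has_real_derivative a * r powr (a - 1)) (at r)" if "0 < r" for r a :: real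
    using that by (auto intro!: derivative_eq_intros)
  have mixed: "mixed_differentiable u r1 r2"
    "mixed_deriv u r1 r2 = \<alpha>1 * r1 powr (\<alpha>1 - 1) * (\<alpha>2 * r2 powr (\<alpha>2 - 1)) * (\<integral>x. weight x * h (scaled r1 r2 x) \<partial>Q)"
    if r: "0 < r1" "0 < r2" for r1 r2
  proof -
    have z: "0 < r1 powr \<alpha>1 * r2 powr \<alpha>2" if "r1 \<in> {0<..}" "r2 \<in> {0<..}" for r1 r2 using that by simp
    note derivs = pois_mixture_derivs[OF P.prob_space_axioms V, of _ k, folded \<Phi>_def \<Phi>1_def \<Phi>2_def]
    note * = mixed_deriv_comp_product[where ?U1.0="{0<..}" and ?U2.0="{0<..}" and ?t1.0=r1 and ?t2.0=r2
        and ?g1.0="\<lambda>r. r powr \<alpha>1" and ?g2.0="\<lambda>r. r powr \<alpha>2"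
        and ?g1'.0="\<lambda>r. \<alpha>1 * r powr (\<alpha>1 - 1)" and ?g2'.0="\<lambda>r. \<alpha>2 * r powr (\<alpha>2 - 1)"
        and u=u and \<Phi>=\<Phi> and ?\<Phi>1.0=\<Phi>1 and ?\<Phi>2.0=\<Phi>2]
    show "mixed_differentiable u r1 r2"
      by (rule *(1)) (use r u_eq powr_deriv derivs z in auto)
    have "mixed_deriv u r1 r2 = \<alpha>1 * r1 powr (\<alpha>1 - 1) * (\<alpha>2 * r2 powr (\<alpha>2 - 1)) *
        (\<Phi>1 (r1 powr \<alpha>1 * r2 powr \<alpha>2) + r1 powr \<alpha>1 * r2 powr \<alpha>2 * \<Phi>2 (r1 powr \<alpha>1 * r2 powr \<alpha>2))"
      by (rule *(2)) (use r u_eq powr_deriv derivs z in auto)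
    also have "\<Phi>1 (r1 powr \<alpha>1 * r2 powr \<alpha>2) + r1 powr \<alpha>1 * r2 powr \<alpha>2 * \<Phi>2 (r1 powr \<alpha>1 * r2 powr \<alpha>2)
        = (\<integral>x. V x * pois_mixed k (r1 powr \<alpha>1 * r2 powr \<alpha>2 * V x) \<partial>Q)"
      using derivs(3)[of "r1 powr \<alpha>1 * r2 powr \<alpha>2"] r by simp
    also have "\<dots> = (\<integral>x. weight x * h (scaled r1 r2 x) \<partial>Q)"
    proof (rule integral_cong_AE)
      show "AE x in Q. V x * pois_mixed k (r1 powr \<alpha>1 * r2 powr \<alpha>2 * V x) = weight x * h (scaled r1 r2 x)"
        using AE_Q_pos by eventually_elim (simp add: scaled_eq r V_def h_def mult_ac)
      show "(\<lambda>x. weight x * h (scaled r1 r2 x)) \<in> borel_measurable Q" unfolding h_def by measurable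
    qed measurable
    finally show "mixed_deriv u r1 r2 = \<alpha>1 * r1 powr (\<alpha>1 - 1) * (\<alpha>2 * r2 powr (\<alpha>2 - 1)) * (\<integral>x. weight x * h (scaled r1 r2 x) \<partial>Q)" .
  qed
  let ?m = "\<lambda>r. \<integral>x. weight x * h (scaled (fst r) (snd r) x) \<partial>Q"
  let ?B = "{0<..<t1} \<times> {0<..<t2}"
  define c where "c = 1 / (Gamma (1 - \<alpha>1) * Gamma (1 - \<alpha>2))"
  have G: "0 < Gamma (1 - \<alpha>1)" "0 < Gamma (1 - \<alpha>2)"
    using D1.alpha D2.alpha by (auto intro!: Gamma_real_pos)
  have bound: "\<bar>h (y1, y2)\<bar> \<le> lam * (4 * real k + 5)" if "0 \<le> y1" "0 \<le> y2" for y1 y2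
    using pois_mixed_bound[of "lam * (y1 * y2)" k] that lam by (simp add: h_def abs_mult)
  have h_meas: "h \<in> borel_measurable (borel \<Otimes>\<^sub>M borel)" unfolding h_def by measurable
  note hbi = has_bochner_integral_caputo_pair[OF h_meas t bound]
  \<comment> \<open>The constant \<open>c\<close> of the Caputo derivative turns the factors
    \<open>\<alpha>1\<close> and \<open>\<alpha>2\<close> of the chain rule into the two values of
    \<open>stable_const\<close>.\<close>
  have integrand: "(\<lambda>r. indicator ?B r *\<^sub>R (kernel t1 t2 r * ?m r))
      = (\<lambda>r. c *\<^sub>R (indicator ?B r *\<^sub>R caputo_integrand \<alpha>1 \<alpha>2 u t1 t2 r))"
  proof
    fix r :: "real \<times> real"
    obtain r1 r2 where r: "r = (r1, r2)" by (cases r)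
    show "indicator ?B r *\<^sub>R (kernel t1 t2 r * ?m r)
      = c *\<^sub>R (indicator ?B r *\<^sub>R caputo_integrand \<alpha>1 \<alpha>2 u t1 t2 r)"
    proof (cases "r \<in> ?B")
      case True
      then have "0 < r1" "0 < r2" by (auto simp: r)
      then show ?thesis using True G
        by (simp add: r caputo_integrand_def mixed kernel_def c_def D1.stable_const_def D2.stable_const_def
            powr_minus field_simps)
    qed simp
  qed
  have c: "c \<noteq> 0" using G by (simp add: c_def)
  have "integrable lborel (\<lambda>r. c *\<^sub>R (indicator ?B r *\<^sub>R caputo_integrand \<alpha>1 \<alpha>2 u t1 t2 r))"
    using hbi unfolding integrand by (rule integrable.intros)
  then have "set_integrable lborel ?B (caputo_integrand \<alpha>1 \<alpha>2 u t1 t2)"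
    using c by (simp add: set_integrable_def)
  with mixed show "caputo_mixed_exists \<alpha>1 \<alpha>2 u t1 t2" by (auto simp: caputo_mixed_exists_def)
  show "caputo_mixed \<alpha>1 \<alpha>2 u t1 t2 = (\<integral>x. h (scaled t1 t2 x) \<partial>Q)"
    using has_bochner_integral_integral_eq[OF hbi] unfolding integrand
    by (simp add: caputo_mixed_def set_lebesgue_integral_def c_def)
qed

end

text \<open>Independence makes the joint law a product, and one pair of laws serves all times at
  once, as differentiation in the times requires.\<close>

lemma fractional_field_stable_laws:
  assumes fpf: "fractional_poisson_field M lam \<alpha>1 \<alpha>2 P Y1 Y2"
    and \<alpha>: "0 < \<alpha>1" "\<alpha>1 < 1" "0 < \<alpha>2" "\<alpha>2 < 1" and lam: "0 < lam"
  obtains D1 D2 where "stable_law_pair D1 D2 \<alpha>1 \<alpha>2"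
    "\<And>t1 t2 (\<phi> :: real \<times> real \<Rightarrow> real). 0 \<le> t1 \<Longrightarrow> 0 \<le> t2 \<Longrightarrow> \<phi> \<in> borel_measurable (borel \<Otimes>\<^sub>M borel) \<Longrightarrow>
      (\<integral>\<omega>. \<phi> (Y1 t1 \<omega>, Y2 t2 \<omega>) \<partial>M) = (\<integral>x. \<phi> (stable_law_pair.scaled \<alpha>1 \<alpha>2 t1 t2 x) \<partial>(D1 \<Otimes>\<^sub>M D2))"
proof -
  obtain D1 where D1: "stable_law D1 \<alpha>1" "\<And>t. 0 \<le> t \<Longrightarrow> distr M borel (Y1 t) = distr D1 borel (\<lambda>x. (t / x) powr \<alpha>1)"
    using inverse_stable_law[OF fpf_inverse1[OF fpf \<alpha> lam order_refl order_refl] \<alpha>(1,2)] by metis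
  obtain D2 where D2: "stable_law D2 \<alpha>2" "\<And>t. 0 \<le> t \<Longrightarrow> distr M borel (Y2 t) = distr D2 borel (\<lambda>x. (t / x) powr \<alpha>2)"
    using inverse_stable_law[OF fpf_inverse2[OF fpf \<alpha> lam order_refl order_refl] \<alpha>(3,4)] by metis
  interpret D1: stable_law D1 \<alpha>1 by fact
  interpret D2: stable_law D2 \<alpha>2 by fact
  interpret stable_law_pair D1 D2 \<alpha>1 \<alpha>2 ..
  interpret M: prob_space M by (rule fpf_prob_space[OF fpf \<alpha> lam order_refl order_refl])
  show thesis
  proof
    show "stable_law_pair D1 D2 \<alpha>1 \<alpha>2" ..
    fix t1 t2 :: real and \<phi> :: "real \<times> real \<Rightarrow> real"
    assume t: "0 \<le> t1" "0 \<le> t2" and [measurable]: "\<phi> \<in> borel_measurable (borel \<Otimes>\<^sub>M borel)"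
    note [measurable] = fpf_measurable[OF fpf \<alpha> lam t]
    have "distr M (borel \<Otimes>\<^sub>M borel) (\<lambda>\<omega>. (Y1 t1 \<omega>, Y2 t2 \<omega>)) = distr M borel (Y1 t1) \<Otimes>\<^sub>M distr M borel (Y2 t2)"
      using fpf_indep_var[OF fpf \<alpha> lam t] by (simp add: M.indep_var_distribution_eq)
    also have "\<dots> = distr D1 borel (\<lambda>x. (t1 / x) powr \<alpha>1) \<Otimes>\<^sub>M distr D2 borel (\<lambda>x. (t2 / x) powr \<alpha>2)"
      by (simp add: D1(2) D2(2) t)
    also have "\<dots> = distr Q (borel \<Otimes>\<^sub>M borel) (\<lambda>(x, y). ((t1 / x) powr \<alpha>1, (t2 / y) powr \<alpha>2))"
      by (intro pair_measure_distr prob_space_imp_sigma_finite D2.prob_space_distr) measurable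
    also have "(\<lambda>(x, y). ((t1 / x) powr \<alpha>1, (t2 / y) powr \<alpha>2)) = scaled t1 t2"
      by (auto simp: scaled_def)
    finally have law: "distr M (borel \<Otimes>\<^sub>M borel) (\<lambda>\<omega>. (Y1 t1 \<omega>, Y2 t2 \<omega>)) = distr Q (borel \<Otimes>\<^sub>M borel) (scaled t1 t2)" .
    have "(\<integral>\<omega>. \<phi> (Y1 t1 \<omega>, Y2 t2 \<omega>) \<partial>M) = (\<integral>y. \<phi> y \<partial>distr M (borel \<Otimes>\<^sub>M borel) (\<lambda>\<omega>. (Y1 t1 \<omega>, Y2 t2 \<omega>)))"
      by (rule integral_distr[symmetric]) measurable
    also have "\<dots> = (\<integral>x. \<phi> (scaled t1 t2 x) \<partial>Q)"
      unfolding law by (rule integral_distr) measurable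
    finally show "(\<integral>\<omega>. \<phi> (Y1 t1 \<omega>, Y2 t2 \<omega>) \<partial>M) = (\<integral>x. \<phi> (scaled t1 t2 x) \<partial>Q)" .
  qed
qed

section \<open>Both sides of the fractional equations as expectations\<close>

lemma recurrence_rhs_bound:
  assumes "0 < lam" "0 \<le> x1" "0 \<le> x2"
  shows "\<bar>recurrence_rhs lam (classical_prob lam) k x1 x2\<bar> \<le> lam * (4 * real k + 5)"
  using pois_mixed_bound[of "lam * x1 * x2" k] assms by (simp add: recurrence_rhs_classical abs_mult)

lemma continuous_recurrence_rhs:
  "continuous_on UNIV (\<lambda>p. recurrence_rhs lam (classical_prob lam) k (fst p) (snd p))"
  unfolding recurrence_rhs_classical
  by (intro continuous_intros continuous_on_compose2[OF continuous_on_pois_mixed]) auto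

lemma fractional_field_caputo:
  assumes fpf: "fractional_poisson_field M lam \<alpha>1 \<alpha>2 P Y1 Y2"
    and \<alpha>: "0 < \<alpha>1" "\<alpha>1 < 1" "0 < \<alpha>2" "\<alpha>2 < 1" and lam: "0 < lam" and t: "0 < t1" "0 < t2"
  shows "caputo_mixed_exists \<alpha>1 \<alpha>2 (fpf_prob M P Y1 Y2 k) t1 t2"
    and "caputo_mixed \<alpha>1 \<alpha>2 (fpf_prob M P Y1 Y2 k) t1 t2
      = (\<integral>\<omega>. recurrence_rhs lam (classical_prob lam) k (Y1 t1 \<omega>) (Y2 t2 \<omega>) \<partial>M)"
proof -
  obtain D1 D2 where "stable_law_pair D1 D2 \<alpha>1 \<alpha>2"
    and law: "\<And>t1 t2 (\<phi> :: real \<times> real \<Rightarrow> real). 0 \<le> t1 \<Longrightarrow> 0 \<le> t2 \<Longrightarrow> \<phi> \<in> borel_measurable (borel \<Otimes>\<^sub>M borel) \<Longrightarrow>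
      (\<integral>\<omega>. \<phi> (Y1 t1 \<omega>, Y2 t2 \<omega>) \<partial>M) = (\<integral>x. \<phi> (stable_law_pair.scaled \<alpha>1 \<alpha>2 t1 t2 x) \<partial>(D1 \<Otimes>\<^sub>M D2))"
    using fractional_field_stable_laws[OF fpf \<alpha> lam] by blast
  then interpret stable_law_pair D1 D2 \<alpha>1 \<alpha>2 by simp
  have u: "fpf_prob M P Y1 Y2 k r1 r2 = (\<integral>x. pois k (lam * (fst (scaled r1 r2 x) * snd (scaled r1 r2 x))) \<partial>Q)"
    if r: "0 < r1" "0 < r2" for r1 r2
    using fpf_prob_eq_expectation[OF fpf \<alpha> lam, of r1 r2 k] r
      law[of r1 r2 "\<lambda>y. pois k (lam * (fst y * snd y))"]
    by (simp add: classical_prob_eq_pois mult.assoc)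
  note * = caputo_pois_mixture[OF lam t u]
  show "caputo_mixed_exists \<alpha>1 \<alpha>2 (fpf_prob M P Y1 Y2 k) t1 t2" by (rule *(1))
  have c: "caputo_mixed \<alpha>1 \<alpha>2 (fpf_prob M P Y1 Y2 k) t1 t2
      = (\<integral>x. lam * pois_mixed k (lam * (fst (scaled t1 t2 x) * snd (scaled t1 t2 x))) \<partial>Q)" by (rule *(2))
  have "pois_mixed k \<in> borel_measurable borel"
    by (rule borel_measurable_continuous_onI[OF continuous_on_pois_mixed])
  then show "caputo_mixed \<alpha>1 \<alpha>2 (fpf_prob M P Y1 Y2 k) t1 t2
      = (\<integral>\<omega>. recurrence_rhs lam (classical_prob lam) k (Y1 t1 \<omega>) (Y2 t2 \<omega>) \<partial>M)"
    using law[of t1 t2 "\<lambda>y. lam * pois_mixed k (lam * (fst y * snd y))"] t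
    unfolding c recurrence_rhs_classical by (auto simp: mult.assoc)
qed

text \<open>The values of \<open>process_density\<close> off the positive axis are not controlled,
  so it is cut off before serving as the density of a measure on the line.\<close>

lemma process_density_law_real:
  assumes inv: "inverse_stable_subordinator M \<alpha> Y" and \<alpha>: "0 < \<alpha>" "\<alpha> < 1" and t: "0 < t"
  defines "w \<equiv> \<lambda>x. process_density M Y t x * indicator {0<..} x"
  shows "w \<in> borel_measurable borel" "distr M borel (Y t) = density lborel (\<lambda>x. ennreal (w x))" "0 \<le> w x"
proof -
  note * = process_density_law[OF inv \<alpha> t]
  have eq: "(\<lambda>x. ennreal (process_density M Y t x) * indicator {0<..} x) = (\<lambda>x. ennreal (w x))"
    by (auto simp: w_def indicator_def)
  show nn: "0 \<le> w x" for x using *(3)[of x] by (simp add: w_def indicator_def)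
  have "(\<lambda>x. enn2real (ennreal (w x))) \<in> borel_measurable borel"
    using *(1) unfolding eq by measurable
  then show "w \<in> borel_measurable borel" using nn by simp
  show "distr M borel (Y t) = density lborel (\<lambda>x. ennreal (w x))" using *(2) unfolding eq .
qed

text \<open>By independence the pair of inverse subordinators has the product of the two densities
  as its density, so the average is an expectation. A bound for \<open>\<phi>\<close> on the
  quadrant is enough, as both coordinates are almost surely nonnegative.\<close>

lemma fractional_field_averaged:
  assumes fpf: "fractional_poisson_field M lam \<alpha>1 \<alpha>2 P Y1 Y2"
    and \<alpha>: "0 < \<alpha>1" "\<alpha>1 < 1" "0 < \<alpha>2" "\<alpha>2 < 1" and lam: "0 < lam" and t: "0 < t1" "0 < t2"
    and \<phi>: "continuous_on UNIV (\<lambda>p. \<phi> (fst p) (snd p))"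
    and bound: "\<And>x1 x2. 0 \<le> x1 \<Longrightarrow> 0 \<le> x2 \<Longrightarrow> \<bar>\<phi> x1 x2\<bar> \<le> C"
  shows "set_integrable lborel ({0<..} \<times> {0<..})
      (averaged_integrand \<phi> (process_density M Y1) (process_density M Y2) t1 t2)"
    and "averaged \<phi> (process_density M Y1) (process_density M Y2) t1 t2 = (\<integral>\<omega>. \<phi> (Y1 t1 \<omega>) (Y2 t2 \<omega>) \<partial>M)"
proof -
  note t' = t[THEN less_imp_le]
  interpret M: prob_space M by (rule fpf_prob_space[OF fpf \<alpha> lam t'])
  note inv = fpf_inverse1[OF fpf \<alpha> lam t'] fpf_inverse2[OF fpf \<alpha> lam t']
  note [measurable] = fpf_measurable[OF fpf \<alpha> lam t']
  define w1 where "w1 x = process_density M Y1 t1 x * indicator {0<..} x" for x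
  define w2 where "w2 x = process_density M Y2 t2 x * indicator {0<..} x" for x
  note w1 = process_density_law_real[OF inv(1) \<alpha>(1,2) t(1), folded w1_def]
  note w2 = process_density_law_real[OF inv(2) \<alpha>(3,4) t(2), folded w2_def]
  note [measurable] = w1(1) w2(1)
  define \<psi> where "\<psi> p = \<phi> (fst p) (snd p)" for p
  have "\<psi> \<in> borel_measurable borel" unfolding \<psi>_def by (rule borel_measurable_continuous_onI[OF \<phi>])
  then have [measurable]: "\<psi> \<in> borel_measurable (borel \<Otimes>\<^sub>M borel)" by (simp add: borel_prod)
  define W where "W p = w1 (fst p) * w2 (snd p)" for p
  have [measurable]: "W \<in> borel_measurable (borel \<Otimes>\<^sub>M borel)" unfolding W_def[abs_def] by measurable
  have W0: "0 \<le> W p" for p by (simp add: W_def w1 w2)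
  let ?law = "distr M (borel \<Otimes>\<^sub>M borel) (\<lambda>\<omega>. (Y1 t1 \<omega>, Y2 t2 \<omega>))"
  have "?law = distr M borel (Y1 t1) \<Otimes>\<^sub>M distr M borel (Y2 t2)"
    using fpf_indep_var[OF fpf \<alpha> lam t'] by (simp add: M.indep_var_distribution_eq)
  also have "\<dots> = density lborel (\<lambda>x. ennreal (w1 x)) \<Otimes>\<^sub>M density lborel (\<lambda>x. ennreal (w2 x))"
    by (simp only: w1(2) w2(2))
  also have "\<dots> = density (lborel \<Otimes>\<^sub>M lborel) (\<lambda>(x, y). ennreal (w1 x) * ennreal (w2 y))"
  proof (rule pair_measure_density)
    show "sigma_finite_measure (density lborel (\<lambda>x. ennreal (w2 x)))"
      unfolding w2(2)[symmetric] by (intro prob_space_imp_sigma_finite M.prob_space_distr) measurable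
  qed (auto intro: lborel.sigma_finite_measure_axioms)
  also have "(\<lambda>(x, y). ennreal (w1 x) * ennreal (w2 y)) = (\<lambda>p. ennreal (W p))"
    by (auto simp: W_def ennreal_mult w1 w2)
  finally have law: "?law = density lborel (\<lambda>p. ennreal (W p))" by (simp add: lborel_prod)
  have "AE \<omega> in M. norm (\<psi> (Y1 t1 \<omega>, Y2 t2 \<omega>)) \<le> C"
    using inverse_stable_AE_nonneg[OF inv(1) \<alpha>(1,2) t'(1)] inverse_stable_AE_nonneg[OF inv(2) \<alpha>(3,4) t'(2)]
    by eventually_elim (simp add: \<psi>_def bound)
  then have "integrable M (\<lambda>\<omega>. \<psi> (Y1 t1 \<omega>, Y2 t2 \<omega>))"
    by (intro M.integrable_const_bound) measurable
  then have "integrable ?law \<psi>" by (subst integrable_distr_eq) measurable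
  moreover have W_meas: "W \<in> borel_measurable lborel" "\<psi> \<in> borel_measurable lborel"
    using \<open>W \<in> _\<close> \<open>\<psi> \<in> borel_measurable borel\<close> by (simp_all add: borel_prod)
  ultimately have int: "integrable lborel (\<lambda>p. W p *\<^sub>R \<psi> p)"
    unfolding law by (subst (asm) integrable_density) (auto simp: W0)
  have integrand: "indicator ({0<..} \<times> {0<..}) p *\<^sub>R averaged_integrand \<phi> (process_density M Y1) (process_density M Y2) t1 t2 p
      = W p *\<^sub>R \<psi> p" for p
    by (cases p) (simp add: averaged_integrand_def W_def w1_def w2_def \<psi>_def indicator_def)
  show "set_integrable lborel ({0<..} \<times> {0<..})
      (averaged_integrand \<phi> (process_density M Y1) (process_density M Y2) t1 t2)"
    unfolding set_integrable_def integrand by (rule int)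
  have "averaged \<phi> (process_density M Y1) (process_density M Y2) t1 t2 = (\<integral>p. W p *\<^sub>R \<psi> p \<partial>lborel)"
    unfolding averaged_def set_lebesgue_integral_def integrand ..
  also have "\<dots> = (\<integral>p. \<psi> p \<partial>?law)"
    unfolding law using W_meas W0 by (subst integral_density) auto
  also have "\<dots> = (\<integral>\<omega>. \<psi> (Y1 t1 \<omega>, Y2 t2 \<omega>) \<partial>M)" by (rule integral_distr) measurable
  finally show "averaged \<phi> (process_density M Y1) (process_density M Y2) t1 t2 = (\<integral>\<omega>. \<phi> (Y1 t1 \<omega>) (Y2 t2 \<omega>) \<partial>M)"
    by (simp add: \<psi>_def)
qed

lemma integral_process_density:
  assumes inv: "inverse_stable_subordinator M \<alpha> Y" and \<alpha>: "0 < \<alpha>" "\<alpha> < 1" and t: "0 < t"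
    and [measurable]: "\<phi> \<in> borel_measurable borel"
  shows "(LINT x : {0<..} | lborel. \<phi> x * process_density M Y t x) = (\<integral>\<omega>. \<phi> (Y t \<omega>) \<partial>M)"
proof -
  have [measurable]: "Y t \<in> borel_measurable M"
    using inv t by (simp add: inverse_stable_subordinator_def)
  define w where "w x = process_density M Y t x * indicator {0<..} x" for x
  note w = process_density_law_real[OF inv \<alpha> t, folded w_def]
  note [measurable] = w(1)
  have "(\<integral>\<omega>. \<phi> (Y t \<omega>) \<partial>M) = (\<integral>x. \<phi> x \<partial>distr M borel (Y t))" by (rule integral_distr[symmetric]) measurable
  also have "\<dots> = (\<integral>x. w x *\<^sub>R \<phi> x \<partial>lborel)"
    unfolding w(2) using w(3) by (subst integral_density) auto
  finally show ?thesis by (simp add: set_lebesgue_integral_def w_def mult_ac)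
qed

section \<open>Limits as the indices tend to one\<close>

text \<open>The bound is uniform over all laws of index \<open>a\<close>, so that it applies to
  subordinators on probability spaces varying with the index. It is Markov's inequality for the
  squared deviation of \<open>exp (- x)\<close> from \<open>exp (- 1)\<close>.\<close>

lemma stable_law_concentration:
  assumes t: "0 < t" and \<eta>: "0 < \<eta>" and \<delta>: "0 < \<delta>"
  shows "\<forall>\<^sub>F a in at_left 1. \<forall>D. stable_law D a \<longrightarrow> measure D {x. \<eta> \<le> \<bar>(t / x) powr a - t\<bar>} \<le> \<delta>"
proof -
  \<comment> \<open>\<open>(t / x) powr a\<close> as a function of the index and of
    \<open>exp (- x)\<close>. It is continuous at \<open>(1, exp (- 1))\<close> with value
    \<open>t\<close>, which converts closeness of \<open>exp (- x)\<close> to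
    \<open>exp (- 1)\<close> into closeness to \<open>t\<close>.\<close>
  define \<psi> where "\<psi> p = (t / (- ln (snd p))) powr fst p" for p :: "real \<times> real"
  have "(\<psi> \<longlongrightarrow> (t / (- ln (exp (- 1)))) powr 1) (at_left 1 \<times>\<^sub>F nhds (exp (- 1)))"
    unfolding \<psi>_def
  proof (intro tendsto_powr tendsto_divide tendsto_const tendsto_minus tendsto_ln)
    show "(snd \<longlongrightarrow> exp (- 1 :: real)) (at_left (1::real) \<times>\<^sub>F nhds (exp (- 1)))" by (rule filterlim_snd)
    show "(fst \<longlongrightarrow> (1::real)) (at_left 1 \<times>\<^sub>F nhds (exp (- 1 :: real)))"
      by (rule filterlim_mono[OF filterlim_fst _ order_refl]) (simp add: at_within_def)
  qed (use t in auto)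
  then have "\<forall>\<^sub>F p in at_left 1 \<times>\<^sub>F nhds (exp (- 1)). dist (\<psi> p) t < \<eta>"
    using tendstoD[OF _ \<eta>] t by fastforce
  then obtain Pa Pz where Pa: "\<forall>\<^sub>F a in at_left (1::real). Pa a" and Pz: "\<forall>\<^sub>F z in nhds (exp (- 1 :: real)). Pz z"
    and P: "\<And>a z. Pa a \<Longrightarrow> Pz z \<Longrightarrow> dist (\<psi> (a, z)) t < \<eta>"
    unfolding eventually_prod_filter by blast
  obtain \<epsilon> where \<epsilon>: "0 < \<epsilon>" "\<And>z. dist z (exp (- 1)) < \<epsilon> \<Longrightarrow> Pz z"
    using Pz by (auto simp: eventually_nhds_metric)
  have "((\<lambda>a. exp (- (2 powr a)) - exp (- 2 :: real)) \<longlongrightarrow> exp (- (2 powr 1)) - exp (- 2)) (at_left 1)"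
    by (intro tendsto_intros) auto
  then have "\<forall>\<^sub>F a in at_left 1. exp (- (2 powr a)) - exp (- 2 :: real) < \<delta> * \<epsilon>\<^sup>2"
    using \<delta> \<epsilon> by (intro order_tendstoD(2)) auto
  with Pa show ?thesis
  proof eventually_elim
    case (elim a)
    show ?case
    proof (intro allI impI)
      fix D assume "stable_law D a"
      then interpret stable_law D a .
      \<comment> \<open>\<open>exp (- x)\<close> has mean \<open>exp (- 1)\<close> for every index, and its variance tends to zero.\<close>
      define f where "f x = (exp (- x) - exp (- 1))\<^sup>2" for x :: real
      have e_int: "integrable D (\<lambda>x. exp (- (s * x)))" if "0 \<le> s" for s
      proof (rule integrable_const_bound[where B=1])
        show "AE x in D. norm (exp (- (s * x))) \<le> 1"
          using AE_nonneg by eventually_elim (use that in auto)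
      qed measurable
      have f_eq: "f x = exp (- (2 * x)) - 2 * exp (- 1) * exp (- (1 * x)) + exp (- 2)" for x
        by (simp add: f_def power2_eq_square algebra_simps exp_add[symmetric])
      have f_int: "integrable D f"
        unfolding f_eq[abs_def] using e_int[of 1] e_int[of 2] by auto
      have "(\<integral>x. f x \<partial>D) = exp (- (2 powr a)) - 2 * exp (- 1) * exp (- (1 powr a)) + exp (- 2)"
        unfolding f_eq using e_int[of 1] e_int[of 2] laplace[of 1] laplace[of 2] prob_space by simp
      also have "\<dots> = exp (- (2 powr a)) - exp (- 2)" by (simp add: exp_add[symmetric])
      finally have f_val: "(\<integral>x. f x \<partial>D) < \<delta> * \<epsilon>\<^sup>2" using elim by simp
      have "measure D {x. \<eta> \<le> \<bar>(t / x) powr a - t\<bar>} \<le> measure D {x \<in> space D. \<epsilon>\<^sup>2 \<le> f x}"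
      proof (rule finite_measure_mono_AE)
        show "AE x in D. x \<in> {x. \<eta> \<le> \<bar>(t / x) powr a - t\<bar>} \<longrightarrow> x \<in> {x \<in> space D. \<epsilon>\<^sup>2 \<le> f x}"
          using AE_pos
        proof eventually_elim
          fix x :: real assume "0 < x"
          show "x \<in> {x. \<eta> \<le> \<bar>(t / x) powr a - t\<bar>} \<longrightarrow> x \<in> {x \<in> space D. \<epsilon>\<^sup>2 \<le> f x}"
          proof (rule impI, rule ccontr)
            assume far: "x \<in> {x. \<eta> \<le> \<bar>(t / x) powr a - t\<bar>}" and near: "x \<notin> {x \<in> space D. \<epsilon>\<^sup>2 \<le> f x}"
            from near have "f x < \<epsilon>\<^sup>2" by (simp add: not_le)
            then have "\<bar>exp (- x) - exp (- 1)\<bar>\<^sup>2 < \<epsilon>\<^sup>2" unfolding f_def power2_abs .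
            then have "\<bar>exp (- x) - exp (- 1)\<bar> < \<epsilon>"
              by (rule power2_less_imp_less) (use \<epsilon>(1) in simp)
            then have "Pz (exp (- x))" by (intro \<epsilon>(2)) (simp add: dist_real_def)
            from P[OF elim(1) this] far show False by (simp add: \<psi>_def dist_real_def)
          qed
        qed
        show "{x \<in> space D. \<epsilon>\<^sup>2 \<le> f x} \<in> events" unfolding f_def by measurable
      qed
      also have "\<dots> \<le> (\<integral>x. f x \<partial>D) / \<epsilon>\<^sup>2"
        using \<epsilon>(1) by (intro integral_Markov_inequality_measure[OF f_int, of "{}"]) (auto simp: f_def)
      also have "\<dots> \<le> \<delta>" using f_val \<epsilon>(1) by (simp add: divide_le_eq)
      finally show "measure D {x. \<eta> \<le> \<bar>(t / x) powr a - t\<bar>} \<le> \<delta>" .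
    qed
  qed
qed

lemma inverse_stable_concentration:
  assumes t: "0 < t" and \<eta>: "0 < \<eta>" and \<delta>: "0 < \<delta>"
  shows "\<forall>\<^sub>F a in at_left 1. \<forall>(M :: 'a measure) Y. inverse_stable_subordinator M a Y \<longrightarrow>
    measure M {\<omega> \<in> space M. \<eta> \<le> \<bar>Y t \<omega> - t\<bar>} \<le> \<delta>"
proof -
  have "\<forall>\<^sub>F a in at_left 1. a \<in> {0<..<1::real}"
    by (rule eventually_at_left_real) simp
  with stable_law_concentration[OF assms] show ?thesis
  proof eventually_elim
    case (elim a)
    show ?case
    proof (intro allI impI)
      fix M :: "'a measure" and Y assume inv: "inverse_stable_subordinator M a Y"
      obtain D where D: "stable_law D a" and law: "distr M borel (Y t) = distr D borel (\<lambda>x. (t / x) powr a)"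
        using inverse_stable_law[OF inv] elim(2) t by (metis greaterThanLessThan_iff less_imp_le)
      interpret stable_law D a by fact
      have [measurable]: "Y t \<in> borel_measurable M"
        using inv t by (simp add: inverse_stable_subordinator_def)
      let ?A = "{y. \<eta> \<le> \<bar>y - t\<bar>}"
      have [measurable]: "?A \<in> sets borel" by measurable
      have "measure M {\<omega> \<in> space M. \<eta> \<le> \<bar>Y t \<omega> - t\<bar>} = measure (distr M borel (Y t)) ?A"
        by (subst measure_distr) (auto intro!: arg_cong2[where f=measure])
      also have "\<dots> = measure D {x. \<eta> \<le> \<bar>(t / x) powr a - t\<bar>}"
        unfolding law by (subst measure_distr) (auto intro!: arg_cong2[where f=measure])
      also have "\<dots> \<le> \<delta>" using elim(1) D by blast
      finally show "measure M {\<omega> \<in> space M. \<eta> \<le> \<bar>Y t \<omega> - t\<bar>} \<le> \<delta>" .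
    qed
  qed
qed

lemma (in prob_space) expectation_close:
  fixes f :: "'a \<Rightarrow> real"
  assumes [measurable]: "f \<in> borel_measurable M" and bound: "AE \<omega> in M. \<bar>f \<omega>\<bar> \<le> B" "\<bar>c\<bar> \<le> B"
    and A [measurable]: "A \<in> events" and close: "\<And>\<omega>. \<omega> \<in> space M \<Longrightarrow> \<omega> \<notin> A \<Longrightarrow> \<bar>f \<omega> - c\<bar> \<le> \<epsilon>"
    and \<epsilon>: "0 \<le> \<epsilon>"
  shows "\<bar>expectation f - c\<bar> \<le> \<epsilon> + 2 * B * prob A"
proof -
  have int: "integrable M f" by (rule integrable_const_bound[where B=B]) (use bound in auto)
  have ind_int: "integrable M (\<lambda>\<omega>. 2 * B * indicator A \<omega>)"
    by (intro integrable_mult_right integrable_real_indicator A) (simp add: less_top[symmetric])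
  have "\<bar>expectation f - c\<bar> = \<bar>\<integral>\<omega>. f \<omega> - c \<partial>M\<bar>" using int prob_space by simp
  also have "\<dots> \<le> (\<integral>\<omega>. \<bar>f \<omega> - c\<bar> \<partial>M)" by (rule integral_abs_bound)
  also have "\<dots> \<le> (\<integral>\<omega>. \<epsilon> + 2 * B * indicator A \<omega> \<partial>M)"
  proof (rule integral_mono_AE)
    show "AE \<omega> in M. \<bar>f \<omega> - c\<bar> \<le> \<epsilon> + 2 * B * indicator A \<omega>"
      using bound(1) AE_space
    proof eventually_elim
      case (elim \<omega>)
      then show ?case using close[of \<omega>] bound(2) \<epsilon> by (cases "\<omega> \<in> A") auto
    qed
    show "integrable M (\<lambda>\<omega>. \<epsilon> + 2 * B * indicator A \<omega>)"
      by (intro Bochner_Integration.integrable_add integrable_const ind_int)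
  qed (use int in auto)
  also have "\<dots> = \<epsilon> + 2 * B * prob A"
    by (subst Bochner_Integration.integral_add[OF integrable_const ind_int]) (simp add: prob_space)
  finally show ?thesis .
qed

lemma tendsto_inverse_stable:
  fixes S :: "real \<Rightarrow> 'a measure" and Z :: "real \<Rightarrow> real \<Rightarrow> 'a \<Rightarrow> real" and \<phi> :: "real \<Rightarrow> real"
  assumes S: "\<And>a. a \<in> {0<..<1} \<Longrightarrow> inverse_stable_subordinator (S a) a (Z a)" and t: "0 < t"
    and \<phi>: "continuous_on UNIV \<phi>" "bounded (range \<phi>)"
  shows "((\<lambda>a. \<integral>\<omega>. \<phi> (Z a t \<omega>) \<partial>S a) \<longlongrightarrow> \<phi> t) (at_left 1)"
proof (rule tendstoI)
  fix e :: real assume e: "0 < e"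
  obtain B where B: "0 < B" "\<And>x. \<bar>\<phi> x\<bar> \<le> B" using \<phi>(2) by (auto simp: bounded_pos)
  obtain \<eta> where \<eta>: "0 < \<eta>" "\<And>x. \<bar>x - t\<bar> < \<eta> \<Longrightarrow> \<bar>\<phi> x - \<phi> t\<bar> < e / 2"
    using \<phi>(1) e unfolding continuous_on_iff by (metis UNIV_I dist_real_def half_gt_zero)
  have \<delta>: "0 < e / (16 * B)" using e B by simp
  have "\<forall>\<^sub>F a in at_left 1. a \<in> {0<..<1::real}" by (rule eventually_at_left_real) simp
  with inverse_stable_concentration[OF t \<eta>(1) \<delta>, where 'a='a]
  show "\<forall>\<^sub>F a in at_left 1. dist (\<integral>\<omega>. \<phi> (Z a t \<omega>) \<partial>S a) (\<phi> t) < e"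
  proof eventually_elim
    case (elim a)
    note inv = S[OF elim(2)]
    interpret prob_space "S a"
      using inv by (auto simp: inverse_stable_subordinator_def stable_subordinator_def levy_subordinator_def levy_process_def)
    have [measurable]: "Z a t \<in> borel_measurable (S a)" "\<phi> \<in> borel_measurable borel"
      using inv t \<phi>(1) by (auto simp: inverse_stable_subordinator_def intro: borel_measurable_continuous_onI)
    let ?A = "{\<omega> \<in> space (S a). \<eta> \<le> \<bar>Z a t \<omega> - t\<bar>}"
    have "\<bar>expectation (\<lambda>\<omega>. \<phi> (Z a t \<omega>)) - \<phi> t\<bar> \<le> e / 2 + 2 * B * prob ?A"
      by (rule expectation_close) (use B less_imp_le[OF \<eta>(2)] e in \<open>auto simp: not_le\<close>)
    also have "\<dots> \<le> e / 2 + 2 * B * (e / (16 * B))"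
      using elim(1) inv B by (intro add_left_mono mult_left_mono) auto
    also have "\<dots> < e" using e B by simp
    finally show ?case by (simp add: dist_real_def)
  qed
qed

text \<open>Each coordinate tends to its time in probability, so the pair does, and a continuous
  function bounded on the quadrant passes to the limit. In the product filter the two indices tend
  to one independently of each other.\<close>

lemma tendsto_fractional_field:
  fixes S :: "real \<Rightarrow> real \<Rightarrow> 'a measure" and \<phi> :: "real \<Rightarrow> real \<Rightarrow> real"
  assumes S: "\<And>a b. a \<in> {0<..<1} \<Longrightarrow> b \<in> {0<..<1} \<Longrightarrow>
      fractional_poisson_field (S a b) lam a b (Q a b) (Z1 a b) (Z2 a b)"
    and lam: "0 < lam" and t: "0 < t1" "0 < t2"
    and \<phi>: "continuous_on UNIV (\<lambda>p. \<phi> (fst p) (snd p))"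
    and bound: "\<And>x1 x2. 0 \<le> x1 \<Longrightarrow> 0 \<le> x2 \<Longrightarrow> \<bar>\<phi> x1 x2\<bar> \<le> C"
  shows "((\<lambda>(a, b). \<integral>\<omega>. \<phi> (Z1 a b t1 \<omega>) (Z2 a b t2 \<omega>) \<partial>S a b) \<longlongrightarrow> \<phi> t1 t2) (at_left 1 \<times>\<^sub>F at_left 1)"
proof (rule tendstoI)
  fix e :: real assume e: "0 < e"
  define B where "B = C + 1"
  have "0 \<le> C" using bound[of 0 0] by simp
  then have B: "0 < B" "\<And>x1 x2. 0 \<le> x1 \<Longrightarrow> 0 \<le> x2 \<Longrightarrow> \<bar>\<phi> x1 x2\<bar> \<le> B"
    using bound by (auto simp: B_def intro: order_trans[of _ C])
  have e2: "0 < e / 2" using e by simp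
  obtain d where d: "0 < d" "\<And>p. dist p (t1, t2) < d \<Longrightarrow> dist (\<phi> (fst p) (snd p)) (\<phi> t1 t2) < e / 2"
    using \<phi> e2 unfolding continuous_on_iff by (metis UNIV_I fst_conv snd_conv)
  define \<eta> where "\<eta> = d / 2"
  have \<eta>: "0 < \<eta>" using d by (simp add: \<eta>_def)
  have close: "\<bar>\<phi> x1 x2 - \<phi> t1 t2\<bar> < e / 2" if "\<bar>x1 - t1\<bar> < \<eta>" "\<bar>x2 - t2\<bar> < \<eta>" for x1 x2
  proof -
    have "dist (x1, x2) (t1, t2) \<le> \<bar>x1 - t1\<bar> + \<bar>x2 - t2\<bar>"
      by (simp add: dist_Pair_Pair dist_real_def sqrt_sum_squares_le_sum_abs)
    then have "dist (x1, x2) (t1, t2) < d" using that by (simp add: \<eta>_def)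
    from d(2)[OF this] show ?thesis by (simp add: dist_real_def)
  qed
  \<comment> \<open>Two exceptional events of this probability cost at most
    \<open>2 * B * (2 * e / (16 * B)) = e / 4\<close>, which fits beside the \<open>e / 2\<close>
    from continuity.\<close>
  have \<delta>: "0 < e / (16 * B)" using e B by simp
  have ev: "\<forall>\<^sub>F a in at_left 1. a \<in> {0<..<1::real}" by (rule eventually_at_left_real) simp
  note ev1 = eventually_conj[OF ev inverse_stable_concentration[OF t(1) \<eta> \<delta>, where 'a='a]]
  note ev2 = eventually_conj[OF ev inverse_stable_concentration[OF t(2) \<eta> \<delta>, where 'a='a]]
  from eventually_prodI[OF ev1 ev2]
  show "\<forall>\<^sub>F p in at_left 1 \<times>\<^sub>F at_left 1.
    dist (case p of (a, b) \<Rightarrow> \<integral>\<omega>. \<phi> (Z1 a b t1 \<omega>) (Z2 a b t2 \<omega>) \<partial>S a b) (\<phi> t1 t2) < e"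
  proof eventually_elim
    case (elim p)
    obtain a b where p: "p = (a, b)" by (cases p)
    have a: "0 < a" "a < 1" and b: "0 < b" "b < 1" using elim by (auto simp: p)
    note t' = t[THEN less_imp_le]
    have fpf: "fractional_poisson_field (S a b) lam a b (Q a b) (Z1 a b) (Z2 a b)" using S a b by simp
    note inv = fpf_inverse1[OF fpf a b lam t'] fpf_inverse2[OF fpf a b lam t']
    interpret prob_space "S a b" by (rule fpf_prob_space[OF fpf a b lam t'])
    note [measurable] = fpf_measurable[OF fpf a b lam t']
    have "(\<lambda>p. \<phi> (fst p) (snd p)) \<in> borel_measurable (borel \<Otimes>\<^sub>M borel)"
      using borel_measurable_continuous_onI[OF \<phi>] by (simp add: borel_prod)
    then have "(\<lambda>\<omega>. (\<lambda>p. \<phi> (fst p) (snd p)) (Z1 a b t1 \<omega>, Z2 a b t2 \<omega>)) \<in> borel_measurable (S a b)"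
      by (rule measurable_compose[rotated]) measurable
    then have meas: "(\<lambda>\<omega>. \<phi> (Z1 a b t1 \<omega>) (Z2 a b t2 \<omega>)) \<in> borel_measurable (S a b)" by simp
    let ?A1 = "{\<omega> \<in> space (S a b). \<eta> \<le> \<bar>Z1 a b t1 \<omega> - t1\<bar>}" and ?A2 = "{\<omega> \<in> space (S a b). \<eta> \<le> \<bar>Z2 a b t2 \<omega> - t2\<bar>}"
    have "\<bar>expectation (\<lambda>\<omega>. \<phi> (Z1 a b t1 \<omega>) (Z2 a b t2 \<omega>)) - \<phi> t1 t2\<bar> \<le> e / 2 + 2 * B * prob (?A1 \<union> ?A2)"
    proof (rule expectation_close[OF meas])
      show "AE \<omega> in S a b. \<bar>\<phi> (Z1 a b t1 \<omega>) (Z2 a b t2 \<omega>)\<bar> \<le> B"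
        using inverse_stable_AE_nonneg[OF inv(1) a t'(1)] inverse_stable_AE_nonneg[OF inv(2) b t'(2)]
        by eventually_elim (rule B)
      show "\<bar>\<phi> t1 t2\<bar> \<le> B" using t' by (rule B)
      show "?A1 \<union> ?A2 \<in> events" by measurable
      show "\<bar>\<phi> (Z1 a b t1 \<omega>) (Z2 a b t2 \<omega>) - \<phi> t1 t2\<bar> \<le> e / 2" if "\<omega> \<in> space (S a b)" "\<omega> \<notin> ?A1 \<union> ?A2" for \<omega>
        using that by (intro less_imp_le close) auto
    qed (use e in simp)
    also have "\<dots> \<le> e / 2 + 2 * B * (e / (16 * B) + e / (16 * B))"
    proof (intro add_left_mono mult_left_mono)
      have "prob (?A1 \<union> ?A2) \<le> prob ?A1 + prob ?A2" by (intro measure_Un_le) measurable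
      also have "\<dots> \<le> e / (16 * B) + e / (16 * B)"
        using elim inv by (intro add_mono) (auto simp: p)
      finally show "prob (?A1 \<union> ?A2) \<le> e / (16 * B) + e / (16 * B)" .
    qed (use B in simp)
    also have "\<dots> < e"
      using B e by (simp add: field_simps)
    finally have "\<bar>expectation (\<lambda>\<omega>. \<phi> (Z1 a b t1 \<omega>) (Z2 a b t2 \<omega>)) - \<phi> t1 t2\<bar> < e" .
    then show ?case by (simp add: p dist_real_def)
  qed
qed

text \<open>On the axes one coordinate of \<open>scaled\<close> is identically zero since
  \<open>0 powr a = 0\<close>, so the Poisson parameter vanishes; \<open>0 ^ 0 = 1\<close> gives the
  case \<open>k = 0\<close>.\<close>

lemma fractional_field_boundary:
  assumes fpf: "fractional_poisson_field M lam \<alpha>1 \<alpha>2 P Y1 Y2"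
    and \<alpha>: "0 < \<alpha>1" "\<alpha>1 < 1" "0 < \<alpha>2" "\<alpha>2 < 1" and lam: "0 < lam"
    and t: "0 \<le> t1" "0 \<le> t2" "t1 = 0 \<or> t2 = 0"
  shows "fpf_prob M P Y1 Y2 k t1 t2 = (if k = 0 then 1 else 0)"
proof -
  obtain D1 D2 where "stable_law_pair D1 D2 \<alpha>1 \<alpha>2"
    and law: "\<And>t1 t2 (\<phi> :: real \<times> real \<Rightarrow> real). 0 \<le> t1 \<Longrightarrow> 0 \<le> t2 \<Longrightarrow> \<phi> \<in> borel_measurable (borel \<Otimes>\<^sub>M borel) \<Longrightarrow>
      (\<integral>\<omega>. \<phi> (Y1 t1 \<omega>, Y2 t2 \<omega>) \<partial>M) = (\<integral>x. \<phi> (stable_law_pair.scaled \<alpha>1 \<alpha>2 t1 t2 x) \<partial>(D1 \<Otimes>\<^sub>M D2))"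
    using fractional_field_stable_laws[OF fpf \<alpha> lam] by blast
  then interpret stable_law_pair D1 D2 \<alpha>1 \<alpha>2 by simp
  have zero: "fst (scaled t1 t2 x) * snd (scaled t1 t2 x) = 0" for x
    using t(3) by (auto simp: scaled_def)
  have "fpf_prob M P Y1 Y2 k t1 t2 = (\<integral>x. pois k (lam * (fst (scaled t1 t2 x) * snd (scaled t1 t2 x))) \<partial>Q)"
    using fpf_prob_eq_expectation[OF fpf \<alpha> lam t(1,2), of k] t
      law[of t1 t2 "\<lambda>y. pois k (lam * (fst y * snd y))"]
    by (simp add: classical_prob_eq_pois mult.assoc)
  also have "\<dots> = (if k = 0 then 1 else 0)"
    unfolding zero using P.prob_space by (simp add: pois_def)
  finally show ?thesis .
qed

text \<open>For indices in \<open>{0<..<1}\<close> each of the three quantities is the expectation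
  of a fixed function of the inverse subordinators, continuous and bounded on the quadrant, so its
  limit is the value at \<open>(t1, t2)\<close>. For the Caputo derivative this value is the
  recurrence expression, that is, the classical mixed derivative.\<close>

lemma fractional_field_limits:
  fixes S :: "real \<Rightarrow> real \<Rightarrow> 'a measure" and k :: nat
  assumes S: "\<And>a b. a \<in> {0<..<1} \<Longrightarrow> b \<in> {0<..<1} \<Longrightarrow>
      fractional_poisson_field (S a b) lam a b (Q a b) (Z1 a b) (Z2 a b)"
    and lam: "0 < lam" and t: "0 < t1" "0 < t2"
  defines "rhs \<equiv> recurrence_rhs lam (classical_prob lam) k"
  shows "((\<lambda>(a, b). fpf_prob (S a b) (Q a b) (Z1 a b) (Z2 a b) k t1 t2)
      \<longlongrightarrow> classical_prob lam k t1 t2) (at_left 1 \<times>\<^sub>F at_left 1)" (is ?prob)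
    and "((\<lambda>(a, b). caputo_mixed a b (fpf_prob (S a b) (Q a b) (Z1 a b) (Z2 a b) k) t1 t2)
      \<longlongrightarrow> mixed_deriv (classical_prob lam k) t1 t2) (at_left 1 \<times>\<^sub>F at_left 1)" (is ?caputo)
    and "((\<lambda>(a, b). averaged rhs (process_density (S a b) (Z1 a b)) (process_density (S a b) (Z2 a b)) t1 t2)
      \<longlongrightarrow> rhs t1 t2) (at_left 1 \<times>\<^sub>F at_left 1)" (is ?averaged)
proof -
  have ev1: "\<forall>\<^sub>F a in at_left 1. a \<in> {0<..<1::real}" by (rule eventually_at_left_real) simp
  have ev: "\<forall>\<^sub>F p in at_left 1 \<times>\<^sub>F at_left 1. 0 < fst p \<and> fst p < (1::real) \<and> 0 < snd p \<and> snd p < (1::real)"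
    using eventually_prodI[OF ev1 ev1] by (rule eventually_mono) auto
  have rhs_bound: "\<bar>rhs x1 x2\<bar> \<le> lam * (4 * real k + 5)" if "0 \<le> x1" "0 \<le> x2" for x1 x2
    unfolding rhs_def using lam that by (rule recurrence_rhs_bound)
  have rhs_cont: "continuous_on UNIV (\<lambda>p. rhs (fst p) (snd p))"
    unfolding rhs_def by (rule continuous_recurrence_rhs)
  have prob_bound: "\<bar>classical_prob lam k x1 x2\<bar> \<le> 1" if "0 \<le> x1" "0 \<le> x2" for x1 x2
    using classical_prob_bounds[OF lam that, of k] by simp
  note lim = tendsto_fractional_field[OF S lam t]
  have lim_rhs: "((\<lambda>(a, b). \<integral>\<omega>. rhs (Z1 a b t1 \<omega>) (Z2 a b t2 \<omega>) \<partial>S a b) \<longlongrightarrow> rhs t1 t2) (at_left 1 \<times>\<^sub>F at_left 1)"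
    by (rule lim[OF _ _ rhs_cont rhs_bound])
  have lim_prob: "((\<lambda>(a, b). \<integral>\<omega>. classical_prob lam k (Z1 a b t1 \<omega>) (Z2 a b t2 \<omega>) \<partial>S a b) \<longlongrightarrow> classical_prob lam k t1 t2)
      (at_left 1 \<times>\<^sub>F at_left 1)"
    by (rule lim[OF _ _ continuous_classical_prob prob_bound])
  show ?prob
  proof (rule Lim_transform_eventually[OF lim_prob], use ev in eventually_elim)
    case (elim p)
    obtain a b where p: "p = (a, b)" by (cases p)
    have ab: "0 < a" "a < 1" "0 < b" "b < 1" using elim by (auto simp: p)
    have "fractional_poisson_field (S a b) lam a b (Q a b) (Z1 a b) (Z2 a b)" using S ab by simp
    from fpf_prob_eq_expectation[OF this ab lam t[THEN less_imp_le]] show ?case by (simp add: p)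
  qed
  show ?caputo
    unfolding classical_prob_mixed rhs_def[symmetric]
  proof (rule Lim_transform_eventually[OF lim_rhs], use ev in eventually_elim)
    case (elim p)
    obtain a b where p: "p = (a, b)" by (cases p)
    have ab: "0 < a" "a < 1" "0 < b" "b < 1" using elim by (auto simp: p)
    have "fractional_poisson_field (S a b) lam a b (Q a b) (Z1 a b) (Z2 a b)" using S ab by simp
    from fractional_field_caputo(2)[OF this ab lam t] show ?case by (simp add: p rhs_def)
  qed
  show ?averaged
  proof (rule Lim_transform_eventually[OF lim_rhs], use ev in eventually_elim)
    case (elim p)
    obtain a b where p: "p = (a, b)" by (cases p)
    have ab: "0 < a" "a < 1" "0 < b" "b < 1" using elim by (auto simp: p)
    have "fractional_poisson_field (S a b) lam a b (Q a b) (Z1 a b) (Z2 a b)" using S ab by simp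
    from fractional_field_averaged(2)[OF this ab lam t rhs_cont rhs_bound] show ?case by (simp add: p)
  qed
qed

text \<open>As \<open>deriv\<close> and the integral are total, the fractional and the classical
  equations are accompanied by existence of the derivatives and, where integrals occur,
  integrability. In the limits each choice of indices may come with its own measure.\<close>

theorem theorem5p1:
  fixes lam \<alpha>1 \<alpha>2 :: real
    and M :: "'a measure" and P :: "'a \<Rightarrow> (real \<times> real) set"
    and Y1 Y2 :: "real \<Rightarrow> 'a \<Rightarrow> real"
  assumes "0 < \<alpha>1" "\<alpha>1 < 1" "0 < \<alpha>2" "\<alpha>2 < 1" "0 < lam"
    and "fractional_poisson_field M lam \<alpha>1 \<alpha>2 P Y1 Y2"
  shows
    \<comment> \<open>1) the fractional differential-integral equations\<close>
    "(\<forall>k. \<forall>t1>0. \<forall>t2>0.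
        caputo_mixed_exists \<alpha>1 \<alpha>2 (fpf_prob M P Y1 Y2 k) t1 t2
      \<and> set_integrable lborel ({0<..} \<times> {0<..})
          (averaged_integrand (recurrence_rhs lam (classical_prob lam) k)
            (process_density M Y1) (process_density M Y2) t1 t2)
      \<and> caputo_mixed \<alpha>1 \<alpha>2 (fpf_prob M P Y1 Y2 k) t1 t2 =
          averaged (recurrence_rhs lam (classical_prob lam) k) (process_density M Y1) (process_density M Y2) t1 t2)
     \<comment> \<open>initial conditions\<close>
   \<and> fpf_prob M P Y1 Y2 0 0 0 = 1
   \<and> (\<forall>k\<ge>1. fpf_prob M P Y1 Y2 k 0 0 = 0
        \<and> (\<forall>t1\<ge>0. fpf_prob M P Y1 Y2 k t1 0 = 0)
        \<and> (\<forall>t2\<ge>0. fpf_prob M P Y1 Y2 k 0 t2 = 0))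
     \<comment> \<open>2) weak convergence of the densities to the delta distribution\<close>
   \<and> (\<forall>(S :: real \<Rightarrow> 'b measure) Z.
        (\<forall>a\<in>{0<..<1}. inverse_stable_subordinator (S a) a (Z a)) \<longrightarrow>
        (\<forall>t>0. \<forall>\<phi> :: real \<Rightarrow> real. continuous_on UNIV \<phi> \<and> bounded (range \<phi>) \<longrightarrow>
          ((\<lambda>a. LINT x : {0<..} | lborel. \<phi> x * process_density (S a) (Z a) t x)
             \<longlongrightarrow> \<phi> t) (at_left 1)))
     \<comment> \<open>both sides of the equations in 1) converge to those of the classical equations\<close>
   \<and> (\<forall>(S :: real \<Rightarrow> real \<Rightarrow> 'c measure) Q Z1 Z2.
        (\<forall>a\<in>{0<..<1}. \<forall>b\<in>{0<..<1}.
          fractional_poisson_field (S a b) lam a b (Q a b) (Z1 a b) (Z2 a b)) \<longrightarrow>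
        (\<forall>k. \<forall>t1>0. \<forall>t2>0.
          ((\<lambda>(a, b). fpf_prob (S a b) (Q a b) (Z1 a b) (Z2 a b) k t1 t2)
             \<longlongrightarrow> classical_prob lam k t1 t2) (at_left 1 \<times>\<^sub>F at_left 1)
        \<and> ((\<lambda>(a, b). caputo_mixed a b (fpf_prob (S a b) (Q a b) (Z1 a b) (Z2 a b) k) t1 t2)
             \<longlongrightarrow> mixed_deriv (classical_prob lam k) t1 t2) (at_left 1 \<times>\<^sub>F at_left 1)
        \<and> ((\<lambda>(a, b). averaged (recurrence_rhs lam (classical_prob lam) k)
               (process_density (S a b) (Z1 a b)) (process_density (S a b) (Z2 a b)) t1 t2)
             \<longlongrightarrow> recurrence_rhs lam (classical_prob lam) k t1 t2) (at_left 1 \<times>\<^sub>F at_left 1)))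
     \<comment> \<open>the classical equations and the marginal distributions of the classical field\<close>
   \<and> (\<forall>k. \<forall>t1\<ge>0. \<forall>t2\<ge>0.
        measure M {\<omega> \<in> space M. count_field P t1 t2 \<omega> = k} = classical_prob lam k t1 t2
      \<and> mixed_differentiable (classical_prob lam k) t1 t2
      \<and> mixed_deriv (classical_prob lam k) t1 t2 = recurrence_rhs lam (classical_prob lam) k t1 t2)"
proof -
  note \<alpha> = assms(1-4) and lam = assms(5) and fpf = assms(6)
  let ?rhs = "recurrence_rhs lam (classical_prob lam)"
  note averaged_rhs = fractional_field_averaged[OF fpf \<alpha> lam _ _ continuous_recurrence_rhs recurrence_rhs_bound[OF lam]]
  have boundary: "fpf_prob M P Y1 Y2 k t1 t2 = (if k = 0 then 1 else 0)"
    if "0 \<le> t1" "0 \<le> t2" "t1 = 0 \<or> t2 = 0" for k t1 t2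
    using fractional_field_boundary[OF fpf \<alpha> lam that] .
  have weak: "((\<lambda>a. LINT x : {0<..} | lborel. \<phi> x * process_density (S a) (Z a) t x) \<longlongrightarrow> \<phi> t) (at_left 1)"
    if S: "\<forall>a\<in>{0<..<1}. inverse_stable_subordinator (S a) a (Z a)" and t: "0 < t"
      and \<phi>: "continuous_on UNIV \<phi>" "bounded (range \<phi>)"
    for S :: "real \<Rightarrow> 'b measure" and Z t and \<phi> :: "real \<Rightarrow> real"
  proof (rule Lim_transform_eventually[OF tendsto_inverse_stable[OF _ t \<phi>, of S Z]])
    have "\<forall>\<^sub>F a in at_left 1. a \<in> {0<..<1::real}" by (rule eventually_at_left_real) simp
    then show "\<forall>\<^sub>F a in at_left 1. (\<integral>\<omega>. \<phi> (Z a t \<omega>) \<partial>S a)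
        = (LINT x : {0<..} | lborel. \<phi> x * process_density (S a) (Z a) t x)"
    proof eventually_elim
      case (elim a)
      then show ?case
        using integral_process_density[of "S a" a "Z a" t \<phi>] S t borel_measurable_continuous_onI[OF \<phi>(1)]
        by simp
    qed
  qed (use S in auto)
  have classical: "measure M {\<omega> \<in> space M. count_field P t1 t2 \<omega> = k} = classical_prob lam k t1 t2"
    if "0 \<le> t1" "0 \<le> t2" for k t1 t2
    using poisson_count_field_prob[OF fpf_poisson[OF fpf \<alpha> lam that] that] .
  show ?thesis
  proof (intro conjI)
    show "fpf_prob M P Y1 Y2 0 0 0 = 1" by (simp add: boundary)
    show "\<forall>k\<ge>1. fpf_prob M P Y1 Y2 k 0 0 = 0
        \<and> (\<forall>t1\<ge>0. fpf_prob M P Y1 Y2 k t1 0 = 0)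
        \<and> (\<forall>t2\<ge>0. fpf_prob M P Y1 Y2 k 0 t2 = 0)"
      by (simp add: boundary)
  qed (intro allI impI conjI fractional_field_limits[OF _ lam];
    use weak classical classical_prob_mixed in \<open>blast | simp add: fractional_field_caputo[OF fpf \<alpha> lam] averaged_rhs\<close>)+
qed

end
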